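(* Let $k\ge2$ be an integer. Let $\tau=u+iv\in\mathbb H$ and $q=e^{2\pi i\tau}$. Define the $q$-series \[ g_k(q):=\left[\left(\zeta\frac{d}{d\zeta}\right)^k\sum_{r\ge1}\operatorname{Log}\bigl(1+\zeta^{1/r}q^r\bigr)\right]_{\zeta=1}, \] where $\operatorname{Log}$ is the principal branch of the logarithm. Define also \[ \widehat g_k(\tau):=\frac{(-1)^{k+1}(4\pi)^k(k-1)!\,B_{2k}}{2(2k)!}\Bigl(E(\tau;k)-2^kE(2\tau;k)\Bigr), \] where $B_{2k}$ is the $2k$-th Bernoulli number. Then: 1. $g_k(q)$ is the holomorphic part of $\widehat g_k(\tau)$; 2. $\widehat g_k$ is a Maass form of weight $0$ on $\Gamma_0(2)$ with eigenvalue $k(1-k)$.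
   Context: **Maass Eisenstein series.** For $\operatorname{Re}(s)>1$, \[ E(\tau;s):=\sum_{\gamma\in\Gamma_\infty\backslash \mathrm{SL}_2(\mathbb Z)}\operatorname{Im}(\gamma\tau)^s, \] where $\Gamma_\infty=\{\pm\begin{pmatrix}1&n\\0&1\end{pmatrix}:n\in\mathbb Z\}$. **Holomorphic part.** Consider a function that can be written as a sum of terms $a\,v^{k}$, $b\,v^{1-k}$, and finitely many terms $v^{-r}\sum_{n\ge1}\bigl(a_r(n)q^n+b_r(n)\overline q^{\,n}\bigr)$ with $r\ge0$. Its holomorphic part means the contribution that is a pure $q$-series, namely $\sum_{n\ge1}a_0(n)q^n$. In particular, no terms involving $\overline q$ or negative or positive powers of $v$ are included. **Maass form.** A real-analytic $f:\mathbb H\to\mathbb C$ is a (weak) Maass form of weight $0$ and eigenvalue $\lambda$ on $\Gamma_0(N)$ if it satisfies the following three conditions: 1. $f(\gamma\tau)=f(\tau)$ for all $\gamma\in\Gamma_0(N)$; 2. $\Delta_0 f=\lambda f$, where $\Delta_0=-v^2\bigl(\frac{\partial^2}{\partial u^2}+\frac{\partial^2}{\partial v^2}\bigr)$; 3. $f$ has at most linear exponential growth at the cusps. *)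

theory Defs
  imports "HOL-Analysis.Analysis" "HOL-Computational_Algebra.Formal_Power_Series"
begin

definition upper_half_plane :: "complex set" where
  "upper_half_plane = {\<tau>. Im \<tau> > 0}"

definition nome :: "complex \<Rightarrow> complex" where
  "nome \<tau> = exp (2 * of_real pi * \<i> * \<tau>)"

(* t / (e^t - 1) = (\<Sum>n. B_n t^n / n!) *)
definition bernoulli_number :: "nat \<Rightarrow> real" where
  "bernoulli_number n = fact n * fps_nth (fps_X / (fps_exp 1 - 1)) n"

subsection \<open>The modular group and its action\<close>

definition SL2Z :: "(int ^ 2 ^ 2) set" where
  "SL2Z = {A. det A = 1}"

definition Gamma_infinity :: "(int ^ 2 ^ 2) set" where
  "Gamma_infinity = (\<Union>n. {vector [vector [1, n], vector [0, 1]],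
                            - vector [vector [1, n], vector [0, 1]]})"

definition Gamma0 :: "nat \<Rightarrow> (int ^ 2 ^ 2) set" where
  "Gamma0 N = {A \<in> SL2Z. int N dvd A $ 2 $ 1}"

definition modular_act :: "int ^ 2 ^ 2 \<Rightarrow> complex \<Rightarrow> complex" where
  "modular_act A = moebius (of_int (A $ 1 $ 1)) (of_int (A $ 1 $ 2))
                           (of_int (A $ 2 $ 1)) (of_int (A $ 2 $ 2))"

definition Gamma_infinity_rel :: "((int ^ 2 ^ 2) \<times> (int ^ 2 ^ 2)) set" where
  "Gamma_infinity_rel = {(A, B). A \<in> SL2Z \<and> B \<in> SL2Z \<and> (\<exists>P\<in>Gamma_infinity. B = P ** A)}"

subsection \<open>The Maass Eisenstein series\<close>

(* Im (\<gamma> \<tau>) depends only on the coset of \<gamma>, so the representative chosen in each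
   coset is immaterial. The series converges absolutely, and the definition is meant,
   for Re s > 1 only. *)
definition maass_eisenstein :: "complex \<Rightarrow> complex \<Rightarrow> complex" where
  "maass_eisenstein \<tau> s =
     (\<Sum>\<^sub>\<infinity>C \<in> SL2Z // Gamma_infinity_rel.
        of_real (Im (modular_act (SOME A. A \<in> C) \<tau>)) powr s)"

subsection \<open>Weak Maass forms of weight zero\<close>

definition real_analytic_on :: "(complex \<Rightarrow> complex) \<Rightarrow> complex set \<Rightarrow> bool" where
  "real_analytic_on f S \<longleftrightarrow>
     (\<forall>z\<in>S. \<exists>r>0. \<exists>c :: nat \<Rightarrow> nat \<Rightarrow> complex. \<forall>w\<in>ball z r.
        ((\<lambda>(m, n). c m n * of_real (Re (w - z)) ^ m * of_real (Im (w - z)) ^ n)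
           has_sum f w) UNIV)"

definition deriv_u :: "(complex \<Rightarrow> complex) \<Rightarrow> complex \<Rightarrow> complex" where
  "deriv_u f \<tau> = vector_derivative (\<lambda>t. f (\<tau> + of_real t)) (at 0)"

definition deriv_v :: "(complex \<Rightarrow> complex) \<Rightarrow> complex \<Rightarrow> complex" where
  "deriv_v f \<tau> = vector_derivative (\<lambda>t. f (\<tau> + \<i> * of_real t)) (at 0)"

definition hyperbolic_laplacian :: "(complex \<Rightarrow> complex) \<Rightarrow> complex \<Rightarrow> complex" where
  "hyperbolic_laplacian f \<tau> =
     - (of_real (Im \<tau>))\<^sup>2 * (deriv_u (deriv_u f) \<tau> + deriv_v (deriv_v f) \<tau>)"

(* Every cusp has the form A \<infinity> with A in SL2Z, so the growth at the cusps is that of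
   f (A \<tau>) as v \<rightarrow> \<infinity>, uniformly in u. *)
definition linear_exponential_growth_at_cusps :: "(complex \<Rightarrow> complex) \<Rightarrow> bool" where
  "linear_exponential_growth_at_cusps f \<longleftrightarrow>
     (\<forall>A\<in>SL2Z. \<exists>C M V :: real. V > 0 \<and>
        (\<forall>\<tau>. Im \<tau> \<ge> V \<longrightarrow> norm (f (modular_act A \<tau>)) \<le> M * exp (C * Im \<tau>)))"

definition maass_form_weight_0 :: "nat \<Rightarrow> complex \<Rightarrow> (complex \<Rightarrow> complex) \<Rightarrow> bool" where
  "maass_form_weight_0 N l f \<longleftrightarrow>
     real_analytic_on f upper_half_plane \<and>
     (\<forall>A\<in>Gamma0 N. \<forall>\<tau>\<in>upper_half_plane. f (modular_act A \<tau>) = f \<tau>) \<and>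
     (\<forall>\<tau>\<in>upper_half_plane. hyperbolic_laplacian f \<tau> = l * f \<tau>) \<and>
     linear_exponential_growth_at_cusps f"

subsection \<open>Holomorphic parts\<close>

(* The coefficients of q^(n+1) are a r n, those of the conjugate are b r n.
   The expansion determines a and b, hence h on the upper half plane. *)
definition is_holomorphic_part ::
    "nat \<Rightarrow> (complex \<Rightarrow> complex) \<Rightarrow> (complex \<Rightarrow> complex) \<Rightarrow> bool" where
  "is_holomorphic_part k f h \<longleftrightarrow>
     (\<exists>(\<alpha> :: complex) (\<beta> :: complex) (R :: nat)
        (a :: nat \<Rightarrow> nat \<Rightarrow> complex) (b :: nat \<Rightarrow> nat \<Rightarrow> complex).
        \<forall>\<tau>\<in>upper_half_plane.
          (\<forall>r\<le>R. summable (\<lambda>n. a r n * nome \<tau> ^ Suc n) \<and>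
                  summable (\<lambda>n. b r n * cnj (nome \<tau>) ^ Suc n)) \<and>
          f \<tau> = \<alpha> * of_real (Im \<tau>) ^ k + \<beta> * of_real (Im \<tau>) powi (1 - int k) +
            (\<Sum>r\<le>R. of_real (Im \<tau>) powi (- int r) *
               (\<Sum>n. a r n * nome \<tau> ^ Suc n + b r n * cnj (nome \<tau>) ^ Suc n)) \<and>
          h \<tau> = (\<Sum>n. a 0 n * nome \<tau> ^ Suc n))"

subsection \<open>The functions of the theorem\<close>

definition euler_op :: "(complex \<Rightarrow> complex) \<Rightarrow> complex \<Rightarrow> complex" where
  "euler_op F = (\<lambda>\<zeta>. \<zeta> * deriv F \<zeta>)"

(* Here \<zeta> powr (1 / r) is the principal r-th root, holomorphic near \<zeta> = 1; the summand
   with index r of the suminf belongs to Suc r. *)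
definition g_series :: "nat \<Rightarrow> complex \<Rightarrow> complex" where
  "g_series k q =
     (euler_op ^^ k) (\<lambda>\<zeta>. \<Sum>r. Ln (1 + \<zeta> powr (1 / of_nat (Suc r)) * q ^ Suc r)) 1"

definition g_hat :: "nat \<Rightarrow> complex \<Rightarrow> complex" where
  "g_hat k \<tau> =
     (-1) ^ (k + 1) * (4 * of_real pi) ^ k * fact (k - 1) * of_real (bernoulli_number (2 * k))
       / (2 * fact (2 * k)) *
     (maass_eisenstein \<tau> (of_nat k) - 2 ^ k * maass_eisenstein (2 * \<tau>) (of_nat k))"

end

theory Submission
  imports Defs "HOL-Complex_Analysis.Complex_Analysis"
begin

text \<open>
  Starting from the partial fractions of the cotangent, repeated differentiation in \<open>v\<close> of
  \<open>\<Sum>n. 1 / ((u + n)\<^sup>2 + v\<^sup>2)\<close> expands \<open>\<Sum>n. 1 / |\<tau> + n|\<^sup>2\<^sup>k\<close> in powers of \<open>1 / v\<close> times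
  series in \<open>q\<close>; only finitely many powers occur because \<open>k\<close> is an integer. Summing over the
  multiples \<open>m \<tau>\<close> gives the Fourier expansion of \<open>\<zeta>(2k) E(\<tau>; k)\<close>, and \<open>u = 0\<close> in the cotangent
  formula evaluates \<open>\<zeta>(2k)\<close> by Bernoulli numbers. The Laplace equation is then the two-term
  recursion of the coefficients, real analyticity and growth are read off the expansion, and
  modularity comes from the lattice sum. On the other side, the Euler operator acts on
  \<open>\<Sum>(-1)\<^sup>m\<^sup>-\<^sup>1 \<zeta>\<^sup>m\<^sup>/\<^sup>r q\<^sup>r\<^sup>m / m\<close> by the factor \<open>m / r\<close>; the sign \<open>(-1)\<^sup>m\<^sup>-\<^sup>1\<close> is what
  \<open>E(\<tau>; k) - 2\<^sup>k E(2\<tau>; k)\<close> produces.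
\<close>

(* HOL-Analysis leaves this infix enabled, where it clashes with vec_nth. *)
no_notation fps_nth (infixl "$" 75)

subsection \<open>Power series in the nome\<close>

text \<open>Rearranging series is the main obstacle. The lattice terms are nonnegative, so iterated
  sums over the lattice are unconditional; the complex double series are majorized on pairs
  \<open>(i, j)\<close> by a product of two one-variable series. No Poisson summation and no Bessel
  function is involved: everything is elementary calculus in the height \<open>v\<close>. The
  coefficient of v^(1-k) is never computed. It is carried as an existential constant, which is
  harmless because v^k and v^(1-k) are both eigenfunctions with eigenvalue k(1-k). What must be
  exact is the q-series without a power of \<open>v\<close>. There the Bernoulli number turns into
  zeta(2k) and cancels the zeta(2k) by which sums over all pairs and over coprime pairs differ, and
  the remaining constants of \<open>g_hat\<close> make the leading coefficient exactly 1. The cusps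
  other than infinity get no expansions of their own: invariance under the full modular group sends
  the value at \<open>A \<tau>\<close> back to \<open>\<tau>\<close>, and the value at twice
  \<open>A \<tau>\<close> to one of three points of comparable height.\<close>

definition disc_summable :: "(nat \<Rightarrow> complex) \<Rightarrow> bool" where
  "disc_summable a \<longleftrightarrow> (\<forall>z. norm z < 1 \<longrightarrow> summable (\<lambda>n. a n * z ^ n))"

(* As in is_holomorphic_part, a n is the coefficient of q^(n+1). *)
definition qsum :: "(nat \<Rightarrow> complex) \<Rightarrow> complex \<Rightarrow> complex" where
  "qsum a \<tau> = (\<Sum>n. a n * nome \<tau> ^ Suc n)"

lemma norm_nome: "norm (nome \<tau>) = exp (- 2 * pi * Im \<tau>)"
  by (simp add: nome_def)

lemma norm_nome_less_1: "Im \<tau> > 0 \<Longrightarrow> norm (nome \<tau>) < 1"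
  by (simp add: norm_nome)

lemma nome_nonzero [simp]: "nome \<tau> \<noteq> 0"
  by (simp add: nome_def)

lemma nome_power: "nome \<tau> ^ n = nome (of_nat n * \<tau>)"
  by (simp add: nome_def exp_of_nat_mult [symmetric] mult_ac)

text \<open>Convergence at one real point strictly between \<open>norm z\<close> and 1 forces
  absolute convergence at \<open>z\<close>.\<close>

lemma disc_summableD_norm:
  assumes "disc_summable a" "norm z < 1"
  shows "summable (\<lambda>n. norm (a n * z ^ n))"
proof -
  obtain r where r: "norm z < r" "r < 1" using assms(2) dense by blast
  then have "r > 0" using norm_ge_zero[of z] by linarith
  then have "summable (\<lambda>n. a n * (of_real r) ^ n)"
    using assms(1) r unfolding disc_summable_def by simp
  then show ?thesis
    by (rule powser_insidea) (use r \<open>r > 0\<close> in simp)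
qed

lemma disc_summableD_Suc_norm:
  assumes "disc_summable a" "norm z < 1"
  shows "summable (\<lambda>n. norm (a n * z ^ Suc n))"
  using summable_mult[OF disc_summableD_norm[OF assms], of "norm z"]
  by (simp add: norm_mult mult_ac)

lemma disc_summableD_Suc:
  assumes "disc_summable a" "norm z < 1"
  shows "summable (\<lambda>n. a n * z ^ Suc n)"
  using disc_summableD_Suc_norm[OF assms] by (rule summable_norm_cancel)

lemma disc_summable_const: "disc_summable (\<lambda>_. c)"
  unfolding disc_summable_def by (simp add: summable_mult summable_geometric)

lemma disc_summable_cmult: "disc_summable a \<Longrightarrow> disc_summable (\<lambda>n. c * a n)"
  unfolding disc_summable_def by (simp add: summable_mult mult.assoc)

lemma disc_summable_diff:
  "disc_summable a \<Longrightarrow> disc_summable b \<Longrightarrow> disc_summable (\<lambda>n. a n - b n)"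
  unfolding disc_summable_def by (auto simp: left_diff_distrib intro: summable_diff)

lemma powser_Suc_has_field_derivative:
  assumes "disc_summable a" "norm z < 1"
  shows "disc_summable (\<lambda>n. of_nat (Suc n) * a n)"
    and "((\<lambda>z. \<Sum>n. a n * z ^ Suc n) has_field_derivative
           (\<Sum>n. of_nat (Suc n) * a n * z ^ n)) (at z)"
proof -
  \<comment> \<open>A zero constant term is prepended: \<open>c\<close> lists the coefficients by
    their true exponents, so that \<open>diffs c\<close> belongs to the derivative.\<close>
  define c where "c = (\<lambda>n. case n of 0 \<Rightarrow> 0 | Suc m \<Rightarrow> a m)"
  have sm: "summable (\<lambda>n. c n * w ^ n)" if "norm w < 1" for w
    by (subst summable_Suc_iff [symmetric])
       (use disc_summableD_Suc[OF assms(1) that] in \<open>simp add: c_def\<close>)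
  have diffs: "diffs c n = of_nat (Suc n) * a n" for n
    by (simp add: diffs_def c_def)
  show "disc_summable (\<lambda>n. of_nat (Suc n) * a n)"
    unfolding disc_summable_def
    using termdiff_converges[of _ 1 c] sm by (auto simp: diffs)
  have eq: "(\<Sum>n. c n * w ^ n) = (\<Sum>n. a n * w ^ Suc n)" if "norm w < 1" for w
    using suminf_split_head[OF sm[OF that]] by (simp add: c_def)
  have "((\<lambda>w. \<Sum>n. c n * w ^ n) has_field_derivative (\<Sum>n. diffs c n * z ^ n)) (at z)"
    by (rule termdiffs_strong'[of 1]) (use sm assms in auto)
  then have "((\<lambda>z. \<Sum>n. a n * z ^ Suc n) has_field_derivative (\<Sum>n. diffs c n * z ^ n)) (at z)"
    by (rule has_field_derivative_transform_within_open[where S = "ball 0 1"])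
       (use assms eq in auto)
  then show "((\<lambda>z. \<Sum>n. a n * z ^ Suc n) has_field_derivative
           (\<Sum>n. of_nat (Suc n) * a n * z ^ n)) (at z)"
    by (simp add: diffs)
qed

lemma disc_summable_deriv:
  assumes "disc_summable a" shows "disc_summable (\<lambda>n. of_nat (Suc n) * a n)"
  using powser_Suc_has_field_derivative(1)[OF assms, of 0] by simp

text \<open>Each application of q d/dq multiplies by \<open>Suc n\<close>, so these are iterated
  derivatives of the geometric series.\<close>

lemma disc_summable_power: "disc_summable (\<lambda>n. of_nat (Suc n) ^ p)"
  by (induction p) (use disc_summable_const[of 1] disc_summable_deriv in \<open>auto simp del: of_nat_Suc\<close>)

lemma qsum_has_field_derivative:
  assumes "disc_summable a" "Im \<tau> > 0"
  shows "(qsum a has_field_derivative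
           2 * of_real pi * \<i> * qsum (\<lambda>n. of_nat (Suc n) * a n) \<tau>) (at \<tau>)"
proof -
  have q: "norm (nome \<tau>) < 1" using assms by (simp add: norm_nome_less_1)
  have n: "(nome has_field_derivative 2 * of_real pi * \<i> * nome \<tau>) (at \<tau>)"
    unfolding nome_def by (auto intro!: derivative_eq_intros)
  have "summable (\<lambda>n. of_nat (Suc n) * a n * nome \<tau> ^ n)"
    using disc_summable_deriv[OF assms(1)] q unfolding disc_summable_def by blast
  then have "qsum (\<lambda>n. of_nat (Suc n) * a n) \<tau> = nome \<tau> * (\<Sum>n. of_nat (Suc n) * a n * nome \<tau> ^ n)"
    unfolding qsum_def by (subst suminf_mult [symmetric]) (auto simp: mult_ac)
  then show ?thesis
    using DERIV_chain2[OF powser_Suc_has_field_derivative(2)[OF assms(1) q] n]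
    unfolding qsum_def by (simp add: mult_ac)
qed

subsection \<open>The cotangent expansion and its derivatives\<close>

text \<open>The reflection formula Gamma(z) Gamma(1 - z) = pi / sin(pi z) is differentiated and the
  common nonzero factor cancelled.\<close>

lemma Digamma_reflection:
  fixes z :: complex
  assumes "z \<notin> \<int>"
  shows "Digamma (1 - z) - Digamma z = of_real pi * cos (of_real pi * z) / sin (of_real pi * z)"
proof -
  have z: "z \<notin> \<int>\<^sub>\<le>\<^sub>0" "1 - z \<notin> \<int>\<^sub>\<le>\<^sub>0"
    using assms nonpos_Ints_Int Ints_diff[of 1 "1 - z"] by auto
  have s: "sin (of_real pi * z) \<noteq> 0"
    using assms by (auto simp: sin_eq_0 algebra_simps Ints_def)
  have "((\<lambda>z. Gamma z * Gamma (1 - z)) has_field_derivative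
           (Gamma z * Gamma (1 - z)) * (Digamma z - Digamma (1 - z))) (at z)"
    using z by (auto intro!: derivative_eq_intros simp: algebra_simps)
  moreover have "((\<lambda>z. of_real pi / sin (of_real pi * z)) has_field_derivative
           - (of_real pi)\<^sup>2 * cos (of_real pi * z) / (sin (of_real pi * z))\<^sup>2) (at z)"
    using s by (auto intro!: derivative_eq_intros simp: power2_eq_square)
  ultimately have "(Gamma z * Gamma (1 - z)) * (Digamma z - Digamma (1 - z)) =
      - (of_real pi)\<^sup>2 * cos (of_real pi * z) / (sin (of_real pi * z))\<^sup>2"
    unfolding Gamma_reflection_complex using DERIV_unique by blast
  then have "(of_real pi / sin (of_real pi * z)) * (Digamma z - Digamma (1 - z)) =
      (of_real pi / sin (of_real pi * z)) * - (of_real pi * cos (of_real pi * z) / sin (of_real pi * z))"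
    by (simp add: Gamma_reflection_complex power2_eq_square)
  moreover have "of_real pi / sin (of_real pi * z) \<noteq> 0" using s by simp
  ultimately have "Digamma z - Digamma (1 - z) =
      - (of_real pi * cos (of_real pi * z) / sin (of_real pi * z))"
    using mult_left_cancel by blast
  then show ?thesis by (simp add: algebra_simps)
qed

text \<open>This is the imaginary part of pi cot(pi z), sign reversed. The limit formula of
  \<open>Digamma\<close> provides the partial fractions with the integers \<open>n\<close> and
  \<open>- 1 - n\<close> paired, and on the other side pi cot(pi z) = - i pi (1 + 2 q / (1 -
  q)).\<close>

lemma inverse_quadratic_sums:
  assumes "v > 0"
  shows "(\<lambda>n. 1 / ((u + real n)\<^sup>2 + v\<^sup>2) + 1 / ((u - 1 - real n)\<^sup>2 + v\<^sup>2)) sums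
           (pi / v * (1 + 2 * Re (qsum (\<lambda>_. 1) (Complex u v))))"
proof -
  define z where "z = Complex u v"
  have z: "z \<notin> \<int>" using assms by (auto simp: z_def Ints_def complex_eq_iff)
  then have z0: "z \<noteq> 0" "1 - z \<noteq> 0" by auto
  \<comment> \<open>The same logarithm occurs in both limits and drops out of the
    difference.\<close>
  have "(\<lambda>m. (of_real (ln (real m)) - (\<Sum>n<m. inverse (1 - z + of_nat n))) -
             (of_real (ln (real m)) - (\<Sum>n<m. inverse (z + of_nat n))))
          \<longlonglongrightarrow> Digamma (1 - z) - Digamma z"
    by (intro tendsto_diff Digamma_LIMSEQ z0)
  then have "(\<lambda>n. inverse (z + of_nat n) - inverse (1 - z + of_nat n)) sums
               (Digamma (1 - z) - Digamma z)"
    by (simp add: sums_def sum_subtractf)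
  from sums_Im[OF sums_minus[OF this]]
  have *: "(\<lambda>n. Im (- (inverse (z + of_nat n) - inverse (1 - z + of_nat n)))) sums
          - Im (Digamma (1 - z) - Digamma z)" by simp
  have t: "Im (- (inverse (z + of_nat n) - inverse (1 - z + of_nat n))) =
     v * (1 / ((u + real n)\<^sup>2 + v\<^sup>2) + 1 / ((u - 1 - real n)\<^sup>2 + v\<^sup>2))" for n
  proof -
    have "(1 - u + real n)\<^sup>2 = (u - 1 - real n)\<^sup>2" by (simp add: power2_eq_square algebra_simps)
    then show ?thesis by (simp add: z_def minus_divide_left [symmetric] add_ac ring_distribs)
  qed
  define q where "q = nome z"
  have q: "norm q < 1" using assms by (simp add: q_def norm_nome_less_1 z_def)
  then have q1: "q \<noteq> 1" by auto
  have qs: "qsum (\<lambda>_. 1) z = q / (1 - q)"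
  proof -
    have "(\<lambda>n. q * q ^ n) sums (q * (1 / (1 - q)))" by (intro sums_mult geometric_sums q)
    then show ?thesis unfolding qsum_def q_def by (simp add: sums_iff)
  qed
  \<comment> \<open>A square root of \<open>q\<close>, in which sine and cosine are
    rational.\<close>
  define e where "e = exp (\<i> * of_real pi * z)"
  have e: "e \<noteq> 0" "e\<^sup>2 = q" "exp (- (\<i> * (of_real pi * z))) = inverse e" "exp (\<i> * (of_real pi * z)) = e"
    by (simp_all add: e_def q_def nome_def power2_eq_square exp_add [symmetric] exp_minus algebra_simps)
  have "of_real pi * cos (of_real pi * z) / sin (of_real pi * z) =
      - \<i> * of_real pi * (1 + 2 * (q / (1 - q)))"
  proof -
    have "e\<^sup>2 \<noteq> 1" using q1 e by simp
    then have "e - inverse e \<noteq> 0" "1 - e\<^sup>2 \<noteq> 0"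
      using e(1) by (auto simp: field_simps power2_eq_square)
    have sc: "sin (of_real pi * z) = (e - inverse e) / (2 * \<i>)"
      "cos (of_real pi * z) = (e + inverse e) / 2"
      by (simp_all add: sin_exp_eq cos_exp_eq e(3,4))
    show ?thesis
      unfolding e(2) [symmetric] sc
      using e(1) \<open>e - inverse e \<noteq> 0\<close> \<open>1 - e\<^sup>2 \<noteq> 0\<close>
      by (simp add: divide_simps) (simp add: field_simps power2_eq_square)
  qed
  then have "- Im (Digamma (1 - z) - Digamma z) = pi * (1 + 2 * Re (qsum (\<lambda>_. 1) z))"
    unfolding Digamma_reflection[OF z] qs by (simp del: times_divide_eq_right)
  with * t have "(\<lambda>n. v * (1 / ((u + real n)\<^sup>2 + v\<^sup>2) + 1 / ((u - 1 - real n)\<^sup>2 + v\<^sup>2))) sums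
     (pi * (1 + 2 * Re (qsum (\<lambda>_. 1) z)))" by simp
  from sums_mult[OF this, of "1 / v"] show ?thesis
    using assms by (simp add: z_def)
qed

(* Here and below K = k - 1. Up to the factor pi^k / (k - 1)! these are the coefficients of the
   terminating expansion of the modified Bessel function of the second kind of order K + 1/2. *)
definition bessel_coeff :: "nat \<Rightarrow> nat \<Rightarrow> real" where
  "bessel_coeff K r = pi ^ Suc K * fact (K + r) / (fact K * fact r * fact (K - r) * (4 * pi) ^ r)"

section \<open>Recursions of the Bessel coefficients\<close>

lemma bessel_coeff_Suc_0: "bessel_coeff (Suc K) 0 = pi / Suc K * bessel_coeff K 0"
  by (simp add: bessel_coeff_def divide_simps del: of_nat_Suc)

text \<open>In the quotient of neighbouring coefficients only one factor of each factorial survives.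
  Besides serving the induction on \<open>K\<close>, this is the identity that makes the Laplace
  equation hold, by way of \<open>hat_coeff_Suc\<close>.\<close>

lemma bessel_coeff_Suc_right:
  assumes "r < K"
  shows "4 * pi * (real r + 1) * bessel_coeff K (Suc r) = (real K + real r + 1) * (real K - real r) * bessel_coeff K r"
proof -
  obtain d where K: "K - r = Suc d" "K - Suc r = d" and d: "real K - real r = real (Suc d)"
    using assms by (metis Suc_diff_Suc less_imp_le of_nat_diff)
  have f: "fact (K + Suc r) = (real K + real r + 1) * fact (K + r)"
     "fact (Suc r) = (real r + 1) * (fact r :: real)" "fact (Suc d) = real (Suc d) * fact d"
     "(4 * pi) ^ Suc r = 4 * pi * (4 * pi) ^ r"
    by (simp_all add: algebra_simps)
  have "real r + 1 \<noteq> 0" "real (Suc d) \<noteq> 0" by (auto simp del: of_nat_Suc)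
  then show ?thesis
    unfolding bessel_coeff_def K d f by (simp add: divide_simps del: of_nat_Suc)
qed

lemma bessel_coeff_Suc_Suc_aux:
  "4 * (real r + 1) * (real K + 1) * bessel_coeff (Suc K) (Suc r) = (real K + real r + 2) * (real K + real r + 1) * bessel_coeff K r"
proof -
  have f: "fact (Suc K + Suc r) = (real K + real r + 2) * ((real K + real r + 1) * fact (K + r))"
     "fact (Suc r) = (real r + 1) * (fact r :: real)" "fact (Suc K) = (real K + 1) * (fact K :: real)"
     "(4 * pi) ^ Suc r = 4 * pi * (4 * pi) ^ r" "pi ^ Suc (Suc K) = pi * pi ^ Suc K"
    by (simp_all add: algebra_simps)
  have nz: "real r + 1 \<noteq> 0" "real K + 1 \<noteq> 0" by auto
  show ?thesis
    unfolding bessel_coeff_def f diff_Suc_Suc using nz by (simp add: divide_simps del: power_Suc)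
qed

text \<open>The recursion mirrors the operator -1 / (2 (K + 1) v) d/dv: its first summand comes from
  differentiating the cosine series, its second from differentiating the power of \<open>v\<close>.
  At the index 0 only the first source contributes, at the index \<open>Suc K\<close> only the
  second, whence the two boundary lemmas.\<close>

lemma bessel_coeff_Suc_Suc:
  assumes "r < K"
  shows "bessel_coeff (Suc K) (Suc r) = pi / Suc K * bessel_coeff K (Suc r) + (Suc K + r) / (2 * Suc K) * bessel_coeff K r"
proof -
  have nz: "4 * (real r + 1) * (real K + 1) \<noteq> 0" by auto
  have "4 * (real r + 1) * (real K + 1) * (pi / Suc K * bessel_coeff K (Suc r) + (Suc K + r) / (2 * Suc K) * bessel_coeff K r)
     = 4 * pi * (real r + 1) * bessel_coeff K (Suc r) + 2 * (real r + 1) * (real K + 1 + real r) * bessel_coeff K r"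
    by (simp add: divide_simps) (simp add: algebra_simps)
  also have "\<dots> = 4 * (real r + 1) * (real K + 1) * bessel_coeff (Suc K) (Suc r)"
    unfolding bessel_coeff_Suc_right[OF assms] bessel_coeff_Suc_Suc_aux by (simp add: algebra_simps)
  finally show ?thesis using nz mult_left_cancel by metis
qed

lemma bessel_coeff_Suc_last: "bessel_coeff (Suc K) (Suc K) = (Suc K + K) / (2 * Suc K) * bessel_coeff K K"
proof -
  have "2 * (real K + 1) * (2 * (real K + 1) * bessel_coeff (Suc K) (Suc K)) = 2 * (real K + 1) * ((Suc K + K) * bessel_coeff K K)"
    using bessel_coeff_Suc_Suc_aux[of K K] by (simp add: algebra_simps)
  then have "2 * (real K + 1) * bessel_coeff (Suc K) (Suc K) = (Suc K + K) * bessel_coeff K K"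
    by (subst (asm) mult_left_cancel) auto
  then show ?thesis by (simp add: field_simps)
qed

text \<open>This is 2 times the sum over n \<ge> 1 of n^j e^(-2 pi n v) cos(2 pi n u).\<close>

definition cosine_series :: "nat \<Rightarrow> real \<Rightarrow> real \<Rightarrow> real" where
  "cosine_series j u v = 2 * Re (qsum (\<lambda>n. of_nat (Suc n) ^ j) (Complex u v))"

lemma cosine_series_has_real_derivative:
  assumes "v > 0"
  shows "((cosine_series j u) has_real_derivative (- 2 * pi * cosine_series (Suc j) u v)) (at v)"
proof -
  have c: "((\<lambda>t. Complex u t) has_vector_derivative \<i>) (at v)"
    unfolding Complex_eq by (auto intro!: derivative_eq_intros simp: has_vector_derivative_def scaleR_conv_of_real)
  have q: "(qsum (\<lambda>n. of_nat (Suc n) ^ j) has_field_derivative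
           2 * of_real pi * \<i> * qsum (\<lambda>n. of_nat (Suc n) ^ Suc j) (Complex u v)) (at (Complex u v))"
    using qsum_has_field_derivative[OF disc_summable_power[of j], of "Complex u v"] assms by simp
  have "((\<lambda>t. Re (qsum (\<lambda>n. of_nat (Suc n) ^ j) (Complex u t))) has_vector_derivative
     Re (\<i> * (2 * of_real pi * \<i> * qsum (\<lambda>n. of_nat (Suc n) ^ Suc j) (Complex u v)))) (at v)"
    using bounded_linear.has_vector_derivative[OF bounded_linear_Re field_vector_diff_chain_at[OF c q]]
    by (simp add: o_def del: power_Suc of_nat_Suc)
  then have "((\<lambda>t. Re (qsum (\<lambda>n. of_nat (Suc n) ^ j) (Complex u t))) has_real_derivative
     - 2 * pi * Re (qsum (\<lambda>n. of_nat (Suc n) ^ Suc j) (Complex u v))) (at v)"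
    by (simp add: has_real_derivative_iff_has_vector_derivative del: power_Suc of_nat_Suc)
  from DERIV_cmult[OF this, of 2] show ?thesis
    unfolding cosine_series_def by (simp add: fun_eq_iff mult_ac del: power_Suc of_nat_Suc)
qed

text \<open>Since w x \<le> x^2 \<le> a^2 + x^2, one factor is absorbed into 1 / w. The terms of a
  sum already known to converge at height \<open>w\<close> thus majorize the derivatives at all
  greater heights.\<close>

lemma inverse_quadratic_deriv_bound:
  fixes a x w :: real
  assumes "0 < w" "w \<le> x"
  shows "x / (a\<^sup>2 + x\<^sup>2) ^ Suc m \<le> 1 / w * (1 / (a\<^sup>2 + w\<^sup>2) ^ m)"
proof -
  have p: "a\<^sup>2 + x\<^sup>2 > 0" "a\<^sup>2 + w\<^sup>2 > 0" using assms by (auto intro: add_nonneg_pos)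
  have "w * x \<le> x * x" using assms by (intro mult_right_mono) auto
  then have "w * x \<le> a\<^sup>2 + x\<^sup>2" by (simp add: power2_eq_square add_increasing)
  then have "x / (a\<^sup>2 + x\<^sup>2) \<le> 1 / w" using p assms
    by (simp add: pos_divide_le_eq pos_le_divide_eq mult.commute)
  moreover have "1 / (a\<^sup>2 + x\<^sup>2) ^ m \<le> 1 / (a\<^sup>2 + w\<^sup>2) ^ m"
    using p assms by (intro divide_left_mono power_mono add_left_mono) auto
  ultimately have "x / (a\<^sup>2 + x\<^sup>2) * (1 / (a\<^sup>2 + x\<^sup>2) ^ m) \<le> 1 / w * (1 / (a\<^sup>2 + w\<^sup>2) ^ m)"
    using p assms by (intro mult_mono) auto
  then show ?thesis by simp
qed

text \<open>Differentiation in \<open>v\<close> raises the exponent by one and brings out the factor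
  -2 (K + 1) v. Termwise differentiation rests on the Weierstrass test.\<close>

lemma inverse_quadratic_power_sums_step:
  fixes u v F' :: real and F :: "real \<Rightarrow> real"
  assumes sums: "\<And>v. v > 0 \<Longrightarrow>
     (\<lambda>n. 1 / ((u + real n)\<^sup>2 + v\<^sup>2) ^ Suc K + 1 / ((u - 1 - real n)\<^sup>2 + v\<^sup>2) ^ Suc K) sums F v"
  assumes deriv: "(F has_real_derivative F') (at v)" and v: "v > 0"
  shows "(\<lambda>n. 1 / ((u + real n)\<^sup>2 + v\<^sup>2) ^ Suc (Suc K) + 1 / ((u - 1 - real n)\<^sup>2 + v\<^sup>2) ^ Suc (Suc K))
     sums (- F' / (2 * Suc K * v))"
proof -
  define f where "f n v = 1 / ((u + real n)\<^sup>2 + v\<^sup>2) ^ Suc K + 1 / ((u - 1 - real n)\<^sup>2 + v\<^sup>2) ^ Suc K" for n and v :: real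
  define g where "g n v = 1 / ((u + real n)\<^sup>2 + v\<^sup>2) ^ Suc (Suc K) + 1 / ((u - 1 - real n)\<^sup>2 + v\<^sup>2) ^ Suc (Suc K)" for n and v :: real
  define f' where "f' n v = - 2 * Suc K * v * g n v" for n and v :: real
  \<comment> \<open>A neighbourhood of \<open>v\<close> bounded away from 0, on which the terms at
    height \<open>v / 2\<close> give a uniform majorant.\<close>
  define S where "S = {v / 2<..}"
  have Sv: "v \<in> S" "interior S = S" "convex S" using v by (auto simp: S_def interior_open)
  have pos: "x > 0" if "x \<in> S" for x using that v by (auto simp: S_def)
  have df1: "((\<lambda>x. 1 / (a\<^sup>2 + x\<^sup>2) ^ Suc K) has_real_derivative (- 2 * Suc K * x * (1 / (a\<^sup>2 + x\<^sup>2) ^ Suc (Suc K)))) (at x)"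
    if "x > 0" for a x :: real
  proof -
    have p: "a\<^sup>2 + x\<^sup>2 > 0" using that by (auto intro: add_nonneg_pos)
    have "((\<lambda>x. inverse (a\<^sup>2 + x\<^sup>2) ^ Suc K) has_real_derivative
       real (Suc K) * inverse (a\<^sup>2 + x\<^sup>2) ^ K * (- (inverse (a\<^sup>2 + x\<^sup>2) * (2 * x) * inverse (a\<^sup>2 + x\<^sup>2)))) (at x)"
      using p by (auto intro!: derivative_eq_intros simp del: power_Suc)
    then show ?thesis by (simp add: divide_inverse power_inverse mult_ac del: of_nat_Suc)
  qed
  have df: "(f n has_real_derivative f' n x) (at x within S)" if "x \<in> S" for n x
  proof -
    have "(f n has_real_derivative
       (- 2 * Suc K * x * (1 / ((u + real n)\<^sup>2 + x\<^sup>2) ^ Suc (Suc K))) +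
       (- 2 * Suc K * x * (1 / ((u - 1 - real n)\<^sup>2 + x\<^sup>2) ^ Suc (Suc K)))) (at x)"
      unfolding f_def by (intro DERIV_add df1 pos that)
    then show ?thesis
      unfolding f'_def g_def ring_distribs by (rule has_field_derivative_at_within)
  qed
  define M where "M n = 2 * Suc K * (1 / (v / 2) * f n (v / 2))" for n
  have "summable M" unfolding M_def f_def
    using sums[of "v/2"] v by (intro summable_mult) (auto simp: sums_iff)
  moreover have "norm (f' n x) \<le> M n" if "x \<in> S" for n x
  proof -
    have "x * g n x \<le> 1 / (v / 2) * f n (v / 2)"
      unfolding g_def f_def ring_distribs
      using inverse_quadratic_deriv_bound[of "v/2" x _ "Suc K"] that v
      by (intro add_mono) (auto simp: S_def simp del: power_Suc)
    moreover have "x * g n x \<ge> 0" using pos[OF that] unfolding g_def by simp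
    ultimately have "2 * Suc K * \<bar>x * g n x\<bar> \<le> M n"
      unfolding M_def by (intro mult_left_mono) auto
    then show ?thesis unfolding f'_def by (simp add: abs_mult mult_ac add_ac)
  qed
  ultimately have "uniform_limit S (\<lambda>n x. \<Sum>i<n. f' i x) (\<lambda>x. \<Sum>i. f' i x) sequentially"
    by (intro Weierstrass_m_test) auto
  then have uc: "uniformly_convergent_on S (\<lambda>n x. \<Sum>i<n. f' i x)"
    by (rule uniformly_convergentI)
  have sf: "summable (\<lambda>n. f n v)" using sums[OF v] by (simp add: f_def sums_iff)
  have uc': "summable (\<lambda>n. f' n v)"
    using tendsto_uniform_limitI \<open>uniform_limit S _ _ _\<close> Sv(1)
    by (force simp: summable_def sums_def)
  have "((\<lambda>x. \<Sum>n. f n x) has_field_derivative (\<Sum>n. f' n v)) (at v)"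
    by (rule has_field_derivative_series'(2)[OF Sv(3) df uc Sv(1) sf]) (use Sv in auto)
  then have "(F has_field_derivative (\<Sum>n. f' n v)) (at v)"
  proof (rule has_field_derivative_transform_within_open)
    show "open S" "v \<in> S" using Sv(1) by (auto simp: S_def)
    show "(\<Sum>n. f n x) = F x" if "x \<in> S" for x
      using sums_unique[OF sums[OF pos[OF that]]] by (simp add: f_def)
  qed
  with deriv have "F' = (\<Sum>n. f' n v)" by (rule DERIV_unique)
  then have "(\<lambda>n. f' n v) sums F'" using uc' by (simp add: sums_iff)
  then have "(\<lambda>n. - f' n v / (2 * Suc K * v)) sums (- F' / (2 * Suc K * v))"
    by (intro sums_divide sums_minus)
  moreover have "- f' n v / (2 * Suc K * v) = g n v" for n
  proof -
    have "- f' n v = (2 * Suc K * v) * g n v" "2 * Suc K * v \<noteq> 0"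
      using v by (simp add: f'_def algebra_simps, simp del: of_nat_Suc)
    then show ?thesis by (metis nonzero_mult_div_cancel_left)
  qed
  ultimately show ?thesis by (simp add: g_def)
qed

text \<open>The constant \<open>c\<close> depends on \<open>K\<close> alone, and this uniformity in
  \<open>u\<close> and \<open>v\<close> is all that is used of it: it only enters the coefficient of
  v^(1-k).\<close>

lemma inverse_quadratic_power_sums:
  "\<exists>c. \<forall>u v. v > 0 \<longrightarrow>
     (\<lambda>n. 1 / ((u + real n)\<^sup>2 + v\<^sup>2) ^ Suc K + 1 / ((u - 1 - real n)\<^sup>2 + v\<^sup>2) ^ Suc K) sums
       (c / v ^ (2 * K + 1) + (\<Sum>r\<le>K. bessel_coeff K r / v ^ (K + 1 + r) * cosine_series (K - r) u v))"
proof (induction K)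
  case 0
  show ?case
    by (rule exI[of _ pi]) (use inverse_quadratic_sums in \<open>simp add: bessel_coeff_def cosine_series_def field_simps\<close>)
next
  case (Suc K)
  then obtain c where c: "\<And>u v. v > 0 \<Longrightarrow>
     (\<lambda>n. 1 / ((u + real n)\<^sup>2 + v\<^sup>2) ^ Suc K + 1 / ((u - 1 - real n)\<^sup>2 + v\<^sup>2) ^ Suc K) sums
       (c / v ^ (2 * K + 1) + (\<Sum>r\<le>K. bessel_coeff K r / v ^ (K + 1 + r) * cosine_series (K - r) u v))" by blast
  define c' where "c' = c * (2 * K + 1) / (2 * Suc K)"
  show ?case
  proof (intro exI[of _ c'] allI impI)
    fix u v :: real assume v: "v > 0"
    define F' where "F' = - c * (2 * K + 1) / v ^ (2 * K + 2) +
      (\<Sum>r\<le>K. bessel_coeff K r * (- real (K + 1 + r) / v ^ (K + 2 + r) * cosine_series (K - r) u v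
           - 2 * pi / v ^ (K + 1 + r) * cosine_series (Suc K - r) u v))"
    have dp: "((\<lambda>v. b / v ^ Suc m) has_real_derivative (- b * real (Suc m) / v ^ Suc (Suc m))) (at v)" for b m
    proof -
      have "((\<lambda>v. b * inverse v ^ Suc m) has_real_derivative
        b * (real (Suc m) * inverse v ^ m * (- (inverse v * inverse v)))) (at v)"
        using v by (auto intro!: derivative_eq_intros simp del: power_Suc)
      then show ?thesis by (simp add: divide_inverse power_inverse mult_ac del: of_nat_Suc)
    qed
    have "((\<lambda>v. (c / v ^ (2 * K + 1) + (\<Sum>r\<le>K. bessel_coeff K r / v ^ (K + 1 + r) * cosine_series (K - r) u v)))
       has_real_derivative F') (at v)"
      unfolding F'_def
    proof (intro DERIV_add DERIV_sum)
      show "((\<lambda>v. c / v ^ (2 * K + 1)) has_real_derivative - c * (2 * K + 1) / v ^ (2 * K + 2)) (at v)"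
        using dp[of c "2 * K"] by simp
    next
      fix r assume "r \<in> {..K}"
      then have r: "Suc K - r = Suc (K - r)" by auto
      show "((\<lambda>v. bessel_coeff K r / v ^ (K + 1 + r) * cosine_series (K - r) u v) has_real_derivative
         bessel_coeff K r * (- real (K + 1 + r) / v ^ (K + 2 + r) * cosine_series (K - r) u v
           - 2 * pi / v ^ (K + 1 + r) * cosine_series (Suc K - r) u v)) (at v)"
        using DERIV_mult[OF dp[of "bessel_coeff K r" "K + r"] cosine_series_has_real_derivative[OF v, of "K - r" u]]
        unfolding r by (simp add: algebra_simps)
    qed
    note step = inverse_quadratic_power_sums_step[OF c[of _ u] this v]
    \<comment> \<open>\<open>A\<close> collects what comes from differentiating the powers of
      \<open>v\<close>, shifted by one index, and \<open>B\<close> what comes from the cosine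
      series. Extended by zero at index 0 and at index \<open>Suc K\<close> respectively, both run
      over the same range.\<close>
    define X where "X r = cosine_series (Suc K - r) u v / v ^ (K + 2 + r)" for r
    define A where "A r = (case r of 0 \<Rightarrow> 0 | Suc s \<Rightarrow> (Suc K + s) / (2 * Suc K) * bessel_coeff K s)" for r
    define B where "B r = (if r \<le> K then pi / Suc K * bessel_coeff K r else 0)" for r
    have e: "bessel_coeff (Suc K) r = A r + B r" if "r \<le> Suc K" for r
    proof -
      have "s = K" if "r = Suc s" "\<not> s < K" for s using that \<open>r \<le> Suc K\<close> by simp
      then show ?thesis
        by (cases r; cases "r - 1 < K")
           (auto simp: A_def B_def bessel_coeff_Suc_0 bessel_coeff_Suc_Suc bessel_coeff_Suc_last simp del: of_nat_Suc of_nat_add)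
    qed
    have "(\<Sum>r\<le>Suc K. bessel_coeff (Suc K) r / v ^ (Suc K + 1 + r) * cosine_series (Suc K - r) u v)
       = (\<Sum>r\<le>Suc K. (A r + B r) * X r)"
      by (intro sum.cong) (auto simp: e X_def)
    also have "\<dots> = (\<Sum>r\<le>Suc K. A r * X r) + (\<Sum>r\<le>Suc K. B r * X r)"
      by (simp add: distrib_right sum.distrib)
    also have "(\<Sum>r\<le>Suc K. A r * X r) = (\<Sum>r\<le>K. A (Suc r) * X (Suc r))"
      by (subst sum.atMost_Suc_shift) (simp add: A_def)
    also have "(\<Sum>r\<le>Suc K. B r * X r) = (\<Sum>r\<le>K. B r * X r)"
      by (simp add: B_def)
    also have "(\<Sum>r\<le>K. A (Suc r) * X (Suc r)) + (\<Sum>r\<le>K. B r * X r) =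
       (\<Sum>r\<le>K. A (Suc r) * X (Suc r) + B r * X r)" by (simp add: sum.distrib)
    also have "\<dots> = (\<Sum>r\<le>K. - (bessel_coeff K r * (- real (K + 1 + r) / v ^ (K + 2 + r) * cosine_series (K - r) u v
           - 2 * pi / v ^ (K + 1 + r) * cosine_series (Suc K - r) u v)) / (2 * Suc K * v))"
    proof (intro sum.cong refl)
      fix r assume "r \<in> {..K}"
      then have r: "r \<le> K" by simp
      have 1: "A (Suc r) * X (Suc r) = bessel_coeff K r * ((K + 1 + r) / v ^ (K + 2 + r) * cosine_series (K - r) u v) / (2 * Suc K * v)"
        unfolding A_def X_def using v by (simp add: field_simps)
      have 2: "B r * X r = bessel_coeff K r * (2 * pi / v ^ (K + 1 + r) * cosine_series (Suc K - r) u v) / (2 * Suc K * v)"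
        unfolding B_def X_def of_nat_mult using v r by (simp add: divide_simps del: of_nat_Suc)
      have 3: "- (e * (- P / x * q - y)) / D = (e * (P / x * q)) / D + (e * y) / D" for e P x q y D :: real
        by (simp add: algebra_simps add_divide_distrib diff_divide_distrib)
      show "A (Suc r) * X (Suc r) + B r * X r = - (bessel_coeff K r * (- real (K + 1 + r) / v ^ (K + 2 + r) * cosine_series (K - r) u v
           - 2 * pi / v ^ (K + 1 + r) * cosine_series (Suc K - r) u v)) / (2 * Suc K * v)"
        unfolding 1 2 3 ..
    qed
    also have "\<dots> = - (\<Sum>r\<le>K. (bessel_coeff K r * (- real (K + 1 + r) / v ^ (K + 2 + r) * cosine_series (K - r) u v
           - 2 * pi / v ^ (K + 1 + r) * cosine_series (Suc K - r) u v))) / (2 * Suc K * v)"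
      by (simp only: sum_negf [symmetric] sum_divide_distrib)
    finally have s: "(\<Sum>r\<le>Suc K. bessel_coeff (Suc K) r / v ^ (Suc K + 1 + r) * cosine_series (Suc K - r) u v) = \<dots>" .
    have "c' / v ^ (2 * Suc K + 1) = - (- c * (2 * K + 1) / v ^ (2 * K + 2)) / (2 * Suc K * v)"
    proof -
      have "v ^ (2 * Suc K + 1) = v ^ (2 * K + 2) * v" by simp
      then show ?thesis unfolding c'_def by (simp add: mult_ac del: of_nat_Suc power_Suc)
    qed
    then have "- F' / (2 * Suc K * v) = c' / v ^ (2 * Suc K + 1) +
       (\<Sum>r\<le>Suc K. bessel_coeff (Suc K) r / v ^ (Suc K + 1 + r) * cosine_series (Suc K - r) u v)"
      unfolding s F'_def by (simp only: minus_add_distrib add_divide_distrib)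
    then show "(\<lambda>n. 1 / ((u + real n)\<^sup>2 + v\<^sup>2) ^ Suc (Suc K) + 1 / ((u - 1 - real n)\<^sup>2 + v\<^sup>2) ^ Suc (Suc K)) sums
       (c' / v ^ (2 * Suc K + 1) + (\<Sum>r\<le>Suc K. bessel_coeff (Suc K) r / v ^ (Suc K + 1 + r) * cosine_series (Suc K - r) u v))"
      using step by (simp only: )
  qed
qed

subsection \<open>Lambert series\<close>

text \<open>Nonnegativity lets the paired series dominate each of its halves, so both one-sided
  series converge and the sum over the integers is unconditional.\<close>

lemma has_sum_int_nonneg:
  fixes f :: "int \<Rightarrow> real"
  assumes "(\<lambda>n. f (int n) + f (- 1 - int n)) sums S" and nn: "\<And>n. f n \<ge> 0"
  shows "(f has_sum S) UNIV"
proof -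
  have sm: "summable (\<lambda>n. f (int n) + f (- 1 - int n))" using assms(1) by (simp add: sums_iff)
  have 1: "summable (\<lambda>n. f (int n))" by (rule summable_comparison_test'[OF sm, of 0]) (simp add: nn)
  have 2: "summable (\<lambda>n. f (- 1 - int n))" by (rule summable_comparison_test'[OF sm, of 0]) (simp add: nn)
  have S: "S = (\<Sum>n. f (int n)) + (\<Sum>n. f (- 1 - int n))"
    using suminf_add[OF 1 2] assms(1) by (simp add: sums_iff)
  have A: "(f has_sum (\<Sum>n. f (int n))) (range int)"
    using sums_nonneg_imp_has_sum[OF summable_sums[OF 1] nn]
    by (subst has_sum_reindex) (auto simp: o_def)
  have B: "(f has_sum (\<Sum>n. f (- 1 - int n))) (range (\<lambda>n. - 1 - int n))"
    using sums_nonneg_imp_has_sum[OF summable_sums[OF 2] nn]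
    by (subst has_sum_reindex) (auto simp: o_def inj_on_def)
  have "x \<in> range int \<union> range (\<lambda>n. - 1 - int n)" for x
    by (cases x rule: int_cases) (auto simp: image_iff)
  then have "range int \<union> range (\<lambda>n. - 1 - int n) = UNIV" by blast
  moreover have "range int \<inter> range (\<lambda>n. - 1 - int n) = {}" by auto
  ultimately show ?thesis using has_sum_Un_disjoint[OF A B] S by simp
qed

(* The Dirichlet convolution with all arguments shifted by one. *)
definition divisor_conv :: "(nat \<Rightarrow> nat \<Rightarrow> 'a :: comm_monoid_add) \<Rightarrow> nat \<Rightarrow> 'a" where
  "divisor_conv w N = (\<Sum>d | d dvd Suc N. w (d - 1) (Suc N div d - 1))"

lemma divisor_conv_cong:
  assumes "\<And>i j. Suc i * Suc j = Suc N \<Longrightarrow> w i j = w' i j"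
  shows "divisor_conv w N = divisor_conv w' N"
  unfolding divisor_conv_def
proof (intro sum.cong refl)
  fix d assume "d \<in> {d. d dvd Suc N}"
  then obtain e where e: "Suc N = d * e" by auto
  then have "d > 0" "e > 0" by (auto intro: Nat.gr0I)
  then show "w (d - 1) (Suc N div d - 1) = w' (d - 1) (Suc N div d - 1)"
    by (intro assms) (auto simp: e)
qed

text \<open>A Lambert series becomes a power series: absolute summability allows the pairs to be
  grouped by the product of the shifted indices instead of by rows.\<close>

lemma has_sum_divisor_conv:
  fixes w :: "nat \<Rightarrow> nat \<Rightarrow> complex"
  assumes "(\<lambda>(i, j). norm (w i j * q ^ (Suc i * Suc j))) summable_on UNIV"
  shows "summable (\<lambda>N. norm (divisor_conv w N * q ^ Suc N))"
    and "(\<lambda>i. \<Sum>j. w i j * q ^ (Suc i * Suc j)) sums (\<Sum>N. divisor_conv w N * q ^ Suc N)"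
proof -
  define f where "f = (\<lambda>(i, j). w i j * q ^ (Suc i * Suc j))"
  define g where "g = (\<lambda>(N, d). w (d - 1) (Suc N div d - 1) * q ^ Suc N)"
  \<comment> \<open>A pair is recorded as the shifted product together with its first factor, which
    is a divisor of that product.\<close>
  define h where "h = (\<lambda>(i, j). (Suc i * Suc j - 1, Suc i))"
  define D where "D = Sigma UNIV (\<lambda>N. {d. d dvd Suc N})"
  have fin: "finite {d. d dvd Suc N}" for N by simp
  have h: "bij_betw h UNIV D"
  proof (rule bij_betw_byWitness[where f' = "\<lambda>(N, d). (d - 1, Suc N div d - 1)"])
    show "\<forall>a\<in>UNIV. (case h a of (N, d) \<Rightarrow> (d - 1, Suc N div d - 1)) = a"
      by (auto simp: h_def simp del: mult_Suc mult_Suc_right)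
    show "\<forall>a'\<in>D. h (case a' of (N, d) \<Rightarrow> (d - 1, Suc N div d - 1)) = a'"
    proof (clarsimp simp: h_def D_def simp del: mult_Suc mult_Suc_right)
      fix N d assume d: "d dvd Suc N"
      then have "d > 0" "Suc N div d > 0" by (auto intro: Nat.gr0I dest: dvd_imp_le simp: div_greater_zero_iff)
      then show "Suc (d - Suc 0) * Suc (Suc N div d - Suc 0) - Suc 0 = N \<and> Suc (d - Suc 0) = d"
        using d by (simp del: mult_Suc mult_Suc_right)
    qed
    show "h ` UNIV \<subseteq> D" by (auto simp: h_def D_def simp del: mult_Suc mult_Suc_right)
    show "(\<lambda>(N, d). (d - 1, Suc N div d - 1)) ` D \<subseteq> UNIV" by simp
  qed
  have gh: "f = (\<lambda>x. g (h x))"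
    by (auto simp: fun_eq_iff f_def g_def h_def simp del: mult_Suc mult_Suc_right power_Suc)
  have absf: "(\<lambda>x. norm (f x)) summable_on UNIV" using assms by (simp add: f_def case_prod_unfold)
  then have absg: "(\<lambda>x. norm (g x)) summable_on D"
    unfolding gh using summable_on_reindex_bij_betw[OF h, of "\<lambda>x. norm (g x)"] by simp
  from abs_summable_summable[OF absg] obtain S where S: "(g has_sum S) D" by (auto simp: summable_on_def)
  have inner: "((\<lambda>d. g (N, d)) has_sum divisor_conv w N * q ^ Suc N) {d. d dvd Suc N}" for N
    using has_sum_finite[OF fin, of "\<lambda>d. g (N, d)" N]
    by (simp add: g_def divisor_conv_def sum_distrib_right)
  from has_sum_SigmaD[OF S[unfolded D_def] inner]
  have N: "((\<lambda>N. divisor_conv w N * q ^ Suc N) has_sum S) UNIV" .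
  then have S_eq: "S = (\<Sum>N. divisor_conv w N * q ^ Suc N)"
    using has_sum_imp_sums sums_unique by blast
  have fS: "((\<lambda>(i, j). w i j * q ^ (Suc i * Suc j)) has_sum (\<Sum>N. divisor_conv w N * q ^ Suc N)) UNIV"
    using S has_sum_reindex_bij_betw[OF h, of g S] unfolding S_eq f_def [symmetric] gh by simp
  show "summable (\<lambda>N. norm (divisor_conv w N * q ^ Suc N))"
    using N by (metis has_sum_imp_summable summable_on_iff_abs_summable_on_complex summable_on_UNIV_nonneg_real_iff norm_ge_zero)
  have row: "((\<lambda>j. f (i, j)) has_sum (\<Sum>j. w i j * q ^ (Suc i * Suc j))) UNIV" for i
  proof -
    have "(\<lambda>j. f (i, j)) summable_on UNIV"
      using summable_on_SigmaD1[of "\<lambda>i j. f (i, j)" UNIV "\<lambda>_. UNIV" i] abs_summable_summable[OF absf] by simp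
    then obtain s where s: "((\<lambda>j. f (i, j)) has_sum s) UNIV" by (auto simp: summable_on_def)
    moreover from has_sum_imp_sums[OF s] have "s = (\<Sum>j. w i j * q ^ (Suc i * Suc j))"
      by (simp add: f_def sums_iff)
    ultimately show ?thesis by simp
  qed
  have rows: "((\<lambda>i. \<Sum>j. w i j * q ^ (Suc i * Suc j)) has_sum (\<Sum>N. divisor_conv w N * q ^ Suc N)) UNIV"
    by (rule has_sum_SigmaD[where f = f and B = "\<lambda>_. UNIV"]) (use fS row in \<open>simp_all add: f_def\<close>)
  then show "(\<lambda>i. \<Sum>j. w i j * q ^ (Suc i * Suc j)) sums (\<Sum>N. divisor_conv w N * q ^ Suc N)"
    by (rule has_sum_imp_sums)
qed

text \<open>As (i + 1)(j + 1) \<ge> i + j, the majorant is at most a geometric series in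
  \<open>i\<close> times a polynomially weighted geometric series in \<open>j\<close>.\<close>

lemma abs_summable_pairs_bound:
  fixes f :: "nat \<Rightarrow> nat \<Rightarrow> complex"
  assumes "0 \<le> x" "x < 1" and bound: "\<And>i j. norm (f i j) \<le> real (Suc j) ^ p * x ^ (Suc i * Suc j)"
  shows "(\<lambda>(i, j). norm (f i j)) summable_on UNIV"
proof -
  have "summable (\<lambda>j. norm (of_nat (Suc j) ^ p * complex_of_real x ^ j))"
    by (rule disc_summableD_norm[OF disc_summable_power]) (use assms in auto)
  then have sj: "summable (\<lambda>j. real (Suc j) ^ p * x ^ j)"
    using assms by (simp add: norm_mult norm_power del: of_nat_Suc)
  define A where "A = (\<Sum>j. real (Suc j) ^ p * x ^ j)"
  have row: "((\<lambda>j. x ^ i * (real (Suc j) ^ p * x ^ j)) has_sum x ^ i * A) UNIV" for i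
    unfolding A_def using assms(1) sj by (intro sums_nonneg_imp_has_sum sums_mult summable_sums) auto
  have "(\<lambda>i. x ^ i * A) summable_on UNIV"
    by (rule summable_on_cmult_left) (use assms in \<open>simp add: summable_on_UNIV_nonneg_real_iff summable_geometric\<close>)
  then have "(\<lambda>(i, j). x ^ i * (real (Suc j) ^ p * x ^ j)) summable_on Sigma UNIV (\<lambda>_. UNIV)"
    by (intro summable_on_SigmaI[where g = "\<lambda>i. x ^ i * A"]) (use row assms in auto)
  then have *: "(\<lambda>(i, j). x ^ i * (real (Suc j) ^ p * x ^ j)) summable_on UNIV" by simp
  show ?thesis
  proof (rule summable_on_comparison_test[OF *])
    fix ij :: "nat \<times> nat"
    obtain i j where ij: "ij = (i, j)" by (cases ij)
    have "norm (f i j) \<le> real (Suc j) ^ p * x ^ (Suc i * Suc j)" by (rule bound)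
    also have "x ^ (Suc i * Suc j) \<le> x ^ (i + j)"
      using assms by (intro power_decreasing) auto
    finally show "(case ij of (i, j) \<Rightarrow> norm (f i j)) \<le> (case ij of (i, j) \<Rightarrow> x ^ i * (real (Suc j) ^ p * x ^ j))"
      by (simp add: ij power_add mult_ac mult_left_mono)
  qed (auto)
qed

lemma disc_summable_divisor_conv:
  assumes "\<And>i j. norm (w i j) \<le> real (Suc j) ^ p"
  shows "disc_summable (divisor_conv w)"
  unfolding disc_summable_def
proof (intro allI impI)
  fix z :: complex assume z: "norm z < 1"
  show "summable (\<lambda>n. divisor_conv w n * z ^ n)"
  \<comment> \<open>The convolution result has the exponents \<open>Suc n\<close>; the surplus
    factor \<open>z\<close> can be cancelled except at the origin, where the series is
    finite.\<close>
  proof (cases "z = 0")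
    case True
    then show ?thesis by (intro summable_finite[of "{0}"]) auto
  next
    case False
    have "(\<lambda>(i, j). norm (w i j * z ^ (Suc i * Suc j))) summable_on UNIV"
      by (rule abs_summable_pairs_bound[of "norm z" _ p])
         (use z assms in \<open>auto simp: norm_mult norm_power intro!: mult_right_mono simp del: mult_Suc mult_Suc_right of_nat_Suc\<close>)
    from summable_norm_cancel[OF has_sum_divisor_conv(1)[OF this]]
    have "summable (\<lambda>n. z * (divisor_conv w n * z ^ n))" by (simp add: mult_ac)
    then show ?thesis using False by (subst (asm) summable_cmult_iff) auto
  qed
qed

text \<open>With M = N + 1 and k = K + 1 this is sigma_(2k-1)(M) / M^k, the classical divisor sum of
  the Eisenstein series.\<close>

definition eis_coeff :: "nat \<Rightarrow> nat \<Rightarrow> real" where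
  "eis_coeff K N = divisor_conv (\<lambda>i j. real (Suc j) ^ K / real (Suc i) ^ Suc K) N"

text \<open>Raising \<open>r\<close> by one divides each summand by the product of its two factors,
  which is \<open>Suc N\<close> for every divisor. So all the q-series in the expansion share one
  coefficient sequence up to powers of \<open>Suc N\<close>, which the Laplace equation later
  exploits.\<close>

lemma divisor_conv_eis:
  assumes "r \<le> K"
  shows "divisor_conv (\<lambda>i j. complex_of_real (real (Suc j) ^ (K - r) / real (Suc i) ^ (K + 1 + r))) N
           = of_real (eis_coeff K N / real (Suc N) ^ r)"
proof -
  have "divisor_conv (\<lambda>i j. complex_of_real (real (Suc j) ^ (K - r) / real (Suc i) ^ (K + 1 + r))) N =
     divisor_conv (\<lambda>i j. of_real (real (Suc j) ^ K / real (Suc i) ^ Suc K) / of_real (real (Suc N) ^ r)) N"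
  proof (rule divisor_conv_cong)
    fix i j assume N: "Suc i * Suc j = Suc N"
    have p: "real (Suc j) ^ K = real (Suc j) ^ (K - r) * real (Suc j) ^ r"
      using assms by (simp add: power_add [symmetric])
    have "real (Suc j) ^ (K - r) / real (Suc i) ^ (K + 1 + r) = real (Suc j) ^ K / real (Suc i) ^ Suc K / real (Suc N) ^ r"
      unfolding p N [symmetric] of_nat_mult
      by (simp add: power_add power_mult_distrib del: of_nat_Suc)
    then show "complex_of_real (real (Suc j) ^ (K - r) / real (Suc i) ^ (K + 1 + r)) =
       of_real (real (Suc j) ^ K / real (Suc i) ^ Suc K) / of_real (real (Suc N) ^ r)"
      by (simp only: of_real_divide)
  qed
  then show ?thesis
    by (simp add: divisor_conv_def eis_coeff_def sum_divide_distrib)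
qed

lemma disc_summable_eis:
  assumes "r \<le> K"
  shows "disc_summable (\<lambda>N. of_real (eis_coeff K N / real (Suc N) ^ r))"
proof -
  define w where "w i j = complex_of_real (real (Suc j) ^ (K - r) / real (Suc i) ^ (K + 1 + r))" for i j
  have "norm (w i j) \<le> real (Suc j) ^ (K - r)" for i j
  proof -
    have "real (Suc j) ^ (K - r) / real (Suc i) ^ (K + 1 + r) \<le> real (Suc j) ^ (K - r) / 1"
      by (intro divide_left_mono one_le_power) auto
    then show ?thesis unfolding w_def norm_of_real by simp
  qed
  then have "disc_summable (divisor_conv w)" by (rule disc_summable_divisor_conv)
  moreover have "divisor_conv w = (\<lambda>N. of_real (eis_coeff K N / real (Suc N) ^ r))"
    unfolding w_def using divisor_conv_eis[OF assms] by (rule ext)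
  ultimately show ?thesis by simp
qed

text \<open>The nome of a multiple of \<tau> by \<open>Suc i\<close> is the corresponding power of
  \<open>q\<close>, so summation over the multiples is a Lambert series; the denominators are those
  that powers of the multiplied height leave behind.\<close>

lemma cosine_series_multiples_sums:
  assumes "v > 0" "r \<le> K"
  shows "(\<lambda>i. cosine_series (K - r) (real (Suc i) * u) (real (Suc i) * v) / real (Suc i) ^ (K + 1 + r)) sums
           (2 * Re (qsum (\<lambda>N. of_real (eis_coeff K N / real (Suc N) ^ r)) (Complex u v)))"
proof -
  define w where "w i j = complex_of_real (real (Suc j) ^ (K - r) / real (Suc i) ^ (K + 1 + r))" for i j
  define q where "q = nome (Complex u v)"
  have q: "norm q < 1" using assms by (simp add: q_def norm_nome_less_1)
  have wb: "norm (w i j) \<le> real (Suc j) ^ (K - r)" for i j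
  proof -
    have "real (Suc j) ^ (K - r) / real (Suc i) ^ (K + 1 + r) \<le> real (Suc j) ^ (K - r) / 1"
      by (intro divide_left_mono one_le_power) auto
    then show ?thesis unfolding w_def norm_of_real by simp
  qed
  have "(\<lambda>(i, j). norm (w i j * q ^ (Suc i * Suc j))) summable_on UNIV"
    by (rule abs_summable_pairs_bound[of "norm q" _ "K - r"])
       (use q wb in \<open>auto simp: norm_mult norm_power intro!: mult_right_mono simp del: mult_Suc mult_Suc_right of_nat_Suc\<close>)
  note s = has_sum_divisor_conv(2)[OF this]
  have row: "2 * Re (\<Sum>j. w i j * q ^ (Suc i * Suc j)) = cosine_series (K - r) (real (Suc i) * u) (real (Suc i) * v) / real (Suc i) ^ (K + 1 + r)" for i
  proof -
    define a where "a n = (of_nat (Suc n) ^ (K - r) :: complex)" for n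
    have nm: "nome (Complex (real (Suc i) * u) (real (Suc i) * v)) = q ^ Suc i"
      unfolding q_def nome_power by (rule arg_cong[of _ _ nome]) (simp add: complex_eq_iff)
    have "summable (\<lambda>n. a n * (q ^ Suc i) ^ Suc n)"
      unfolding a_def by (intro disc_summableD_Suc disc_summable_power) (use q in \<open>simp add: norm_power power_less_one_iff del: power_Suc\<close>)
    then have "(\<Sum>j. complex_of_real (1 / real (Suc i) ^ (K + 1 + r)) * (a j * (q ^ Suc i) ^ Suc j)) =
      complex_of_real (1 / real (Suc i) ^ (K + 1 + r)) * (\<Sum>j. a j * (q ^ Suc i) ^ Suc j)"
      by (rule suminf_mult)
    moreover have "complex_of_real (1 / real (Suc i) ^ (K + 1 + r)) * (a j * (q ^ Suc i) ^ Suc j) = w i j * q ^ (Suc i * Suc j)" for j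
      unfolding w_def a_def power_mult [symmetric] by (simp del: of_nat_Suc mult_Suc mult_Suc_right power_Suc)
    ultimately have e: "(\<Sum>j. w i j * q ^ (Suc i * Suc j)) =
      complex_of_real (1 / real (Suc i) ^ (K + 1 + r)) * (\<Sum>j. a j * (q ^ Suc i) ^ Suc j)" by simp
    show ?thesis
      unfolding e cosine_series_def qsum_def nm a_def [symmetric]
      by (simp del: of_nat_Suc power_Suc)
  qed
  show "(\<lambda>i. cosine_series (K - r) (real (Suc i) * u) (real (Suc i) * v) / real (Suc i) ^ (K + 1 + r)) sums
           (2 * Re (qsum (\<lambda>N. of_real (eis_coeff K N / real (Suc N) ^ r)) (Complex u v)))"
    using sums_mult[OF sums_Re[OF s], of 2] unfolding row
    unfolding qsum_def q_def w_def divisor_conv_eis[OF assms(2)] .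
qed

subsection \<open>Lattice sums\<close>

definition lattice_term :: "nat \<Rightarrow> complex \<Rightarrow> int \<times> int \<Rightarrow> real" where
  "lattice_term K \<tau> = (\<lambda>(m, n). 1 / ((norm (of_int m * \<tau> + of_int n))\<^sup>2) ^ Suc K)"

text \<open>One vector out of each pair of opposite nonzero vectors, which accounts for the sign in
  \<open>Gamma_infinity\<close>.\<close>

definition half_lattice :: "(int \<times> int) set" where
  "half_lattice = {(m, n). m > 0 \<or> m = 0 \<and> n > 0}"

(* zeta_even K is zeta (2k) for k = K + 1. *)
definition zeta_even :: "nat \<Rightarrow> real" where
  "zeta_even K = (\<Sum>n. 1 / (real (Suc n)) ^ (2 * Suc K))"

definition eis_series :: "nat \<Rightarrow> nat \<Rightarrow> complex \<Rightarrow> complex" where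
  "eis_series K r = qsum (\<lambda>N. of_real (eis_coeff K N / real (Suc N) ^ r))"

lemma lattice_term_nonneg: "lattice_term K \<tau> x \<ge> 0"
  by (simp add: lattice_term_def case_prod_unfold)

lemma lattice_term_eq:
  "lattice_term K \<tau> (m, n) = 1 / ((of_int m * Re \<tau> + of_int n)\<^sup>2 + (of_int m * Im \<tau>)\<^sup>2) ^ Suc K"
  by (simp add: lattice_term_def cmod_power2)

lemma summable_inverse_Suc_power: "p \<ge> 2 \<Longrightarrow> summable (\<lambda>n. 1 / real (Suc n) ^ p)"
  using inverse_power_summable[of p, where 'a = real]
  by (subst summable_Suc_iff[of "\<lambda>n. 1 / real n ^ p"]) (simp add: inverse_eq_divide power_inverse field_simps)

text \<open>The row m = 0 gives zeta(2k), and each row m > 0 is the previous expansion at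
  \<open>m * \<tau>\<close>. The assumption on \<open>K\<close> makes the zero modes, of size 1 /
  m^(2K+1), summable over \<open>m\<close>.\<close>

lemma half_lattice_has_sum:
  assumes "K \<ge> 1"
  shows "\<exists>\<beta>. \<forall>\<tau>. Im \<tau> > 0 \<longrightarrow> (lattice_term K \<tau> has_sum
     (zeta_even K + \<beta> / Im \<tau> ^ (2 * K + 1) +
       (\<Sum>r\<le>K. bessel_coeff K r / Im \<tau> ^ (K + 1 + r) * (2 * Re (eis_series K r \<tau>))))) half_lattice"
proof -
  obtain c where c: "\<And>u v. v > 0 \<Longrightarrow>
     (\<lambda>n. 1 / ((u + real n)\<^sup>2 + v\<^sup>2) ^ Suc K + 1 / ((u - 1 - real n)\<^sup>2 + v\<^sup>2) ^ Suc K) sums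
       (c / v ^ (2 * K + 1) + (\<Sum>r\<le>K. bessel_coeff K r / v ^ (K + 1 + r) * cosine_series (K - r) u v))"
    using inverse_quadratic_power_sums by blast
  \<comment> \<open>The zero mode of row m is c / (m v)^(2K+1), so its \<open>m\<close>-dependence
    sums to zeta(2K+1).\<close>
  define \<beta> where "\<beta> = c * (\<Sum>i. 1 / real (Suc i) ^ (2 * K + 1))"
  show ?thesis
  proof (intro exI[of _ \<beta>] allI impI)
    fix \<tau> :: complex assume im: "Im \<tau> > 0"
    define u v where "u = Re \<tau>" and "v = Im \<tau>"
    have \<tau>: "\<tau> = Complex u v" by (simp add: u_def v_def)
    have v: "v > 0" using im by (simp add: v_def)
    define x where "x i = real (Suc i)" for i
    have x: "x i > 0" for i by (simp add: x_def)
    define R where "R i = c / (x i * v) ^ (2 * K + 1) +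
       (\<Sum>r\<le>K. bessel_coeff K r / (x i * v) ^ (K + 1 + r) * cosine_series (K - r) (x i * u) (x i * v))" for i
    have row: "((\<lambda>n. lattice_term K \<tau> (int (Suc i), n)) has_sum R i) UNIV" for i
    proof (rule has_sum_int_nonneg)
      have "(x i * u + real_of_int (int n))\<^sup>2 = (x i * u + real n)\<^sup>2"
           "(x i * u + real_of_int (- 1 - int n))\<^sup>2 = (x i * u - 1 - real n)\<^sup>2" for n
        by (simp_all add: algebra_simps)
      then show "(\<lambda>n. lattice_term K \<tau> (int (Suc i), int n) + lattice_term K \<tau> (int (Suc i), - 1 - int n)) sums R i"
        using c[of "x i * v" "x i * u"] x[of i] v unfolding lattice_term_eq R_def
        by (simp only: u_def [symmetric] v_def [symmetric] x_def [symmetric] of_int_of_nat_eq mult_pos_pos)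
    qed (rule lattice_term_nonneg)
    define S where "S = \<beta> / v ^ (2 * K + 1) + (\<Sum>r\<le>K. bessel_coeff K r / v ^ (K + 1 + r) * (2 * Re (eis_series K r \<tau>)))"
    have "(\<lambda>i. c / v ^ (2 * K + 1) * (1 / x i ^ (2 * K + 1)) +
       (\<Sum>r\<le>K. bessel_coeff K r / v ^ (K + 1 + r) * (cosine_series (K - r) (x i * u) (x i * v) / x i ^ (K + 1 + r)))) sums
       (c / v ^ (2 * K + 1) * (\<Sum>i. 1 / x i ^ (2 * K + 1)) + (\<Sum>r\<le>K. bessel_coeff K r / v ^ (K + 1 + r) * (2 * Re (eis_series K r \<tau>))))"
      unfolding x_def eis_series_def \<tau>
      by (intro sums_add sums_mult sums_sum summable_sums summable_inverse_Suc_power cosine_series_multiples_sums)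
         (use assms v in auto)
    also have "(\<lambda>i. c / v ^ (2 * K + 1) * (1 / x i ^ (2 * K + 1)) +
       (\<Sum>r\<le>K. bessel_coeff K r / v ^ (K + 1 + r) * (cosine_series (K - r) (x i * u) (x i * v) / x i ^ (K + 1 + r)))) = R"
      unfolding R_def power_mult_distrib by (simp add: fun_eq_iff mult_ac del: power_Suc)
    also have "c / v ^ (2 * K + 1) * (\<Sum>i. 1 / x i ^ (2 * K + 1)) + (\<Sum>r\<le>K. bessel_coeff K r / v ^ (K + 1 + r) * (2 * Re (eis_series K r \<tau>))) = S"
      by (simp add: S_def \<beta>_def x_def)
    finally have "R sums S" .
    moreover have "R i \<ge> 0" for i
      by (rule has_sum_nonneg[OF row]) (simp add: lattice_term_nonneg)
    ultimately have RS: "(R has_sum S) UNIV" by (rule sums_nonneg_imp_has_sum)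
    define h where "h = (\<lambda>(i, n :: int). (int (Suc i), n))"
    have sm: "(\<lambda>p. lattice_term K \<tau> (h p)) summable_on Sigma UNIV (\<lambda>_. UNIV)"
      by (rule summable_on_SigmaI[where g = R])
         (use row RS in \<open>auto simp: h_def lattice_term_nonneg dest: has_sum_imp_summable\<close>)
    have "((\<lambda>p. lattice_term K \<tau> (h p)) has_sum S) (Sigma UNIV (\<lambda>_. UNIV))"
      by (rule has_sum_SigmaI[where g = R]) (use row RS sm in \<open>auto simp: h_def\<close>)
    then have "(lattice_term K \<tau> has_sum S) (h ` UNIV)"
      by (subst has_sum_reindex) (auto simp: inj_on_def h_def o_def)
    also have "h ` UNIV = {(m, n). m > 0}"
    proof -
      have "(m, n) \<in> range h" if "m > 0" for m n :: int
        using that by (intro image_eqI[of _ _ "(nat m - 1, n)"]) (auto simp: h_def)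
      then show ?thesis by (auto simp: h_def)
    qed
    finally have 1: "(lattice_term K \<tau> has_sum S) {(m, n). m > 0}" .
    have "(\<lambda>n. 1 / real (Suc n) ^ (2 * Suc K)) sums zeta_even K"
      unfolding zeta_even_def by (intro summable_sums summable_inverse_Suc_power) auto
    then have "((\<lambda>n. 1 / real (Suc n) ^ (2 * Suc K)) has_sum zeta_even K) UNIV"
      by (rule sums_nonneg_imp_has_sum) simp
    also have "(\<lambda>n. 1 / real (Suc n) ^ (2 * Suc K)) = (\<lambda>n. lattice_term K \<tau> (0, int (Suc n)))"
      unfolding lattice_term_eq by (simp add: power_mult [symmetric] del: power_Suc of_nat_Suc)
    finally have "(lattice_term K \<tau> has_sum zeta_even K) ((\<lambda>n. (0, int (Suc n))) ` UNIV)"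
      by (subst has_sum_reindex) (auto simp: inj_on_def o_def)
    also have "(\<lambda>n. (0, int (Suc n))) ` UNIV = {(m, n). m = 0 \<and> n > 0}"
    proof -
      have "(0, n) \<in> range (\<lambda>n. (0 :: int, int (Suc n)))" if "n > 0" for n :: int
        using that by (intro image_eqI[of _ _ "nat n - 1"]) auto
      then show ?thesis by auto
    qed
    finally have 2: "(lattice_term K \<tau> has_sum zeta_even K) {(m, n). m = 0 \<and> n > 0}" .
    have "half_lattice = {(m, n). m = 0 \<and> n > 0} \<union> {(m, n). m > 0}" by (auto simp: half_lattice_def)
    then show "(lattice_term K \<tau> has_sum
     (zeta_even K + \<beta> / Im \<tau> ^ (2 * K + 1) +
       (\<Sum>r\<le>K. bessel_coeff K r / Im \<tau> ^ (K + 1 + r) * (2 * Re (eis_series K r \<tau>))))) half_lattice"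
      using has_sum_Un_disjoint[OF 2 1] by (auto simp: S_def v_def add.assoc)
  qed
qed

subsection \<open>The Eisenstein series as a lattice sum\<close>

definition primitive_pairs :: "(int \<times> int) set" where
  "primitive_pairs = {(c, d) \<in> half_lattice. coprime c d}"

text \<open>A vector is uniquely its gcd times a coprime pair; \<open>Suc g\<close> stands for the
  gcd, and its positivity preserves the half lattice.\<close>

lemma bij_betw_primitive_pairs:
  "bij_betw (\<lambda>(g, c, d). (int (Suc g) * c, int (Suc g) * d)) (UNIV \<times> primitive_pairs) half_lattice"
proof (rule bij_betw_byWitness[where f' = "\<lambda>(m, n). (nat (gcd m n) - 1, m div gcd m n, n div gcd m n)"])
  let ?h = "\<lambda>(g, c, d). (int (Suc g) * c, int (Suc g) * d)"
  let ?h' = "\<lambda>(m, n). (nat (gcd m n) - 1, m div gcd m n, n div gcd m n)"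
  show "\<forall>a\<in>UNIV \<times> primitive_pairs. ?h' (?h a) = a"
  proof
    fix a assume "a \<in> (UNIV :: nat set) \<times> primitive_pairs"
    then obtain g c d where a: "a = (g, c, d)" and "(c, d) \<in> primitive_pairs" by (cases a) auto
    then have "gcd c d = 1" by (simp add: primitive_pairs_def)
    then have "gcd (int (Suc g) * c) (int (Suc g) * d) = int (Suc g)"
      by (simp only: gcd_mult_left) simp
    then show "?h' (?h a) = a" by (simp add: a)
  qed
  have gcd_pos: "gcd m n > 0" if "(m, n) \<in> half_lattice" for m n
    using that by (auto simp: half_lattice_def gcd_pos_int)
  show "\<forall>a'\<in>half_lattice. ?h (?h' a') = a'"
  proof
    fix a assume "a \<in> half_lattice"
    then obtain m n where a: "a = (m, n)" and mn: "(m, n) \<in> half_lattice" by (cases a) auto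
    from gcd_pos[OF mn] have g: "gcd m n > 0" .
    then have "int (Suc (nat (gcd m n) - 1)) = gcd m n" by linarith
    then show "?h (?h' a) = a" by (simp add: a del: of_nat_Suc)
  qed
  have pos: "int (Suc g) * c > 0 \<longleftrightarrow> c > 0" "int (Suc g) * c = 0 \<longleftrightarrow> c = 0" for g c
    by (auto simp: zero_less_mult_iff)
  show "?h ` (UNIV \<times> primitive_pairs) \<subseteq> half_lattice"
    unfolding primitive_pairs_def half_lattice_def by (auto simp del: of_nat_Suc simp: pos)
  show "?h' ` half_lattice \<subseteq> UNIV \<times> primitive_pairs"
  proof (rule image_subsetI)
    fix x assume "x \<in> half_lattice"
    then obtain m n where x: "x = (m, n)" and H: "(m, n) \<in> half_lattice" by (cases x) auto
    define g where "g = gcd m n"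
    have g: "g > 0" using gcd_pos[OF H] by (simp add: g_def)
    define a b where "a = m div g" and "b = n div g"
    have mn: "m = g * a" "n = g * b" by (simp_all add: g_def a_def b_def)
    have "coprime a b" unfolding a_def b_def g_def
      by (rule div_gcd_coprime) (use g in \<open>auto simp: g_def\<close>)
    moreover have "(a, b) \<in> half_lattice"
      using H g unfolding mn half_lattice_def by (auto simp: zero_less_mult_iff)
    ultimately show "?h' x \<in> UNIV \<times> primitive_pairs"
      by (simp add: x primitive_pairs_def a_def b_def g_def)
  qed
qed

lemma zeta_even_sums: "(\<lambda>n. 1 / real (Suc n) ^ (2 * Suc K)) sums zeta_even K"
  unfolding zeta_even_def by (intro summable_sums summable_inverse_Suc_power) auto

lemma zeta_even_has_sum: "((\<lambda>n. 1 / real (Suc n) ^ (2 * Suc K)) has_sum zeta_even K) UNIV"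
  by (rule sums_nonneg_imp_has_sum[OF zeta_even_sums]) simp

lemma zeta_even_pos: "zeta_even K > 0"
  unfolding zeta_even_def using zeta_even_sums[of K]
  by (intro suminf_pos) (auto simp: sums_iff simp del: power_Suc)

text \<open>The summand is homogeneous of degree -2k. Grouping the vectors by their gcd therefore
  factors the sum into zeta(2k) and the sum over coprime pairs.\<close>

lemma primitive_pairs_has_sum:
  assumes "(lattice_term K \<tau> has_sum S) half_lattice"
  shows "(lattice_term K \<tau> has_sum (S / zeta_even K)) primitive_pairs"
proof -
  let ?h = "\<lambda>(g, c, d). (int (Suc g) * c, int (Suc g) * d)"
  have "lattice_term K \<tau> summable_on primitive_pairs"
    by (rule summable_on_subset_banach[OF has_sum_imp_summable[OF assms]])
       (unfold primitive_pairs_def, blast)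
  then obtain P where P: "(lattice_term K \<tau> has_sum P) primitive_pairs" by (auto simp: summable_on_def)
  have scale: "lattice_term K \<tau> (?h (g, x)) = 1 / real (Suc g) ^ (2 * Suc K) * lattice_term K \<tau> x" for g x
  proof (cases x)
    case (Pair c d)
    have "complex_of_int (int (Suc g) * c) * \<tau> + complex_of_int (int (Suc g) * d) =
      of_nat (Suc g) * (of_int c * \<tau> + of_int d)" by (simp add: algebra_simps)
    then show ?thesis unfolding Pair lattice_term_def power_mult [of "real (Suc g)" 2]
      by (simp add: norm_mult power_mult_distrib del: of_nat_Suc power_Suc)
  qed
  have 1: "((\<lambda>p. lattice_term K \<tau> (?h p)) has_sum S) (Sigma UNIV (\<lambda>_. primitive_pairs))"
    using has_sum_reindex_bij_betw[OF bij_betw_primitive_pairs] assms by blast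
  have 2: "((\<lambda>g. 1 / real (Suc g) ^ (2 * Suc K) * P) has_sum S) UNIV"
    by (rule has_sum_SigmaD[OF 1]) (unfold scale, rule has_sum_cmult_right, rule P)
  have 3: "((\<lambda>g. 1 / real (Suc g) ^ (2 * Suc K) * P) has_sum (zeta_even K * P)) UNIV"
    by (rule has_sum_cmult_left[OF zeta_even_has_sum])
  from has_sum_unique[OF 2 3] have "P = S / zeta_even K" using zeta_even_pos[of K] by simp
  then show ?thesis using P by simp
qed

section \<open>Cosets and bottom rows\<close>

lemma SL2Z_det: "A \<in> SL2Z \<longleftrightarrow> A $ 1 $ 1 * A $ 2 $ 2 - A $ 1 $ 2 * A $ 2 $ 1 = 1"
  by (simp add: SL2Z_def det_2)

lemma coprime_bottom_row:
  assumes "A \<in> SL2Z" shows "coprime (A $ 2 $ 1) (A $ 2 $ 2)"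
proof (rule coprimeI)
  fix x assume "x dvd A $ 2 $ 1" "x dvd A $ 2 $ 2"
  then have "x dvd A $ 1 $ 1 * A $ 2 $ 2 - A $ 1 $ 2 * A $ 2 $ 1" by simp
  then show "x dvd 1" using assms by (simp add: SL2Z_det)
qed

text \<open>The sign is normalized so that the row becomes an invariant of the coset: left
  multiplication by \<open>Gamma_infinity\<close> changes the row by a sign at most.\<close>

definition bottom_row :: "int ^ 2 ^ 2 \<Rightarrow> int \<times> int" where
  "bottom_row A = (if (A $ 2 $ 1, A $ 2 $ 2) \<in> half_lattice then (A $ 2 $ 1, A $ 2 $ 2)
                   else (- A $ 2 $ 1, - A $ 2 $ 2))"

lemma bottom_row_primitive:
  assumes "A \<in> SL2Z" shows "bottom_row A \<in> primitive_pairs"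
proof -
  note c = coprime_bottom_row[OF assms]
  then have "A $ 2 $ 1 \<noteq> 0 \<or> A $ 2 $ 2 \<noteq> 0" by auto
  then show ?thesis using c
    by (auto simp: bottom_row_def primitive_pairs_def half_lattice_def)
qed

lemma Gamma_infinity_iff:
  "P \<in> Gamma_infinity \<longleftrightarrow> (\<exists>n. \<exists>e\<in>{1, -1}. P $ 1 $ 1 = e \<and> P $ 1 $ 2 = e * n \<and> P $ 2 $ 1 = 0 \<and> P $ 2 $ 2 = e)"
  by (auto simp: Gamma_infinity_def vec_eq_iff forall_2 intro: exI[of _ "P $ 1 $ 2"] exI[of _ "- (P $ 1 $ 2)"])

text \<open>Two matrices of determinant 1 with the same second row have first rows differing by an
  integral multiple of it, that is, they differ by a translation; the sign \<open>e\<close> makes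
  the second rows equal.\<close>

lemma Gamma_infinity_rel_iff:
  "(A, B) \<in> Gamma_infinity_rel \<longleftrightarrow> A \<in> SL2Z \<and> B \<in> SL2Z \<and> bottom_row A = bottom_row B"
proof (intro iffI)
  assume "(A, B) \<in> Gamma_infinity_rel"
  then obtain P where AB: "A \<in> SL2Z" "B \<in> SL2Z" and P: "P \<in> Gamma_infinity" "B = P ** A"
    by (auto simp: Gamma_infinity_rel_def)
  from P obtain n e where e: "e = 1 \<or> e = -1" and PE: "P $ 1 $ 1 = e" "P $ 1 $ 2 = e * n" "P $ 2 $ 1 = 0" "P $ 2 $ 2 = e"
    unfolding Gamma_infinity_iff by blast
  have B: "B $ 2 $ 1 = e * A $ 2 $ 1" "B $ 2 $ 2 = e * A $ 2 $ 2"
    by (simp_all add: P(2) matrix_matrix_mult_def sum_2 PE)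
  have "A $ 2 $ 1 \<noteq> 0 \<or> A $ 2 $ 2 \<noteq> 0" using coprime_bottom_row[OF AB(1)] by auto
  then have "bottom_row A = bottom_row B"
    using e by (auto simp: bottom_row_def half_lattice_def B)
  then show "A \<in> SL2Z \<and> B \<in> SL2Z \<and> bottom_row A = bottom_row B" using AB by blast
next
  assume *: "A \<in> SL2Z \<and> B \<in> SL2Z \<and> bottom_row A = bottom_row B"
  then have "B $ 2 $ 1 = A $ 2 $ 1 \<and> B $ 2 $ 2 = A $ 2 $ 2 \<or> B $ 2 $ 1 = - A $ 2 $ 1 \<and> B $ 2 $ 2 = - A $ 2 $ 2"
    by (auto simp: bottom_row_def split: if_splits)
  then have "\<exists>e. (e = 1 \<or> e = -1) \<and> B $ 2 $ 1 = e * A $ 2 $ 1 \<and> B $ 2 $ 2 = e * A $ 2 $ 2"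
  proof
    assume "B $ 2 $ 1 = A $ 2 $ 1 \<and> B $ 2 $ 2 = A $ 2 $ 2" then show ?thesis by (intro exI[of _ 1]) auto
  next
    assume "B $ 2 $ 1 = - A $ 2 $ 1 \<and> B $ 2 $ 2 = - A $ 2 $ 2" then show ?thesis by (intro exI[of _ "-1"]) auto
  qed
  then obtain e where e: "e = 1 \<or> e = -1" and B2: "B $ 2 $ 1 = e * A $ 2 $ 1" "B $ 2 $ 2 = e * A $ 2 $ 2"
    by blast
  define a b c d where "a = A $ 1 $ 1" "b = A $ 1 $ 2" "c = A $ 2 $ 1" "d = A $ 2 $ 2"
  define a' b' where "a' = e * B $ 1 $ 1" "b' = e * B $ 1 $ 2"
  have ee: "e * e = 1" using e by auto
  have d1: "a * d - b * c = 1" using * by (simp add: SL2Z_det a_b_c_d_def)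
  have d2: "a' * d - b' * c = 1" using * by (simp add: SL2Z_det a_b_c_d_def a'_b'_def B2 mult_ac)
  \<comment> \<open>The upper right entry of the sign-corrected \<open>B\<close> times the inverse
    of \<open>A\<close>.\<close>
  define n where "n = a * b' - b * a'"
  have n: "a' = a + n * c" "b' = b + n * d"
    unfolding n_def using d1 d2 by algebra+
  define P :: "int ^ 2 ^ 2" where "P = vector [vector [e, e * n], vector [0, e]]"
  have "P \<in> Gamma_infinity"
    unfolding Gamma_infinity_iff using e by (intro exI[of _ n] bexI[of _ e]) (auto simp: P_def)
  moreover have "B = P ** A"
  proof -
    have "B $ 1 $ 1 = e * a'" "B $ 1 $ 2 = e * b'" using ee by (simp_all add: a'_b'_def mult.assoc [symmetric])
    then show ?thesis unfolding n
      by (simp add: vec_eq_iff forall_2 P_def matrix_matrix_mult_def sum_2 B2)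
         (simp add: a_b_c_d_def algebra_simps)
  qed
  ultimately show "(A, B) \<in> Gamma_infinity_rel" using * by (auto simp: Gamma_infinity_rel_def)
qed

text \<open>The arbitrary choice of representative does no harm, since \<open>bottom_row\<close> is
  constant on each coset. Surjectivity is Bezout's identity, which completes a coprime pair to a
  matrix of determinant 1.\<close>

lemma bij_betw_cosets:
  "bij_betw (\<lambda>C. bottom_row (SOME A. A \<in> C)) (SL2Z // Gamma_infinity_rel) primitive_pairs"
proof -
  let ?f = "\<lambda>C. bottom_row (SOME A. A \<in> C)"
  have cls: "Gamma_infinity_rel `` {A} = {B \<in> SL2Z. bottom_row B = bottom_row A}" if "A \<in> SL2Z" for A
    using that by (auto simp: Gamma_infinity_rel_iff)
  have some: "?f (Gamma_infinity_rel `` {A}) = bottom_row A" if "A \<in> SL2Z" for A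
  proof -
    have "(SOME B. B \<in> Gamma_infinity_rel `` {A}) \<in> Gamma_infinity_rel `` {A}"
      by (rule someI[of _ A]) (use that in \<open>simp add: cls\<close>)
    then show ?thesis by (simp add: cls[OF that])
  qed
  show ?thesis
  proof (rule bij_betw_imageI)
    show "inj_on ?f (SL2Z // Gamma_infinity_rel)"
    proof (rule inj_onI)
      fix C D assume "C \<in> SL2Z // Gamma_infinity_rel" "D \<in> SL2Z // Gamma_infinity_rel" and eq: "?f C = ?f D"
      then obtain A B where AB: "A \<in> SL2Z" "C = Gamma_infinity_rel `` {A}" "B \<in> SL2Z" "D = Gamma_infinity_rel `` {B}"
        by (auto simp: quotient_def)
      then have "bottom_row A = bottom_row B" using eq some by simp
      then show "C = D" using AB by (simp add: cls)
    qed
    show "?f ` (SL2Z // Gamma_infinity_rel) = primitive_pairs"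
    proof
      show "?f ` (SL2Z // Gamma_infinity_rel) \<subseteq> primitive_pairs"
        using some bottom_row_primitive by (auto simp: quotient_def)
      show "primitive_pairs \<subseteq> ?f ` (SL2Z // Gamma_infinity_rel)"
      proof clarify
        fix c d assume cd: "(c, d) \<in> primitive_pairs"
        then have "coprime c d" by (simp add: primitive_pairs_def)
        then obtain x y where xy: "x * c + y * d = 1" using bezout_int[of c d] by auto
        define A :: "int ^ 2 ^ 2" where "A = vector [vector [y, - x], vector [c, d]]"
        have A: "A \<in> SL2Z" using xy by (simp add: A_def SL2Z_det)
        moreover have "bottom_row A = (c, d)"
          using cd by (simp add: bottom_row_def A_def primitive_pairs_def)
        ultimately show "(c, d) \<in> ?f ` (SL2Z // Gamma_infinity_rel)"
          using some[OF A] by (intro image_eqI[of _ _ "Gamma_infinity_rel `` {A}"] quotientI) auto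
      qed
    qed
  qed
qed

lemma SL2Z_denominator_nonzero:
  assumes "A \<in> SL2Z" "Im \<tau> > 0"
  shows "of_int (A $ 2 $ 1) * \<tau> + of_int (A $ 2 $ 2) \<noteq> 0"
proof
  assume 0: "of_int (A $ 2 $ 1) * \<tau> + of_int (A $ 2 $ 2) = 0"
  then have "Im (of_int (A $ 2 $ 1) * \<tau> + of_int (A $ 2 $ 2)) = 0" by simp
  then have "A $ 2 $ 1 = 0" using assms(2) by simp
  with 0 have "A $ 2 $ 2 = 0" by simp
  with \<open>A $ 2 $ 1 = 0\<close> coprime_bottom_row[OF assms(1)] show False by simp
qed

lemma Im_modular_act:
  assumes "A \<in> SL2Z"
  shows "Im (modular_act A \<tau>) = Im \<tau> / (norm (of_int (A $ 2 $ 1) * \<tau> + of_int (A $ 2 $ 2)))\<^sup>2"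
proof -
  define a b c d where "a = real_of_int (A $ 1 $ 1)" "b = real_of_int (A $ 1 $ 2)" "c = real_of_int (A $ 2 $ 1)" "d = real_of_int (A $ 2 $ 2)"
  have "a * d - b * c = real_of_int (A $ 1 $ 1 * A $ 2 $ 2 - A $ 1 $ 2 * A $ 2 $ 1)"
    by (simp add: a_b_c_d_def)
  then have "a * d - b * c = 1" using assms unfolding SL2Z_det by simp
  then have "a * Im \<tau> * (c * Re \<tau> + d) - (a * Re \<tau> + b) * (c * Im \<tau>) = Im \<tau>" by algebra
  then show ?thesis
    unfolding modular_act_def moebius_def cmod_power2
    by (simp add: Im_divide a_b_c_d_def)
qed

lemma Im_modular_act_pos:
  assumes "A \<in> SL2Z" "Im \<tau> > 0" shows "Im (modular_act A \<tau>) > 0"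
  using SL2Z_denominator_nonzero[OF assms] assms(2) by (simp add: Im_modular_act[OF assms(1)])

lemma lattice_term_uminus: "lattice_term K \<tau> (- m, - n) = lattice_term K \<tau> (m, n)"
proof -
  have "of_int (- m) * \<tau> + of_int (- n) = - (of_int m * \<tau> + of_int n)" by simp
  then show ?thesis unfolding lattice_term_def by (simp only: prod.case norm_minus_cancel)
qed

text \<open>Im(A \<tau>)^k is v^k times a lattice term that sees only the second row of
  \<open>A\<close>, up to sign. The coset sum is thus a sum over coprime pairs, and zeta(2k)
  converts it to the half lattice.\<close>

lemma maass_eisenstein_eq:
  assumes "(lattice_term K \<tau> has_sum S) half_lattice" "Im \<tau> > 0"
  shows "maass_eisenstein \<tau> (of_nat (Suc K)) = of_real (S / zeta_even K * Im \<tau> ^ Suc K)"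
proof -
  define g where "g x = complex_of_real (Im \<tau> ^ Suc K * lattice_term K \<tau> x)" for x
  have "of_real (Im (modular_act (SOME A. A \<in> C) \<tau>)) powr of_nat (Suc K) = g (bottom_row (SOME A. A \<in> C))"
    if C: "C \<in> SL2Z // Gamma_infinity_rel" for C
  proof -
    define A where "A = (SOME A. A \<in> C)"
    obtain B where B: "B \<in> SL2Z" "C = Gamma_infinity_rel `` {B}" using C by (auto simp: quotient_def)
    have "A \<in> C" unfolding A_def by (rule someI[of _ B]) (use B in \<open>simp add: Gamma_infinity_rel_iff\<close>)
    then have A: "A \<in> SL2Z" using B by (simp add: Gamma_infinity_rel_iff)
    have "of_real (Im (modular_act A \<tau>)) powr of_nat (Suc K) = complex_of_real (Im (modular_act A \<tau>) ^ Suc K)"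
      using Im_modular_act_pos[OF A assms(2)]
      by (metis less_imp_le of_real_of_nat_eq powr_of_real powr_realpow)
    also have "Im (modular_act A \<tau>) ^ Suc K = Im \<tau> ^ Suc K * lattice_term K \<tau> (A $ 2 $ 1, A $ 2 $ 2)"
      by (simp add: Im_modular_act[OF A] lattice_term_def power_divide del: power_Suc)
    also have "lattice_term K \<tau> (A $ 2 $ 1, A $ 2 $ 2) = lattice_term K \<tau> (bottom_row A)"
      by (simp add: bottom_row_def lattice_term_uminus)
    finally show ?thesis by (simp add: g_def A_def)
  qed
  then have "maass_eisenstein \<tau> (of_nat (Suc K)) = (\<Sum>\<^sub>\<infinity>C \<in> SL2Z // Gamma_infinity_rel. g (bottom_row (SOME A. A \<in> C)))"
    unfolding maass_eisenstein_def by (rule infsum_cong)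
  also have "\<dots> = infsum g primitive_pairs"
    by (rule infsum_reindex_bij_betw[OF bij_betw_cosets])
  also have "\<dots> = of_real (Im \<tau> ^ Suc K * (S / zeta_even K))"
    unfolding g_def by (intro infsumI has_sum_of_real has_sum_cmult_right primitive_pairs_has_sum assms)
  finally show ?thesis by (simp add: mult_ac)
qed

text \<open>The half lattice is not stable under the modular group while the punctured lattice is,
  so invariance is proved on the latter.\<close>

lemma full_lattice_has_sum:
  assumes "(lattice_term K \<tau> has_sum S) half_lattice"
  shows "(lattice_term K \<tau> has_sum (2 * S)) (- {(0, 0)})"
proof -
  let ?n = "\<lambda>(m, n). (- m, - n) :: int \<times> int"
  have "((\<lambda>x. lattice_term K \<tau> (?n x)) has_sum S) half_lattice"
    using assms by (simp add: lattice_term_uminus case_prod_unfold)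
  then have 2: "(lattice_term K \<tau> has_sum S) (?n ` half_lattice)"
    by (subst has_sum_reindex) (auto simp: inj_on_def o_def)
  have "x \<in> half_lattice \<union> ?n ` half_lattice" if "x \<noteq> (0, 0)" for x
  proof (cases x)
    case (Pair m n)
    show ?thesis
    proof (cases "(m, n) \<in> half_lattice")
      case False
      then have "(- m, - n) \<in> half_lattice" using that by (auto simp: Pair half_lattice_def)
      then have "?n (- m, - n) \<in> ?n ` half_lattice" by (rule imageI)
      then show ?thesis by (simp add: Pair)
    qed (simp add: Pair)
  qed
  then have "half_lattice \<union> ?n ` half_lattice = - {(0, 0)}" by (auto simp: half_lattice_def)
  moreover have "half_lattice \<inter> ?n ` half_lattice = {}" by (auto simp: half_lattice_def)
  ultimately show ?thesis using has_sum_Un_disjoint[OF assms 2] by simp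
qed

text \<open>A matrix of determinant 1 permutes the nonzero lattice vectors. The factor |c \<tau> +
  d|^(2k) that each term acquires is exactly what the power of the imaginary part loses.\<close>

lemma half_lattice_sum_modular:
  assumes A: "A \<in> SL2Z" and im: "Im \<tau> > 0"
  assumes S: "(lattice_term K \<tau> has_sum S) half_lattice"
  assumes S': "(lattice_term K (modular_act A \<tau>) has_sum S') half_lattice"
  shows "S' * Im (modular_act A \<tau>) ^ Suc K = S * Im \<tau> ^ Suc K"
proof -
  define a b c d where "a = A $ 1 $ 1" "b = A $ 1 $ 2" "c = A $ 2 $ 1" "d = A $ 2 $ 2"
  have det: "a * d - b * c = 1" using A by (simp add: SL2Z_det a_b_c_d_def)
  define D where "D = of_int c * \<tau> + of_int d"
  have D0: "D \<noteq> 0" using SL2Z_denominator_nonzero[OF A im] by (simp add: D_def a_b_c_d_def)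
  \<comment> \<open>The row vector (m, n) times \<open>A\<close>; the inverse matrix gives the
    witness for bijectivity.\<close>
  let ?L = "\<lambda>(m, n). (m * a + n * c, m * b + n * d)"
  have bij: "bij_betw ?L (- {(0, 0)}) (- {(0, 0)})"
  proof (rule bij_betw_byWitness[where f' = "\<lambda>(x, y). (d * x - c * y, a * y - b * x)"])
    have 1: "d * (m * a + n * c) - c * (m * b + n * d) = m" "a * (m * b + n * d) - b * (m * a + n * c) = n" for m n
      using det by algebra+
    have 2: "(d * x - c * y) * a + (a * y - b * x) * c = x" "(d * x - c * y) * b + (a * y - b * x) * d = y" for x y
      using det by algebra+
    show "\<forall>p\<in>- {(0, 0)}. (case ?L p of (x, y) \<Rightarrow> (d * x - c * y, a * y - b * x)) = p"
      by (auto simp: 1)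
    show "\<forall>p\<in>- {(0, 0)}. ?L (case p of (x, y) \<Rightarrow> (d * x - c * y, a * y - b * x)) = p"
      by (auto simp: 2)
    have nz: "m = 0 \<and> n = 0" if "m * a + n * c = 0" "m * b + n * d = 0" for m n
      using that det by (intro conjI; algebra)
    show "?L ` (- {(0, 0)}) \<subseteq> - {(0, 0)}"
    proof (rule image_subsetI)
      fix p :: "int \<times> int" assume "p \<in> - {(0, 0)}"
      then have "?L p \<noteq> (0, 0)"
        using nz[of "fst p" "snd p"] by (simp only: Compl_iff singleton_iff prod.case prod.inject case_prod_unfold prod_eq_iff fst_conv snd_conv) blast
      then show "?L p \<in> - {(0, 0)}" by blast
    qed
    have nz': "x = 0 \<and> y = 0" if "d * x - c * y = 0" "a * y - b * x = 0" for x y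
      using that det by (intro conjI; algebra)
    show "(\<lambda>(x, y). (d * x - c * y, a * y - b * x)) ` (- {(0, 0)}) \<subseteq> - {(0, 0)}"
    proof (rule image_subsetI)
      fix p :: "int \<times> int" assume "p \<in> - {(0, 0)}"
      then have "(\<lambda>(x, y). (d * x - c * y, a * y - b * x)) p \<noteq> (0, 0)"
        using nz'[of "fst p" "snd p"] by (simp only: Compl_iff singleton_iff prod.case prod.inject case_prod_unfold prod_eq_iff fst_conv snd_conv) blast
      then show "(\<lambda>(x, y). (d * x - c * y, a * y - b * x)) p \<in> - {(0, 0)}" by blast
    qed
  qed
  have tr: "lattice_term K (modular_act A \<tau>) x = (norm D)\<^sup>2 ^ Suc K * lattice_term K \<tau> (?L x)" for x
  proof (cases x)
    case (Pair m n)
    have "of_int m * modular_act A \<tau> + of_int n = (of_int (m * a + n * c) * \<tau> + of_int (m * b + n * d)) / D"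
    proof -
      have "modular_act A \<tau> = (of_int a * \<tau> + of_int b) / D"
        by (simp add: modular_act_def moebius_def a_b_c_d_def D_def)
      then have "of_int m * modular_act A \<tau> + of_int n = (of_int m * (of_int a * \<tau> + of_int b) + of_int n * D) / D"
        using D0 by (simp add: add_divide_distrib distrib_left)
      also have "of_int m * (of_int a * \<tau> + of_int b) + of_int n * D = of_int (m * a + n * c) * \<tau> + of_int (m * b + n * d)"
        by (simp add: D_def algebra_simps)
      finally show ?thesis .
    qed
    then show ?thesis
      unfolding Pair lattice_term_def using D0 by (simp add: norm_divide power_divide del: power_Suc)
  qed
  have "((\<lambda>x. (norm D)\<^sup>2 ^ Suc K * lattice_term K \<tau> (?L x)) has_sum (norm D)\<^sup>2 ^ Suc K * (2 * S)) (- {(0, 0)})"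
    using full_lattice_has_sum[OF S] has_sum_reindex_bij_betw[OF bij]
    by (intro has_sum_cmult_right) blast
  then have "(lattice_term K (modular_act A \<tau>) has_sum (norm D)\<^sup>2 ^ Suc K * (2 * S)) (- {(0, 0)})"
    by (simp only: tr [symmetric])
  from has_sum_unique[OF this full_lattice_has_sum[OF S']]
  have "S' = (norm D)\<^sup>2 ^ Suc K * S" by simp
  moreover have "Im (modular_act A \<tau>) = Im \<tau> / (norm D)\<^sup>2"
    by (simp add: Im_modular_act[OF A] D_def a_b_c_d_def)
  ultimately show ?thesis using D0 by (simp add: power_divide del: power_Suc)
qed

subsection \<open>Bernoulli numbers and even zeta values\<close>

text \<open>At u = 0 the paired terms become \<open>a n + a (Suc n)\<close>: every positive integer
  counts twice and 0 once, which explains the subtracted 1 / v^2 and the division by 2.\<close>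

lemma inverse_square_sums:
  assumes "v > 0"
  shows "(\<lambda>n. 1 / ((real (Suc n))\<^sup>2 + v\<^sup>2)) sums
           ((pi / v * (1 + 2 / (exp (2 * pi * v) - 1)) - 1 / v\<^sup>2) / 2)"
proof -
  define a where "a n = 1 / ((real n)\<^sup>2 + v\<^sup>2)" for n
  have q: "nome (Complex 0 v) = of_real (exp (- 2 * pi * v))"
  proof -
    have "2 * of_real pi * \<i> * Complex 0 v = of_real (- 2 * pi * v)" by (simp add: complex_eq_iff)
    then show ?thesis unfolding nome_def by (simp add: exp_of_real del: of_real_mult of_real_minus)
  qed
  have "(\<lambda>n. nome (Complex 0 v) * nome (Complex 0 v) ^ n) sums (nome (Complex 0 v) * (1 / (1 - nome (Complex 0 v))))"
    by (intro sums_mult geometric_sums norm_nome_less_1) (use assms in simp)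
  then have "qsum (\<lambda>_. 1) (Complex 0 v) = of_real (exp (- 2 * pi * v) / (1 - exp (- 2 * pi * v)))"
    unfolding qsum_def q by (simp add: sums_iff)
  moreover have "exp (- 2 * pi * v) / (1 - exp (- 2 * pi * v)) = 1 / (exp (2 * pi * v) - 1)"
    using assms by (simp add: exp_minus field_simps)
  ultimately have qs: "Re (qsum (\<lambda>_. 1) (Complex 0 v)) = 1 / (exp (2 * pi * v) - 1)"
    by simp
  have "(\<lambda>n. a n + a (Suc n)) sums (pi / v * (1 + 2 / (exp (2 * pi * v) - 1)))"
  proof -
    have "(0 - 1 - real n)\<^sup>2 = (real (Suc n))\<^sup>2" for n by (simp add: power2_eq_square algebra_simps)
    then show ?thesis
      using inverse_quadratic_sums[OF assms, of 0] unfolding qs a_def by (simp del: of_nat_Suc)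
  qed
  note s = this
  have sm: "summable (\<lambda>n. a (Suc n))"
    by (rule summable_comparison_test'[OF sums_summable[OF s], of 0]) (simp add: a_def)
  have "(\<lambda>n. a n) sums (a 0 + (\<Sum>n. a (Suc n)))"
    using summable_sums[OF sm] by (simp add: sums_Suc_iff add.commute)
  from sums_unique2[OF s sums_add[OF this summable_sums[OF sm]]]
  have eq: "(\<Sum>n. a (Suc n)) = ((pi / v * (1 + 2 / (exp (2 * pi * v) - 1)) - 1 / v\<^sup>2) / 2)"
    by (simp add: a_def)
  show ?thesis using summable_sums[OF sm] unfolding eq unfolding a_def .
qed

text \<open>For v < 1 each v^2 / (n^2 + v^2) is a geometric series in - v^2 / n^2, and the two
  summations are exchanged under the majorant v^(2j) / n^2.\<close>

lemma zeta_even_power_sums: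
  assumes "0 < v" "v < 1"
  shows "(\<lambda>j. (-1) ^ j * v ^ (2 * j + 2) * zeta_even j) sums (v\<^sup>2 * (\<Sum>n. 1 / ((real (Suc n))\<^sup>2 + v\<^sup>2)))"
proof -
  define f where "f = (\<lambda>(j, n). (-1) ^ j * v ^ (2 * j + 2) * (1 / real (Suc n) ^ (2 * Suc j)))"
  have v2: "v\<^sup>2 < 1" "v\<^sup>2 > 0" using assms by (auto simp: power_less_one_iff)
  have s2: "summable (\<lambda>n. 1 / real (Suc n) ^ 2)" by (rule summable_inverse_Suc_power) simp
  have g1: "((\<lambda>n. (v\<^sup>2) ^ j * (1 / real (Suc n) ^ 2)) has_sum ((v\<^sup>2) ^ j * (\<Sum>n. 1 / real (Suc n) ^ 2))) UNIV" for j
    by (intro sums_nonneg_imp_has_sum sums_mult summable_sums s2) auto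
  have "(\<lambda>j. (v\<^sup>2) ^ j * (\<Sum>n. 1 / real (Suc n) ^ 2)) summable_on UNIV"
    by (intro summable_on_cmult_left) (use v2 in \<open>simp add: summable_on_UNIV_nonneg_real_iff summable_geometric\<close>)
  then have g: "(\<lambda>(j, n). (v\<^sup>2) ^ j * (1 / real (Suc n) ^ 2)) summable_on Sigma UNIV (\<lambda>_. UNIV)"
    using g1 by (intro summable_on_SigmaI) auto
  have absf: "(\<lambda>x. norm (f x)) summable_on Sigma UNIV (\<lambda>_. UNIV)"
  proof (rule summable_on_comparison_test[OF g])
    fix x :: "nat \<times> nat"
    obtain j n where x: "x = (j, n)" by (cases x)
    have "v ^ (2 * j + 2) * (1 / real (Suc n) ^ (2 * Suc j)) \<le> (v\<^sup>2) ^ j * (1 / real (Suc n) ^ 2)"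
    proof (intro mult_mono)
      show "v ^ (2 * j + 2) \<le> (v\<^sup>2) ^ j"
        unfolding power_mult [symmetric] using assms by (intro power_decreasing) auto
      show "1 / real (Suc n) ^ (2 * Suc j) \<le> 1 / real (Suc n) ^ 2"
        by (intro divide_left_mono power_increasing) auto
    qed (use assms in auto)
    then show "norm (f x) \<le> (case x of (j, n) \<Rightarrow> (v\<^sup>2) ^ j * (1 / real (Suc n) ^ 2))"
      using assms by (simp add: x f_def abs_mult power_abs del: power_Suc of_nat_Suc)
  qed auto
  then have "f summable_on Sigma UNIV (\<lambda>_. UNIV)" by (rule abs_summable_summable)
  then obtain S where S: "(f has_sum S) (Sigma UNIV (\<lambda>_. UNIV))" by (auto simp: summable_on_def)
  have "((\<lambda>j. (-1) ^ j * v ^ (2 * j + 2) * zeta_even j) has_sum S) UNIV"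
    by (rule has_sum_SigmaD[OF S])
       (unfold f_def prod.case, intro has_sum_cmult_right sums_nonneg_imp_has_sum, unfold zeta_even_def,
        intro summable_sums summable_inverse_Suc_power, auto)
  then have 1: "(\<lambda>j. (-1) ^ j * v ^ (2 * j + 2) * zeta_even j) sums S" by (rule has_sum_imp_sums)
  have "((\<lambda>x. f (prod.swap x)) has_sum S) (Sigma UNIV (\<lambda>_. UNIV))"
    using has_sum_reindex_bij_betw[OF bij_swap, of f S] S by simp
  then have "((\<lambda>n. v\<^sup>2 * (1 / ((real (Suc n))\<^sup>2 + v\<^sup>2))) has_sum S) UNIV"
  proof (rule has_sum_SigmaD)
    fix n :: nat
    define y where "y = v\<^sup>2 / (real (Suc n))\<^sup>2"
    have y: "0 \<le> y" "y < 1"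
    proof -
      have "1 \<le> (real (Suc n))\<^sup>2" by (rule one_le_power) simp
      then have "v\<^sup>2 < (real (Suc n))\<^sup>2" using v2 by linarith
      then show "y < 1" by (simp add: y_def divide_less_eq del: of_nat_Suc)
    qed (simp add: y_def)
    have e: "f (j, n) = y * (- y) ^ j" for j
    proof -
      have "f (j, n) = (-1) ^ j * y ^ Suc j"
        unfolding f_def y_def prod.case power_divide power_mult [symmetric] by (simp del: power_Suc)
      then show ?thesis by (simp add: power_minus[of y] mult_ac)
    qed
    have "(\<lambda>j. y * (- y) ^ j) sums (y * (1 / (1 - (- y))))"
      by (intro sums_mult geometric_sums) (use y in auto)
    moreover have "summable (\<lambda>j. norm (y * (- y) ^ j))"
      using y by (simp add: abs_mult power_abs summable_geometric summable_mult)
    ultimately have "((\<lambda>j. y * (- y) ^ j) has_sum (y * (1 / (1 - (- y))))) UNIV"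
      by (intro norm_summable_imp_has_sum)
    moreover have "y * (1 / (1 - (- y))) = v\<^sup>2 * (1 / ((real (Suc n))\<^sup>2 + v\<^sup>2))"
      using v2 by (simp add: y_def divide_simps del: of_nat_Suc)
    ultimately show "((\<lambda>j. f (prod.swap (n, j))) has_sum v\<^sup>2 * (1 / ((real (Suc n))\<^sup>2 + v\<^sup>2))) UNIV"
      by (simp add: e)
  qed
  then have "(\<lambda>n. v\<^sup>2 * (1 / ((real (Suc n))\<^sup>2 + v\<^sup>2))) sums S" by (rule has_sum_imp_sums)
  moreover have "(\<lambda>n. v\<^sup>2 * (1 / ((real (Suc n))\<^sup>2 + v\<^sup>2))) sums (v\<^sup>2 * (\<Sum>n. 1 / ((real (Suc n))\<^sup>2 + v\<^sup>2)))"
    using inverse_square_sums[OF assms(1)] by (intro sums_mult summable_sums) (auto simp: sums_iff)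
  ultimately have "S = v\<^sup>2 * (\<Sum>n. 1 / ((real (Suc n))\<^sup>2 + v\<^sup>2))" by (rule sums_unique2)
  then show ?thesis using 1 by simp
qed

text \<open>The candidate for t / (e^t - 1), with Euler's values of zeta at even integers already
  inserted. The index of the coefficient is shifted because \<open>zeta_even j\<close> is zeta(2j +
  2).\<close>

definition bernoulli_fps :: "real fps" where
  "bernoulli_fps = Abs_fps (\<lambda>n. if n = 0 then 1 else if n = 1 then - 1 / 2 else if even n
     then 2 * (-1) ^ (n div 2 - 1) * zeta_even (n div 2 - 1) / (2 * pi) ^ n else 0)"

text \<open>The scaling v = |t| / (2 pi) turns e^(2 pi v) into e^|t| and the condition v < 1 into
  |t| < 2 pi. Negative \<open>t\<close> is covered because t / (e^t - 1) + t / 2 is even.\<close>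

lemma bernoulli_fps_sums:
  assumes "0 < \<bar>t\<bar>" "\<bar>t\<bar> < 2 * pi"
  shows "(\<lambda>n. fps_nth bernoulli_fps n * t ^ n) sums (t / (exp t - 1))"
proof -
  define v where "v = \<bar>t\<bar> / (2 * pi)"
  have v: "0 < v" "v < 1" using assms by (auto simp: v_def)
  have tv: "\<bar>t\<bar> = 2 * pi * v" by (simp add: v_def)
  define h where "h n = (if even n \<and> n \<ge> 2 then fps_nth bernoulli_fps n * t ^ n else 0)" for n
  have hj: "h (2 * j + 2) = 2 * ((-1) ^ j * v ^ (2 * j + 2) * zeta_even j)" for j
  proof -
    have "t ^ (2 * j + 2) = (2 * pi) ^ (2 * j + 2) * v ^ (2 * j + 2)"
      unfolding power_mult_distrib [symmetric] tv [symmetric] by (rule power_even_abs [symmetric]) simp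
    then show ?thesis by (simp add: h_def bernoulli_fps_def del: power_Suc)
  qed
  define E where "E = 2 * (v\<^sup>2 * (\<Sum>n. 1 / ((real (Suc n))\<^sup>2 + v\<^sup>2)))"
  have "(\<lambda>j. h (2 * j + 2)) sums E"
    unfolding hj E_def by (intro sums_mult zeta_even_power_sums v)
  then have "h sums E"
  proof (subst (asm) sums_mono_reindex)
    show "strict_mono (\<lambda>j. 2 * j + 2 :: nat)" by (simp add: strict_mono_def)
    fix n :: nat assume n: "n \<notin> range (\<lambda>j. 2 * j + 2)"
    have "n \<in> range (\<lambda>j. 2 * j + 2)" if "even n" "n \<ge> 2"
      using that by (intro image_eqI[of _ _ "(n - 2) div 2"]) auto
    then show "h n = 0" using n unfolding h_def by auto
  qed
  from sums_add[OF sums_add[OF sums_single[of 0 "\<lambda>_. 1"] sums_single[of 1 "\<lambda>_. - t / 2"]] this]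
  have "(\<lambda>n. (if n = 0 then 1 else 0) + (if n = 1 then - t / 2 else 0) + h n) sums (1 + - t / 2 + E)" .
  also have "(\<lambda>n. (if n = 0 then 1 else 0) + (if n = 1 then - t / 2 else 0) + h n) = (\<lambda>n. fps_nth bernoulli_fps n * t ^ n)"
    by (auto simp: fun_eq_iff h_def bernoulli_fps_def)
  also have "1 + - t / 2 + E = t / (exp t - 1)"
  proof -
    have ne: "exp \<bar>t\<bar> - 1 \<noteq> 0" using assms by simp
    have "E = v\<^sup>2 * (pi / v * (1 + 2 / (exp \<bar>t\<bar> - 1)) - 1 / v\<^sup>2)"
      using inverse_square_sums[OF v(1)] unfolding E_def tv by (simp add: sums_iff)
    also have "\<dots> = pi * v * (1 + 2 / (exp \<bar>t\<bar> - 1)) - 1"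
      using v by (simp add: right_diff_distrib power2_eq_square)
    also have "\<dots> = \<bar>t\<bar> / 2 + \<bar>t\<bar> / (exp \<bar>t\<bar> - 1) - 1"
      unfolding tv by (simp add: algebra_simps)
    finally have E: "E = \<bar>t\<bar> / 2 + \<bar>t\<bar> / (exp \<bar>t\<bar> - 1) - 1" .
    show ?thesis
    proof (cases "t > 0")
      case True then show ?thesis by (simp add: E)
    next
      case False
      then have "exp \<bar>t\<bar> = inverse (exp t)" using assms by (simp add: exp_minus)
      moreover have "exp t \<noteq> 1" using assms by auto
      ultimately show ?thesis using False
        by (simp add: E divide_simps) (simp add: algebra_simps)
    qed
  qed
  finally show ?thesis .
qed

text \<open>If a function vanishes near 0, so does its derivative; hence the coefficient of index n
  + 1 is reduced to that of index n in \<open>fps_deriv F\<close>.\<close>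

lemma eval_fps_real_eq_0D:
  fixes F :: "real fps"
  assumes "fps_conv_radius F > 0" "eventually (\<lambda>t. eval_fps F t = 0) (nhds 0)"
  shows "F = 0"
proof (rule fps_ext)
  fix n
  from assms have "fps_nth F n = 0"
  proof (induction n arbitrary: F)
    case 0
    then have "eval_fps F 0 = 0" by (rule_tac eventually_nhds_x_imp_x)
    then show ?case by (simp add: eval_fps_at_0)
  next
    case (Suc n)
    have r: "fps_conv_radius (fps_deriv F) > 0"
      using Suc.prems(1) fps_conv_radius_deriv[of F] by (rule less_le_trans)
    obtain \<epsilon> where \<epsilon>: "\<epsilon> > 0" "ereal \<epsilon> < fps_conv_radius F"
      using ereal_dense2[OF Suc.prems(1)] by auto
    have "eventually (\<lambda>t. t \<in> ball 0 \<epsilon>) (nhds (0 :: real))"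
      using \<epsilon> by (intro eventually_nhds_in_open) auto
    moreover have "eventually (\<lambda>t. eventually (\<lambda>t. eval_fps F t = 0) (nhds t)) (nhds 0)"
      using Suc.prems(2) by (simp add: eventually_eventually)
    ultimately have "eventually (\<lambda>t. eval_fps (fps_deriv F) t = 0) (nhds 0)"
    proof eventually_elim
      fix t assume t: "t \<in> ball 0 \<epsilon>" "eventually (\<lambda>t. eval_fps F t = 0) (nhds t)"
      have "(eval_fps F has_field_derivative eval_fps (fps_deriv F) t) (at t)"
        using t \<epsilon> by (intro has_field_derivative_eval_fps) (auto intro: less_trans[of _ "ereal \<epsilon>"])
      moreover have "(eval_fps F has_field_derivative 0) (at t)"
        using t(2) by (subst DERIV_cong_ev[OF refl _ refl, where g = "\<lambda>_. 0"]) auto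
      ultimately show "eval_fps (fps_deriv F) t = 0" by (rule DERIV_unique)
    qed
    from Suc.IH[OF r this] show ?case by (simp add: fps_deriv_nth)
  qed
  then show "fps_nth F n = fps_nth 0 n" by simp
qed

text \<open>With the denominator cleared, the claim is that a series of positive radius vanishes
  near 0. The origin is treated apart, since the summation formula excludes it.\<close>

lemma bernoulli_fps_eq: "fps_X / (fps_exp 1 - 1) = bernoulli_fps"
proof -
  have R: "fps_conv_radius bernoulli_fps \<ge> ereal (2 * pi)"
    unfolding fps_conv_radius_def
  proof (rule conv_radius_geI_ex')
    fix r :: real assume "0 < r" "ereal r < ereal (2 * pi)"
    then show "summable (\<lambda>n. fps_nth bernoulli_fps n * of_real r ^ n)"
      using bernoulli_fps_sums[of r] by (auto simp: sums_iff)
  qed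
  have "bernoulli_fps * (fps_exp 1 - 1) - fps_X = 0"
  proof (rule eval_fps_real_eq_0D)
    have r: "fps_conv_radius (fps_exp 1 - 1 :: real fps) = \<infinity>"
      using fps_conv_radius_diff[of "fps_exp 1 :: real fps" 1] by simp
    have "ereal (2 * pi) \<le> min (fps_conv_radius bernoulli_fps) (fps_conv_radius (fps_exp 1 - 1 :: real fps))"
      using R r by simp
    also have "\<dots> \<le> fps_conv_radius (bernoulli_fps * (fps_exp 1 - 1))" by (rule fps_conv_radius_mult)
    finally have r': "ereal (2 * pi) \<le> fps_conv_radius (bernoulli_fps * (fps_exp 1 - 1))" .
    also have "\<dots> = min (fps_conv_radius (bernoulli_fps * (fps_exp 1 - 1))) (fps_conv_radius (fps_X :: real fps))" by simp
    also have "\<dots> \<le> fps_conv_radius (bernoulli_fps * (fps_exp 1 - 1) - fps_X)" by (rule fps_conv_radius_diff)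
    finally have "ereal (2 * pi) \<le> fps_conv_radius (bernoulli_fps * (fps_exp 1 - 1) - fps_X)" .
    then show "fps_conv_radius (bernoulli_fps * (fps_exp 1 - 1) - fps_X) > 0"
      by (rule less_le_trans[rotated]) simp
    have "eventually (\<lambda>t. t \<in> ball 0 (2 * pi)) (nhds (0 :: real))"
      by (intro eventually_nhds_in_open) auto
    then show "eventually (\<lambda>t. eval_fps (bernoulli_fps * (fps_exp 1 - 1) - fps_X) t = 0) (nhds 0)"
    proof eventually_elim
      fix t :: real assume t: "t \<in> ball 0 (2 * pi)"
      then have tr: "ereal (norm t) < fps_conv_radius bernoulli_fps"
        using R by (auto intro: less_le_trans[of _ "ereal (2 * pi)"])
      have e: "eval_fps (fps_exp 1 - 1) t = exp t - 1"
        by (subst eval_fps_diff) (auto simp: eval_fps_exp)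
      have "eval_fps (bernoulli_fps * (fps_exp 1 - 1)) t = eval_fps bernoulli_fps t * (exp t - 1)"
        using tr r by (subst eval_fps_mult) (auto simp: e)
      also have "\<dots> = t"
      proof (cases "t = 0")
        case False
        then show ?thesis using bernoulli_fps_sums[of t] t by (simp add: eval_fps_def sums_iff)
      qed simp
      finally show "eval_fps (bernoulli_fps * (fps_exp 1 - 1) - fps_X) t = 0"
        using r' t by (subst eval_fps_diff) (auto intro: less_le_trans[of _ "ereal (2 * pi)"])
    qed
  qed
  then have "bernoulli_fps * (fps_exp 1 - 1) = fps_X" by simp
  moreover have "fps_exp 1 - 1 \<noteq> (0 :: real fps)"
  proof
    assume "fps_exp 1 - 1 = (0 :: real fps)"
    then have "fps_nth (fps_exp 1 - 1 :: real fps) 1 = 0" by simp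
    then show False by simp
  qed
  ultimately show ?thesis by (metis nonzero_mult_div_cancel_right)
qed

lemma bernoulli_number_zeta:
  "bernoulli_number (2 * Suc K) = fact (2 * Suc K) * 2 * (-1) ^ K * zeta_even K / (2 * pi) ^ (2 * Suc K)"
  unfolding bernoulli_number_def bernoulli_fps_eq by (simp add: bernoulli_fps_def)

subsection \<open>The logarithmic series\<close>

definition alt_coeff :: "nat \<Rightarrow> nat \<Rightarrow> real" where
  "alt_coeff K N = divisor_conv (\<lambda>i j. (-1) ^ j * real (Suc j) ^ K / real (Suc i) ^ Suc K) N"

text \<open>Changing the sign at even cofactors removes their terms twice. An even cofactor 2e of 2M
  belongs to a divisor of M with cofactor e, and 2 (2e)^K = 2^(K+1) e^K.\<close>

lemma alt_coeff_eq:
  "alt_coeff K N = eis_coeff K N -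
     (if even (Suc N) then 2 ^ Suc K * eis_coeff K (Suc N div 2 - 1) else 0)"
proof -
  define D where "D n = {d. d dvd n}" for n :: nat
  define e where "e d = real (Suc N div d) ^ K / real d ^ Suc K" for d
  have pos: "0 < d" "0 < M div d" if "d dvd M" "M > 0" for d M :: nat
    using that by (auto intro: Nat.gr0I simp: div_greater_zero_iff dest: dvd_imp_le)
  have alt: "alt_coeff K N = (\<Sum>d\<in>D (Suc N). (-1) ^ (Suc N div d - 1) * e d)"
    unfolding alt_coeff_def divisor_conv_def D_def
  proof (intro sum.cong refl)
    fix d assume "d \<in> {d. d dvd Suc N}"
    then have "Suc (d - 1) = d" "Suc (Suc N div d - 1) = Suc N div d" using pos[of d "Suc N"] by auto
    then show "(-1) ^ (Suc N div d - 1) * real (Suc (Suc N div d - 1)) ^ K / real (Suc (d - 1)) ^ Suc K =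
       (-1) ^ (Suc N div d - 1) * e d"
      by (simp add: e_def del: power_Suc)
  qed
  have eis: "eis_coeff K (M - 1) = (\<Sum>d\<in>D M. real (M div d) ^ K / real d ^ Suc K)" if M: "M > 0" for M
    unfolding eis_coeff_def divisor_conv_def D_def
  proof (intro sum.cong)
    fix d assume "d \<in> {d. d dvd M}"
    then show "real (Suc (Suc (M - 1) div d - 1)) ^ K / real (Suc (d - 1)) ^ Suc K = real (M div d) ^ K / real d ^ Suc K"
      using M pos[of d M] by simp
  qed (use M in auto)
  have eisN: "eis_coeff K N = (\<Sum>d\<in>D (Suc N). e d)"
    using eis[of "Suc N"] by (simp add: e_def)
  have fin: "finite (D n)" if "n > 0" for n using that by (simp add: D_def)
  have "eis_coeff K N - alt_coeff K N = (\<Sum>d\<in>D (Suc N). (1 - (-1) ^ (Suc N div d - 1)) * e d)"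
    unfolding alt eisN by (simp add: sum_subtractf left_diff_distrib)
  also have "\<dots> = (if even (Suc N) then 2 ^ Suc K * eis_coeff K (Suc N div 2 - 1) else 0)"
  proof (cases "even (Suc N)")
    case False
    have "(1 - (-1) ^ (Suc N div d - 1)) * e d = 0" if d: "d \<in> D (Suc N)" for d
    proof -
      from d obtain m where m: "Suc N = d * m" by (auto simp: D_def)
      then have "odd m" "d > 0" using False by (auto intro: Nat.gr0I)
      then have "even (Suc N div d - 1)" unfolding m by simp
      then show ?thesis by simp
    qed
    then show ?thesis using False by (simp add: sum.neutral)
  next
    case True
    then obtain M where M: "Suc N = 2 * M" by (rule evenE)
    then have M0: "M > 0" by simp
    have "(\<Sum>d\<in>D (Suc N). (1 - (-1) ^ (Suc N div d - 1)) * e d) = (\<Sum>d\<in>D M. (1 - (-1) ^ (Suc N div d - 1)) * e d)"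
    proof (rule sum.mono_neutral_right)
      show "finite (D (Suc N))" by (rule fin) simp
      show "D M \<subseteq> D (Suc N)" unfolding M D_def by auto
      show "\<forall>d\<in>D (Suc N) - D M. (1 - (-1) ^ (Suc N div d - 1)) * e d = 0"
      proof
        fix d assume d: "d \<in> D (Suc N) - D M"
        then obtain m where m: "Suc N = d * m" by (auto simp: D_def)
        have "odd m"
        proof
          assume "even m"
          then obtain m' where "m = 2 * m'" by blast
          then have "M = d * m'" using m M by simp
          then show False using d by (simp add: D_def)
        qed
        moreover have "d > 0" using m by (auto intro: Nat.gr0I)
        ultimately have "even (Suc N div d - 1)" unfolding m by simp
        then show "(1 - (-1) ^ (Suc N div d - 1)) * e d = 0" by simp
      qed
    qed
    also have "\<dots> = (\<Sum>d\<in>D M. 2 ^ Suc K * (real (M div d) ^ K / real d ^ Suc K))"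
    proof (rule sum.cong[OF refl])
      fix d assume "d \<in> D M"
      then obtain m where m: "M = d * m" by (auto simp: D_def)
      then have dm: "d > 0" "m > 0" using M0 by (auto intro: Nat.gr0I)
      have N: "Suc N div d = 2 * m" "M div d = m" unfolding M m using dm by simp_all
      have "odd (2 * m - 1)" using dm by simp
      then show "(1 - (-1) ^ (Suc N div d - 1)) * e d = 2 ^ Suc K * (real (M div d) ^ K / real d ^ Suc K)"
        unfolding e_def N by (simp add: power_mult_distrib)
    qed
    also have "\<dots> = 2 ^ Suc K * eis_coeff K (M - 1)"
      unfolding eis[OF M0] sum_distrib_left ..
    finally show ?thesis using M by simp
  qed
  finally show ?thesis by simp
qed

lemma qsum_alt_coeff:
  assumes "Im \<tau> > 0" "r \<le> K"
  shows "disc_summable (\<lambda>N. of_real (alt_coeff K N / real (Suc N) ^ r))"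
    and "qsum (\<lambda>N. of_real (alt_coeff K N / real (Suc N) ^ r)) \<tau> =
           eis_series K r \<tau> - 2 ^ Suc K / 2 ^ r * eis_series K r (2 * \<tau>)"
proof -
  define a where "a N = complex_of_real (eis_coeff K N / real (Suc N) ^ r)" for N
  \<comment> \<open>Index \<open>N\<close> carries the exponent N + 1, so the even exponents 2M sit
    at odd indices. The denominator 2^r comes from (2M)^r.\<close>
  define b where "b N = (if even (Suc N) then 2 ^ Suc K / 2 ^ r * a (Suc N div 2 - 1) else 0)" for N
  have ab: "of_real (alt_coeff K N / real (Suc N) ^ r) = a N - b N" for N
  proof (cases "even (Suc N)")
    case True
    then obtain M where M: "Suc N = 2 * M" by (rule evenE)
    then have "M > 0" by simp
    then have "Suc (M - 1) = M" by simp
    then show ?thesis using True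
      unfolding alt_coeff_eq a_def b_def M by (simp add: power_mult_distrib diff_divide_distrib del: power_Suc)
  next
    case False
    then show ?thesis unfolding alt_coeff_eq a_def b_def by simp
  qed
  have da: "disc_summable a" unfolding a_def by (rule disc_summable_eis[OF assms(2)])
  have sb: "(\<lambda>N. b N * z ^ Suc N) sums (2 ^ Suc K / 2 ^ r * (\<Sum>M. a M * (z ^ 2) ^ Suc M))"
    and sb': "summable (\<lambda>N. b N * z ^ N)" if z: "norm z < 1" for z
  proof -
    have z2: "norm (z ^ 2) < 1" using z by (simp add: norm_power power_less_one_iff)
    have "(\<lambda>M. 2 ^ Suc K / 2 ^ r * (a M * (z ^ 2) ^ Suc M)) sums (2 ^ Suc K / 2 ^ r * (\<Sum>M. a M * (z ^ 2) ^ Suc M))"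
      by (intro sums_mult summable_sums disc_summableD_Suc da z2)
    also have "(\<lambda>M. 2 ^ Suc K / 2 ^ r * (a M * (z ^ 2) ^ Suc M)) = (\<lambda>M. b (2 * M + 1) * z ^ Suc (2 * M + 1))"
      unfolding power_mult [symmetric] by (simp add: fun_eq_iff b_def)
    finally show *: "(\<lambda>N. b N * z ^ Suc N) sums (2 ^ Suc K / 2 ^ r * (\<Sum>M. a M * (z ^ 2) ^ Suc M))"
    proof (subst (asm) sums_mono_reindex)
      show "strict_mono (\<lambda>M. 2 * M + 1 :: nat)" by (simp add: strict_mono_def)
      fix n :: nat assume "n \<notin> range (\<lambda>M. 2 * M + 1)"
      then have "even n" by (metis oddE rangeI)
      then show "b n * z ^ Suc n = 0" by (simp add: b_def)
    qed
    show "summable (\<lambda>N. b N * z ^ N)"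
    proof (cases "z = 0")
      case True then show ?thesis by (intro summable_finite[of "{0}"]) auto
    next
      case False
      have "summable (\<lambda>N. z * (b N * z ^ N))" using * by (simp add: sums_iff mult_ac)
      then show ?thesis using False by (subst (asm) summable_cmult_iff) auto
    qed
  qed
  have db: "disc_summable b" unfolding disc_summable_def using sb' by blast
  show "disc_summable (\<lambda>N. of_real (alt_coeff K N / real (Suc N) ^ r))"
    unfolding ab by (rule disc_summable_diff[OF da db])
  have q: "norm (nome \<tau>) < 1" using assms by (simp add: norm_nome_less_1)
  have "qsum (\<lambda>N. of_real (alt_coeff K N / real (Suc N) ^ r)) \<tau> =
    (\<Sum>N. a N * nome \<tau> ^ Suc N) - (\<Sum>N. b N * nome \<tau> ^ Suc N)"
    unfolding qsum_def ab left_diff_distrib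
    by (intro suminf_diff [symmetric] disc_summableD_Suc da db q)
  also have "(\<Sum>N. b N * nome \<tau> ^ Suc N) = 2 ^ Suc K / 2 ^ r * eis_series K r (2 * \<tau>)"
    using sb[OF q] nome_power[of \<tau> 2] unfolding eis_series_def qsum_def a_def by (simp add: sums_iff)
  finally show "qsum (\<lambda>N. of_real (alt_coeff K N / real (Suc N) ^ r)) \<tau> =
           eis_series K r \<tau> - 2 ^ Suc K / 2 ^ r * eis_series K r (2 * \<tau>)"
    by (simp add: eis_series_def qsum_def a_def)
qed

text \<open>With r = i + 1 and m = j + 1 this is the coefficient of q^(r m) in the logarithmic
  series after \<open>p\<close> Euler operators, each of which multiplies zeta^(m/r) by m /
  r.\<close>

definition log_coeff :: "nat \<Rightarrow> complex \<Rightarrow> nat \<Rightarrow> nat \<Rightarrow> complex" where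
  "log_coeff p \<zeta> i j = of_real ((-1) ^ j / real (Suc j) * (real (Suc j) / real (Suc i)) ^ p) *
     \<zeta> powr of_real (real (Suc j) / real (Suc i))"

lemma norm_powr_of_real:
  "z \<noteq> 0 \<Longrightarrow> norm ((z :: complex) powr of_real a) = norm z powr a"
  by (simp add: powr_def)

text \<open>Enlarging the exponent m / r to r m is wasteful, but then the power of \<rho> merges
  with the power of \<open>q\<close> into one of \<open>\<rho> * norm q\<close>.\<close>

lemma norm_log_coeff_le:
  assumes "norm \<zeta> \<le> \<rho>" "\<rho> \<ge> 1" "Re \<zeta> > 0"
  shows "norm (log_coeff p \<zeta> i j) \<le> real (Suc j) ^ p * \<rho> ^ (Suc i * Suc j)"
proof -
  have "norm (\<zeta> powr of_real (real (Suc j) / real (Suc i))) = norm \<zeta> powr (real (Suc j) / real (Suc i))"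
    using assms(3) by (intro norm_powr_of_real) auto
  also have "\<dots> \<le> \<rho> powr (real (Suc j) / real (Suc i))"
    using assms by (intro powr_mono2) auto
  also have "\<dots> \<le> \<rho> powr (real (Suc i * Suc j))"
  proof (rule powr_mono)
    have "real (Suc j) / real (Suc i) \<le> real (Suc j) / 1" by (intro divide_left_mono) auto
    also have "\<dots> \<le> real (Suc i * Suc j)" by simp
    finally show "real (Suc j) / real (Suc i) \<le> real (Suc i * Suc j)" .
  qed fact
  also have "\<dots> = \<rho> ^ (Suc i * Suc j)" using assms by (subst powr_realpow) auto
  finally have 1: "norm (\<zeta> powr of_real (real (Suc j) / real (Suc i))) \<le> \<rho> ^ (Suc i * Suc j)" .
  have "(real (Suc j) / real (Suc i)) ^ p \<le> (real (Suc j) / 1) ^ p"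
    by (intro power_mono divide_left_mono) auto
  moreover have "1 / real (Suc j) \<le> 1" by simp
  ultimately have "1 / real (Suc j) * (real (Suc j) / real (Suc i)) ^ p \<le> 1 * (real (Suc j) / 1) ^ p"
    by (intro mult_mono) auto
  then have 2: "norm (complex_of_real ((-1) ^ j / real (Suc j) * (real (Suc j) / real (Suc i)) ^ p)) \<le> real (Suc j) ^ p"
    unfolding norm_of_real by (simp add: abs_mult power_abs del: of_nat_Suc)
  show ?thesis unfolding log_coeff_def norm_mult by (intro mult_mono 1 2) auto
qed

lemma log_coeff_has_field_derivative:
  assumes "Re \<zeta> > 0"
  shows "((\<lambda>\<zeta>. log_coeff p \<zeta> i j) has_field_derivative log_coeff (Suc p) \<zeta> i j / \<zeta>) (at \<zeta>)"
proof -
  define x where "x = complex_of_real (real (Suc j) / real (Suc i))"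
  have z: "\<zeta> \<notin> \<real>\<^sub>\<le>\<^sub>0" "\<zeta> \<noteq> 0" using assms by (auto simp: complex_nonpos_Reals_iff)
  have "((\<lambda>\<zeta>. \<zeta> powr x) has_field_derivative x * (\<zeta> powr x / \<zeta>)) (at \<zeta>)"
    using has_field_derivative_powr[OF z(1), of x] z by (simp add: powr_diff)
  from DERIV_cmult[OF this, of "of_real ((-1) ^ j / real (Suc j) * (real (Suc j) / real (Suc i)) ^ p)"]
  show ?thesis unfolding log_coeff_def x_def [symmetric]
    by (simp add: x_def mult_ac del: of_nat_Suc)
qed

definition log_series :: "nat \<Rightarrow> complex \<Rightarrow> complex \<Rightarrow> complex" where
  "log_series p q \<zeta> = (\<Sum>N. divisor_conv (log_coeff p \<zeta>) N * q ^ Suc N)"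

text \<open>\<open>Suc N\<close> has at most \<open>Suc N\<close> divisors, each contributing at
  most (N + 1)^p \<rho>^(N+1). The bound is uniform in \<zeta>, as the Weierstrass test
  needs.\<close>

lemma divisor_conv_log_coeff_bound:
  assumes "norm \<zeta> \<le> \<rho>" "\<rho> \<ge> 1" "Re \<zeta> > 0"
  shows "norm (divisor_conv (log_coeff p \<zeta>) N * q ^ Suc N) \<le> real (Suc N) ^ Suc p * (\<rho> * norm q) ^ Suc N"
proof -
  have "norm (divisor_conv (log_coeff p \<zeta>) N) \<le> (\<Sum>d | d dvd Suc N. real (Suc N) ^ p * \<rho> ^ Suc N)"
    unfolding divisor_conv_def
  proof (rule sum_norm_le)
    fix d assume "d \<in> {d. d dvd Suc N}"
    then obtain m where m: "Suc N = d * m" by auto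
    then have dm: "d > 0" "m > 0" by (auto intro: Nat.gr0I)
    have "norm (log_coeff p \<zeta> (d - 1) (m - 1)) \<le> real m ^ p * \<rho> ^ (d * m)"
      using norm_log_coeff_le[OF assms, of p "d - 1" "m - 1"] dm by simp
    also have "real m ^ p \<le> real (Suc N) ^ p"
      unfolding m using dm by (intro power_mono) auto
    finally show "norm (log_coeff p \<zeta> (d - 1) (Suc N div d - 1)) \<le> real (Suc N) ^ p * \<rho> ^ Suc N"
      using dm assms by (simp add: m mult_right_mono)
  qed
  also have "\<dots> = real (card {d. d dvd Suc N}) * (real (Suc N) ^ p * \<rho> ^ Suc N)" by simp
  also have "\<dots> \<le> real (Suc N) * (real (Suc N) ^ p * \<rho> ^ Suc N)"
  proof (intro mult_right_mono)
    have "d \<in> {1..Suc N}" if "d dvd Suc N" for d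
      using that dvd_imp_le[OF that] by (cases d) auto
    then have "{d. d dvd Suc N} \<subseteq> {1..Suc N}" by blast
    from card_mono[OF _ this] show "real (card {d. d dvd Suc N}) \<le> real (Suc N)" by simp
  qed (use assms in auto)
  finally have "norm (divisor_conv (log_coeff p \<zeta>) N) \<le> real (Suc N) ^ Suc p * \<rho> ^ Suc N"
    by (simp add: mult_ac)
  then have "norm (divisor_conv (log_coeff p \<zeta>) N) * norm q ^ Suc N \<le> real (Suc N) ^ Suc p * \<rho> ^ Suc N * norm q ^ Suc N"
    by (intro mult_right_mono) auto
  then show ?thesis by (simp add: norm_mult norm_power power_mult_distrib mult_ac)
qed

text \<open>The half-plane \<open>Re \<zeta> > 0\<close> avoids the branch cut of the powers, and
  the disc of radius \<rho> keeps the majorant geometric. The quotient by \<zeta> is what the Euler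
  operator undoes.\<close>

lemma log_series_has_field_derivative:
  assumes \<rho>: "\<rho> > 1" "\<rho> * norm q < 1" and \<zeta>: "Re \<zeta> > 0" "norm \<zeta> < \<rho>"
  shows "(log_series p q has_field_derivative log_series (Suc p) q \<zeta> / \<zeta>) (at \<zeta>)"
proof -
  define S where "S = {\<zeta>. Re \<zeta> > 0} \<inter> ball 0 \<rho>"
  have S: "open S" unfolding S_def by (intro open_Int open_halfspace_Re_gt open_ball)
  have "summable (\<lambda>n. norm (complex_of_nat (Suc n) ^ Suc p * complex_of_real (\<rho> * norm q) ^ Suc n))"
    by (rule disc_summableD_Suc_norm[OF disc_summable_power]) (use \<rho> in \<open>simp add: abs_mult norm_mult\<close>)
  then have h: "summable (\<lambda>n. real (Suc n) ^ Suc p * (\<rho> * norm q) ^ Suc n)"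
    using \<rho> by (simp add: norm_mult norm_power abs_mult del: of_nat_Suc power_Suc)
  have d: "((\<lambda>\<zeta>. divisor_conv (log_coeff p \<zeta>) n * q ^ Suc n) has_field_derivative
      divisor_conv (log_coeff (Suc p) \<zeta>) n * q ^ Suc n / \<zeta>) (at \<zeta>)" if "\<zeta> \<in> S" for n \<zeta>
  proof -
    have "((\<lambda>\<zeta>. divisor_conv (log_coeff p \<zeta>) n) has_field_derivative
      (\<Sum>d | d dvd Suc n. log_coeff (Suc p) \<zeta> (d - 1) (Suc n div d - 1) / \<zeta>)) (at \<zeta>)"
      unfolding divisor_conv_def
      by (intro DERIV_sum log_coeff_has_field_derivative) (use that in \<open>simp add: S_def\<close>)
    from DERIV_cmult_right[OF this, of "q ^ Suc n"] show ?thesis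
      by (simp add: divisor_conv_def sum_divide_distrib [symmetric])
  qed
  have b: "norm (divisor_conv (log_coeff p \<zeta>) n * q ^ Suc n) \<le> real (Suc n) ^ Suc p * (\<rho> * norm q) ^ Suc n"
    if "\<zeta> \<in> S" for n \<zeta>
    using that \<rho> by (intro divisor_conv_log_coeff_bound) (auto simp: S_def)
  have ev: "\<forall>\<^sub>F n in sequentially. \<forall>\<zeta>\<in>S. norm (divisor_conv (log_coeff p \<zeta>) n * q ^ Suc n)
      \<le> real (Suc n) ^ Suc p * (\<rho> * norm q) ^ Suc n"
    using b by (intro always_eventually) blast
  obtain g g' where gg: "\<forall>x\<in>S. (\<lambda>n. divisor_conv (log_coeff p x) n * q ^ Suc n) sums g x \<and>
     (\<lambda>n. divisor_conv (log_coeff (Suc p) x) n * q ^ Suc n / x) sums g' x \<and> (g has_field_derivative g' x) (at x)"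
    using series_and_derivative_comparison[OF S h d ev] by blast
  have \<zeta>S: "\<zeta> \<in> S" using \<zeta> by (simp add: S_def)
  have g: "g x = log_series p q x" if "x \<in> S" for x
    using gg that unfolding log_series_def by (auto simp: sums_iff)
  have "g' \<zeta> = log_series (Suc p) q \<zeta> / \<zeta>"
  proof -
    have "\<zeta> \<noteq> 0" using \<zeta> by auto
    have "(\<lambda>n. \<zeta> * (divisor_conv (log_coeff (Suc p) \<zeta>) n * q ^ Suc n / \<zeta>)) sums (\<zeta> * g' \<zeta>)"
      using gg \<zeta>S by (intro sums_mult) auto
    then have "log_series (Suc p) q \<zeta> = \<zeta> * g' \<zeta>"
      unfolding log_series_def using \<open>\<zeta> \<noteq> 0\<close> by (simp add: sums_iff)
    then show ?thesis using \<open>\<zeta> \<noteq> 0\<close> by simp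
  qed
  moreover have "(log_series p q has_field_derivative g' \<zeta>) (at \<zeta>)"
    by (rule has_field_derivative_transform_within_open[of g _ _ S]) (use gg g \<zeta>S S in auto)
  ultimately show ?thesis by simp
qed

text \<open>The argument of each logarithm differs from 1 by at most \<open>\<rho> * norm q\<close>
  in modulus, so the logarithmic power series applies; powers of the principal root are again
  principal powers of \<zeta>.\<close>

lemma log_series_0:
  assumes \<rho>: "\<rho> > 1" "\<rho> * norm q < 1" and \<zeta>: "Re \<zeta> > 0" "norm \<zeta> < \<rho>"
  shows "(\<Sum>r. Ln (1 + \<zeta> powr (1 / of_nat (Suc r)) * q ^ Suc r)) = log_series 0 q \<zeta>"
proof -
  have z0: "\<zeta> \<noteq> 0" using \<zeta> by auto
  have q1: "norm q < 1" using \<rho> by (smt (verit, ccfv_SIG) mult_le_cancel_right1 norm_ge_zero)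
  have "norm (log_coeff 0 \<zeta> i j * q ^ (Suc i * Suc j)) \<le> real (Suc j) ^ 0 * (\<rho> * norm q) ^ (Suc i * Suc j)" for i j
    using mult_right_mono[OF norm_log_coeff_le[of \<zeta> \<rho> 0 i j], of "norm q ^ (Suc i * Suc j)"] \<rho> \<zeta>
    by (simp add: norm_mult norm_power power_mult_distrib del: mult_Suc mult_Suc_right)
  then have "(\<lambda>(i, j). norm (log_coeff 0 \<zeta> i j * q ^ (Suc i * Suc j))) summable_on UNIV"
    using \<rho> by (intro abs_summable_pairs_bound[of "\<rho> * norm q" _ 0]) auto
  from has_sum_divisor_conv(2)[OF this]
  have "(\<lambda>i. \<Sum>j. log_coeff 0 \<zeta> i j * q ^ (Suc i * Suc j)) sums log_series 0 q \<zeta>"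
    by (simp add: log_series_def)
  moreover have "(\<Sum>j. log_coeff 0 \<zeta> i j * q ^ (Suc i * Suc j)) = Ln (1 + \<zeta> powr (1 / of_nat (Suc i)) * q ^ Suc i)" for i
  proof -
    define w where "w = \<zeta> powr (1 / of_nat (Suc i)) * q ^ Suc i"
    have "norm (\<zeta> powr (1 / of_nat (Suc i))) = norm \<zeta> powr (1 / real (Suc i))"
      using norm_powr_of_real[OF z0, of "1 / real (Suc i)"] by simp
    also have "\<dots> \<le> \<rho> powr (1 / real (Suc i))" using \<zeta> by (intro powr_mono2) auto
    also have "\<dots> \<le> \<rho> powr 1" using \<rho> by (intro powr_mono) auto
    finally have "norm (\<zeta> powr (1 / of_nat (Suc i))) \<le> \<rho>" using \<rho> by simp
    moreover have "norm q ^ Suc i \<le> norm q ^ 1" using q1 by (intro power_decreasing) auto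
    ultimately have "norm w \<le> \<rho> * norm q"
      unfolding w_def norm_mult norm_power using \<rho> by (intro mult_mono) auto
    then have w: "norm w < 1" using \<rho> by simp
    have "(\<lambda>n. (-1) ^ Suc (Suc n) / of_nat (Suc n) * w ^ Suc n) sums Ln (1 + w)"
      using Ln_series[OF w] by (subst sums_Suc_iff) simp
    also have "(\<lambda>n. (-1) ^ Suc (Suc n) / of_nat (Suc n) * w ^ Suc n) = (\<lambda>j. log_coeff 0 \<zeta> i j * q ^ (Suc i * Suc j))"
    proof
      fix n
      have "w ^ Suc n = \<zeta> powr (of_nat (Suc n) * (1 / of_nat (Suc i))) * q ^ (Suc i * Suc n)"
        unfolding w_def power_mult_distrib power_mult using z0 by (subst powr_power) auto
      then show "(-1) ^ Suc (Suc n) / of_nat (Suc n) * w ^ Suc n = log_coeff 0 \<zeta> i n * q ^ (Suc i * Suc n)"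
        by (simp add: log_coeff_def del: mult_Suc mult_Suc_right of_nat_Suc)
    qed
    finally show ?thesis by (simp add: w_def sums_iff)
  qed
  ultimately show ?thesis by (simp add: sums_iff)
qed

text \<open>Although only \<zeta> = 1 is wanted, the induction covers an open set around it, because
  \<open>deriv\<close> depends on nearby values.\<close>

lemma g_series_nome:
  assumes "Im \<tau> > 0"
  shows "g_series (Suc K) (nome \<tau>) = qsum (\<lambda>N. of_real (alt_coeff K N)) \<tau>"
proof -
  define q where "q = nome \<tau>"
  have q: "0 < norm q" "norm q < 1" using assms by (auto simp: q_def norm_nome_less_1)
  then have "1 < 1 / norm q" by simp
  then obtain \<rho> where r: "1 < \<rho>" "\<rho> < 1 / norm q" using dense by blast
  then have \<rho>: "\<rho> > 1" "\<rho> * norm q < 1" using q by (auto simp: field_simps)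
  define S where "S = {\<zeta>. Re \<zeta> > 0} \<inter> ball 0 \<rho>"
  have S: "open S" unfolding S_def by (intro open_Int open_halfspace_Re_gt open_ball)
  have eu: "(euler_op ^^ p) (\<lambda>\<zeta>. \<Sum>r. Ln (1 + \<zeta> powr (1 / of_nat (Suc r)) * q ^ Suc r)) \<zeta> = log_series p q \<zeta>"
    if "\<zeta> \<in> S" for p \<zeta>
    using that
  proof (induction p arbitrary: \<zeta>)
    case 0
    then show ?case using log_series_0[OF \<rho>, of \<zeta>] by (simp add: S_def)
  next
    case (Suc p)
    define G where "G = (euler_op ^^ p) (\<lambda>\<zeta>. \<Sum>r. Ln (1 + \<zeta> powr (1 / of_nat (Suc r)) * q ^ Suc r))"
    have d: "(log_series p q has_field_derivative log_series (Suc p) q \<zeta> / \<zeta>) (at \<zeta>)"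
      using Suc.prems by (intro log_series_has_field_derivative[OF \<rho>]) (auto simp: S_def)
    have "(G has_field_derivative log_series (Suc p) q \<zeta> / \<zeta>) (at \<zeta>)"
      by (rule has_field_derivative_transform_within_open[OF d S Suc.prems]) (simp only: G_def Suc.IH)
    then have "deriv G \<zeta> = log_series (Suc p) q \<zeta> / \<zeta>" by (rule DERIV_imp_deriv)
    moreover have "\<zeta> \<noteq> 0" using Suc.prems by (auto simp: S_def)
    ultimately have "euler_op G \<zeta> = log_series (Suc p) q \<zeta>" by (simp add: euler_op_def)
    then show ?case by (simp only: funpow.simps o_apply G_def)
  qed
  have "1 \<in> S" using \<rho> by (simp add: S_def)
  then have "g_series (Suc K) q = log_series (Suc K) q 1" unfolding g_series_def by (rule eu)
  also have "\<dots> = qsum (\<lambda>N. of_real (alt_coeff K N)) \<tau>"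
    unfolding log_series_def qsum_def q_def alt_coeff_def divisor_conv_def log_coeff_def
    by (simp add: power_divide)
  finally show ?thesis by (simp add: q_def)
qed

subsection \<open>Fourier expansion\<close>

lemma maass_eisenstein_expansion:
  assumes "K \<ge> 1"
  shows "\<exists>\<beta>. \<forall>\<tau>. Im \<tau> > 0 \<longrightarrow> maass_eisenstein \<tau> (of_nat (Suc K)) =
    of_real ((zeta_even K + \<beta> / Im \<tau> ^ (2 * K + 1) +
       (\<Sum>r\<le>K. bessel_coeff K r / Im \<tau> ^ (K + 1 + r) * (2 * Re (eis_series K r \<tau>)))) / zeta_even K * Im \<tau> ^ Suc K)"
proof -
  obtain \<beta> where \<beta>: "\<forall>\<tau>. Im \<tau> > 0 \<longrightarrow> (lattice_term K \<tau> has_sum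
     (zeta_even K + \<beta> / Im \<tau> ^ (2 * K + 1) +
       (\<Sum>r\<le>K. bessel_coeff K r / Im \<tau> ^ (K + 1 + r) * (2 * Re (eis_series K r \<tau>))))) half_lattice"
    using half_lattice_has_sum[OF assms] ..
  show ?thesis
  proof (rule exI[of _ \<beta>], intro allI impI)
    fix \<tau> :: complex assume im: "Im \<tau> > 0"
    show "maass_eisenstein \<tau> (of_nat (Suc K)) =
      of_real ((zeta_even K + \<beta> / Im \<tau> ^ (2 * K + 1) +
       (\<Sum>r\<le>K. bessel_coeff K r / Im \<tau> ^ (K + 1 + r) * (2 * Re (eis_series K r \<tau>)))) / zeta_even K * Im \<tau> ^ Suc K)"
      by (rule maass_eisenstein_eq[OF \<beta>[rule_format, OF im] im])
  qed
qed

lemma maass_eisenstein_modular: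
  assumes "K \<ge> 1" "A \<in> SL2Z" "Im \<tau> > 0"
  shows "maass_eisenstein (modular_act A \<tau>) (of_nat (Suc K)) = maass_eisenstein \<tau> (of_nat (Suc K))"
proof -
  define S where "S \<tau> = infsum (lattice_term K \<tau>) half_lattice" for \<tau>
  obtain \<beta> where "\<forall>\<tau>. Im \<tau> > 0 \<longrightarrow> (lattice_term K \<tau> has_sum
     (zeta_even K + \<beta> / Im \<tau> ^ (2 * K + 1) +
       (\<Sum>r\<le>K. bessel_coeff K r / Im \<tau> ^ (K + 1 + r) * (2 * Re (eis_series K r \<tau>))))) half_lattice"
    using half_lattice_has_sum[OF assms(1)] ..
  then have S: "(lattice_term K \<tau> has_sum S \<tau>) half_lattice" if "Im \<tau> > 0" for \<tau>
    using that unfolding S_def by (intro has_sum_infsum has_sum_imp_summable) (rule allE, assumption, erule mp)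
  note im = Im_modular_act_pos[OF assms(2,3)]
  from half_lattice_sum_modular[OF assms(2,3) S[OF assms(3)] S[OF im]] show ?thesis
    unfolding maass_eisenstein_eq[OF S[OF assms(3)] assms(3)] maass_eisenstein_eq[OF S[OF im] im]
    by (simp only: times_divide_eq_left)
qed

section \<open>Expansion of the completed series\<close>

definition alt_series :: "nat \<Rightarrow> nat \<Rightarrow> complex \<Rightarrow> complex" where
  "alt_series K r = qsum (\<lambda>N. of_real (alt_coeff K N / real (Suc N) ^ r))"

text \<open>The factor (k-1)! / pi^k is what the normalization of \<open>g_hat\<close> leaves once
  zeta(2k) has cancelled; it makes the coefficient of index 0 equal to 1.\<close>

definition hat_coeff :: "nat \<Rightarrow> nat \<Rightarrow> real" where
  "hat_coeff K r = fact K / pi ^ Suc K * bessel_coeff K r"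

lemma hat_coeff_0 [simp]: "hat_coeff K 0 = 1"
  by (simp add: hat_coeff_def bessel_coeff_def)

text \<open>The Bernoulli number is replaced by zeta(2k). The two signs multiply to 1, and (2
  pi)^(2k) = (4 pi)^k pi^k.\<close>

lemma g_hat_prefactor:
  "g_hat (Suc K) \<tau> = of_real (fact K * zeta_even K / pi ^ Suc K) *
     (maass_eisenstein \<tau> (of_nat (Suc K)) - 2 ^ Suc K * maass_eisenstein (2 * \<tau>) (of_nat (Suc K)))"
proof -
  have "(-1) ^ (Suc K + 1) * (4 * pi) ^ Suc K * fact (Suc K - 1) * bernoulli_number (2 * Suc K) / (2 * fact (2 * Suc K))
      = fact K * zeta_even K / pi ^ Suc K"
  proof -
    have "(2 * pi) ^ (2 * Suc K) = (4 * pi) ^ Suc K * pi ^ Suc K"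
      unfolding power_mult power_mult_distrib [symmetric] by (simp add: power2_eq_square mult_ac)
    moreover have "(-1) ^ (Suc K + 1) * (-1) ^ K = (1 :: real)"
      by (simp add: power_add [symmetric])
    ultimately show ?thesis unfolding bernoulli_number_zeta
      by (simp add: divide_simps del: power_Suc fact_Suc mult_Suc_right)
  qed
  then have "complex_of_real ((-1) ^ (Suc K + 1) * (4 * pi) ^ Suc K * fact (Suc K - 1) * bernoulli_number (2 * Suc K) / (2 * fact (2 * Suc K)))
      = of_real (fact K * zeta_even K / pi ^ Suc K)" by (simp only:)
  then show ?thesis unfolding g_hat_def
    by (simp only: of_real_mult of_real_divide of_real_power of_real_minus of_real_1 of_real_fact of_real_numeral)
qed

text \<open>The power v^(k+r) in the denominators meets the factor v^k of the Eisenstein series,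
  leaving 1 / v^r. In the combination with \<open>2 * \<tau>\<close> the coefficient of v^(1-k)
  merely changes sign, because 1 - 2^(K+1) / 2^K = -1.\<close>

lemma g_hat_expansion:
  assumes K: "K \<ge> 1"
  shows "\<exists>\<alpha> \<beta>. \<forall>\<tau>. Im \<tau> > 0 \<longrightarrow> g_hat (Suc K) \<tau> =
    of_real (\<alpha> * Im \<tau> ^ Suc K + \<beta> / Im \<tau> ^ K + (\<Sum>r\<le>K. hat_coeff K r / Im \<tau> ^ r * (2 * Re (alt_series K r \<tau>))))"
proof -
  obtain \<beta> where \<beta>: "\<And>\<tau>. Im \<tau> > 0 \<Longrightarrow> maass_eisenstein \<tau> (of_nat (Suc K)) =
    of_real ((zeta_even K + \<beta> / Im \<tau> ^ (2 * K + 1) +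
       (\<Sum>r\<le>K. bessel_coeff K r / Im \<tau> ^ (K + 1 + r) * (2 * Re (eis_series K r \<tau>)))) / zeta_even K * Im \<tau> ^ Suc K)"
    using maass_eisenstein_expansion[OF K] by blast
  define c where "c = fact K / pi ^ Suc K"
  have E: "of_real (fact K * zeta_even K / pi ^ Suc K) * maass_eisenstein \<tau> (of_nat (Suc K)) =
     of_real (c * zeta_even K * Im \<tau> ^ Suc K + c * \<beta> / Im \<tau> ^ K +
       (\<Sum>r\<le>K. hat_coeff K r / Im \<tau> ^ r * (2 * Re (eis_series K r \<tau>))))" if "Im \<tau> > 0" for \<tau>
  proof -
    define v where "v = Im \<tau>"
    have v: "v > 0" using that by (simp add: v_def)
    have p: "v ^ (2 * K + 1) = v ^ Suc K * v ^ K" "\<And>r. v ^ (K + 1 + r) = v ^ Suc K * v ^ r"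
      by (simp_all add: power_add [symmetric] mult_2)
    define R where "R r = 2 * Re (eis_series K r \<tau>)" for r
    have "(fact K * zeta_even K / pi ^ Suc K) * ((zeta_even K + \<beta> / v ^ (2 * K + 1) +
       (\<Sum>r\<le>K. bessel_coeff K r / v ^ (K + 1 + r) * R r)) / zeta_even K * v ^ Suc K)
      = c * v ^ Suc K * (zeta_even K + \<beta> / v ^ (2 * K + 1) + (\<Sum>r\<le>K. bessel_coeff K r / v ^ (K + 1 + r) * R r))"
      using zeta_even_pos[of K] by (simp add: c_def)
    also have "\<dots> = c * zeta_even K * v ^ Suc K + c * \<beta> / v ^ K + (\<Sum>r\<le>K. c * v ^ Suc K * (bessel_coeff K r / v ^ (K + 1 + r) * R r))"
      unfolding distrib_left sum_distrib_left p using v by (simp del: power_Suc)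
    also have "(\<Sum>r\<le>K. c * v ^ Suc K * (bessel_coeff K r / v ^ (K + 1 + r) * R r)) = (\<Sum>r\<le>K. hat_coeff K r / v ^ r * R r)"
      unfolding p using v by (intro sum.cong) (auto simp: hat_coeff_def c_def simp del: power_Suc)
    finally show ?thesis
      unfolding \<beta>[OF that] of_real_mult [symmetric] v_def R_def by (simp only:)
  qed
  \<comment> \<open>From v^k - 2^k (2v)^k = (1 - 4^k) v^k.\<close>
  define \<alpha> where "\<alpha> = c * zeta_even K * (1 - 2 ^ Suc K * 2 ^ Suc K)"
  show ?thesis
  proof (intro exI allI impI)
    fix \<tau> :: complex assume im: "Im \<tau> > 0"
    define v where "v = Im \<tau>"
    have v: "v > 0" "Im (2 * \<tau>) = 2 * v" using im by (simp_all add: v_def)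
    have "g_hat (Suc K) \<tau> = of_real (c * zeta_even K * v ^ Suc K + c * \<beta> / v ^ K +
       (\<Sum>r\<le>K. hat_coeff K r / v ^ r * (2 * Re (eis_series K r \<tau>))) -
       2 ^ Suc K * (c * zeta_even K * (2 * v) ^ Suc K + c * \<beta> / (2 * v) ^ K +
       (\<Sum>r\<le>K. hat_coeff K r / (2 * v) ^ r * (2 * Re (eis_series K r (2 * \<tau>))))))"
      unfolding g_hat_prefactor right_diff_distrib mult.left_commute[of _ "2 ^ Suc K"]
      using E[OF im] E[of "2 * \<tau>"] im unfolding v_def by simp
    also have "c * zeta_even K * v ^ Suc K + c * \<beta> / v ^ K +
       (\<Sum>r\<le>K. hat_coeff K r / v ^ r * (2 * Re (eis_series K r \<tau>))) -
       2 ^ Suc K * (c * zeta_even K * (2 * v) ^ Suc K + c * \<beta> / (2 * v) ^ K +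
       (\<Sum>r\<le>K. hat_coeff K r / (2 * v) ^ r * (2 * Re (eis_series K r (2 * \<tau>)))))
      = \<alpha> * v ^ Suc K + - c * \<beta> / v ^ K +
       ((\<Sum>r\<le>K. hat_coeff K r / v ^ r * (2 * Re (eis_series K r \<tau>))) -
        2 ^ Suc K * (\<Sum>r\<le>K. hat_coeff K r / (2 * v) ^ r * (2 * Re (eis_series K r (2 * \<tau>)))))"
    proof -
      have "2 ^ Suc K * (c * zeta_even K * (2 * v) ^ Suc K) = c * zeta_even K * (2 ^ Suc K * 2 ^ Suc K) * v ^ Suc K"
        by (simp add: power_mult_distrib mult_ac del: power_Suc)
      moreover have "2 ^ Suc K * (c * \<beta> / (2 * v) ^ K) = 2 * (c * \<beta> / v ^ K)"
        by (simp add: power_mult_distrib)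
      ultimately show ?thesis
        unfolding \<alpha>_def distrib_left by (simp add: algebra_simps del: power_Suc)
    qed
    also have "(\<Sum>r\<le>K. hat_coeff K r / v ^ r * (2 * Re (eis_series K r \<tau>))) -
        2 ^ Suc K * (\<Sum>r\<le>K. hat_coeff K r / (2 * v) ^ r * (2 * Re (eis_series K r (2 * \<tau>))))
      = (\<Sum>r\<le>K. hat_coeff K r / v ^ r * (2 * Re (alt_series K r \<tau>)))"
      unfolding sum_distrib_left sum_subtractf [symmetric]
    proof (intro sum.cong refl)
      fix r assume "r \<in> {..K}"
      then have "alt_series K r \<tau> = eis_series K r \<tau> - 2 ^ Suc K / 2 ^ r * eis_series K r (2 * \<tau>)"
        unfolding alt_series_def by (intro qsum_alt_coeff(2) im) auto
      also have "2 ^ Suc K / 2 ^ r = complex_of_real (2 ^ Suc K / 2 ^ r)" by simp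
      finally have "Re (alt_series K r \<tau>) = Re (eis_series K r \<tau>) - 2 ^ Suc K / 2 ^ r * Re (eis_series K r (2 * \<tau>))"
        by (simp only: minus_complex.sel Re_complex_of_real times_complex.sel Im_complex_of_real
             mult_zero_left diff_zero)
      then show "hat_coeff K r / v ^ r * (2 * Re (eis_series K r \<tau>)) - 2 ^ Suc K * (hat_coeff K r / (2 * v) ^ r * (2 * Re (eis_series K r (2 * \<tau>))))
        = hat_coeff K r / v ^ r * (2 * Re (alt_series K r \<tau>))"
        by (simp add: power_mult_distrib right_diff_distrib mult_ac del: power_Suc)
    qed
    finally show "g_hat (Suc K) \<tau> = of_real (\<alpha> * Im \<tau> ^ Suc K + (- c * \<beta>) / Im \<tau> ^ K + (\<Sum>r\<le>K. hat_coeff K r / Im \<tau> ^ r * (2 * Re (alt_series K r \<tau>))))"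
      unfolding v_def .
  qed
qed

lemma disc_summable_alt_coeff:
  assumes "r \<le> K" shows "disc_summable (\<lambda>N. of_real (alt_coeff K N / real (Suc N) ^ r))"
  by (rule qsum_alt_coeff(1)[of \<i>]) (use assms in auto)

text \<open>The coefficients are real, so twice the real part is the series plus its conjugate and
  \<open>a\<close> serves for both. The match with \<open>g_series\<close> is exact because
  \<open>hat_coeff K 0\<close> is 1.\<close>

lemma is_holomorphic_part_g_hat:
  assumes K: "K \<ge> 1"
  shows "is_holomorphic_part (Suc K) (g_hat (Suc K)) (\<lambda>\<tau>. g_series (Suc K) (nome \<tau>))"
proof -
  obtain \<alpha> \<beta> where ex: "\<And>\<tau>. Im \<tau> > 0 \<Longrightarrow> g_hat (Suc K) \<tau> =
    of_real (\<alpha> * Im \<tau> ^ Suc K + \<beta> / Im \<tau> ^ K + (\<Sum>r\<le>K. hat_coeff K r / Im \<tau> ^ r * (2 * Re (alt_series K r \<tau>))))"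
    using g_hat_expansion[OF K] by blast
  define a where "a r N = complex_of_real (hat_coeff K r) * of_real (alt_coeff K N / real (Suc N) ^ r)" for r N
  show ?thesis
    unfolding is_holomorphic_part_def
  proof (rule exI[of _ "of_real \<alpha>"], rule exI[of _ "of_real \<beta>"], rule exI[of _ K],
      rule exI[of _ a], rule exI[of _ a], intro ballI conjI allI impI)
    fix \<tau> assume "\<tau> \<in> upper_half_plane"
    then have im: "Im \<tau> > 0" by (simp add: upper_half_plane_def)
    then have q: "norm (nome \<tau>) < 1" "norm (cnj (nome \<tau>)) < 1" by (simp_all add: norm_nome_less_1)
    have da: "disc_summable (a r)" if "r \<le> K" for r
      unfolding a_def by (intro disc_summable_cmult disc_summable_alt_coeff that)
    have s: "summable (\<lambda>n. a r n * nome \<tau> ^ Suc n)" "summable (\<lambda>n. a r n * cnj (nome \<tau>) ^ Suc n)" if "r \<le> K" for r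
      by (intro disc_summableD_Suc da that q)+
    show "summable (\<lambda>n. a r n * nome \<tau> ^ Suc n)" "summable (\<lambda>n. a r n * cnj (nome \<tau>) ^ Suc n)" if "r \<le> K" for r
      using s[OF that] .
    have A: "(\<Sum>n. a r n * nome \<tau> ^ Suc n) = of_real (hat_coeff K r) * alt_series K r \<tau>" if "r \<le> K" for r
      unfolding a_def alt_series_def qsum_def mult.assoc
      by (intro suminf_mult disc_summableD_Suc disc_summable_alt_coeff that q)
    have C: "(\<Sum>n. a r n * nome \<tau> ^ Suc n + a r n * cnj (nome \<tau>) ^ Suc n) =
        of_real (hat_coeff K r * (2 * Re (alt_series K r \<tau>)))" if "r \<le> K" for r
    proof -
      have cnj: "a r n * cnj (nome \<tau>) ^ Suc n = cnj (a r n * nome \<tau> ^ Suc n)" for n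
        by (simp add: a_def)
      have "(\<lambda>n. cnj (a r n * nome \<tau> ^ Suc n)) sums cnj (\<Sum>n. a r n * nome \<tau> ^ Suc n)"
        unfolding sums_cnj using s(1)[OF that] by (rule summable_sums)
      then have "(\<Sum>n. a r n * cnj (nome \<tau>) ^ Suc n) = cnj (\<Sum>n. a r n * nome \<tau> ^ Suc n)"
        unfolding cnj by (simp add: sums_iff)
      then have "(\<Sum>n. a r n * nome \<tau> ^ Suc n + a r n * cnj (nome \<tau>) ^ Suc n) =
        of_real (hat_coeff K r) * (alt_series K r \<tau> + cnj (alt_series K r \<tau>))"
        using suminf_add[OF s[OF that]] A[OF that]
        by (simp add: distrib_left del: power_Suc complex_cnj_mult) simp
      then show ?thesis by (simp add: complex_add_cnj)
    qed
    have "g_hat (Suc K) \<tau> = of_real \<alpha> * of_real (Im \<tau>) ^ Suc K + of_real \<beta> * of_real (Im \<tau>) powi (- int K) +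
       (\<Sum>r\<le>K. of_real (Im \<tau>) powi (- int r) * of_real (hat_coeff K r * (2 * Re (alt_series K r \<tau>))))"
      unfolding ex[OF im] by (simp add: power_int_minus divide_inverse mult_ac)
    then show "g_hat (Suc K) \<tau> = of_real \<alpha> * of_real (Im \<tau>) ^ Suc K + of_real \<beta> * of_real (Im \<tau>) powi (1 - int (Suc K)) +
       (\<Sum>r\<le>K. of_real (Im \<tau>) powi (- int r) * (\<Sum>n. a r n * nome \<tau> ^ Suc n + a r n * cnj (nome \<tau>) ^ Suc n))"
      using C by simp
    show "g_series (Suc K) (nome \<tau>) = (\<Sum>n. a 0 n * nome \<tau> ^ Suc n)"
      unfolding g_series_nome[OF im] qsum_def a_def by simp
  qed
qed

subsection \<open>The Laplace equation\<close>

text \<open>One predicate for both partial derivatives: d = 1 is the direction of u, d = \<i> that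
  of v. It is demanded on the whole half-plane so that it can be iterated.\<close>

definition dir_deriv :: "complex \<Rightarrow> (complex \<Rightarrow> real) \<Rightarrow> (complex \<Rightarrow> real) \<Rightarrow> bool" where
  "dir_deriv d \<phi> \<psi> \<longleftrightarrow>
     (\<forall>\<tau>. Im \<tau> > 0 \<longrightarrow> ((\<lambda>t. \<phi> (\<tau> + d * of_real t)) has_real_derivative \<psi> \<tau>) (at 0))"

lemma dir_deriv_add:
  "dir_deriv d \<phi> \<psi> \<Longrightarrow> dir_deriv d \<phi>' \<psi>' \<Longrightarrow> dir_deriv d (\<lambda>\<tau>. \<phi> \<tau> + \<phi>' \<tau>) (\<lambda>\<tau>. \<psi> \<tau> + \<psi>' \<tau>)"
  unfolding dir_deriv_def by (auto intro: DERIV_add)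

lemma dir_deriv_cmult:
  "dir_deriv d \<phi> \<psi> \<Longrightarrow> dir_deriv d (\<lambda>\<tau>. c * \<phi> \<tau>) (\<lambda>\<tau>. c * \<psi> \<tau>)"
  unfolding dir_deriv_def by (auto intro: DERIV_cmult)

lemma dir_deriv_sum:
  "(\<And>r. r \<in> A \<Longrightarrow> dir_deriv d (\<phi> r) (\<psi> r)) \<Longrightarrow>
     dir_deriv d (\<lambda>\<tau>. \<Sum>r\<in>A. \<phi> r \<tau>) (\<lambda>\<tau>. \<Sum>r\<in>A. \<psi> r \<tau>)"
  unfolding dir_deriv_def by (auto intro: DERIV_sum)

lemma dir_deriv_mult:
  "dir_deriv d \<phi> \<psi> \<Longrightarrow> dir_deriv d \<phi>' \<psi>' \<Longrightarrow>
     dir_deriv d (\<lambda>\<tau>. \<phi> \<tau> * \<phi>' \<tau>) (\<lambda>\<tau>. \<psi> \<tau> * \<phi>' \<tau> + \<psi>' \<tau> * \<phi> \<tau>)"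
  unfolding dir_deriv_def
proof (intro allI impI)
  fix \<tau> assume *: "\<forall>\<tau>. Im \<tau> > 0 \<longrightarrow> ((\<lambda>t. \<phi> (\<tau> + d * of_real t)) has_real_derivative \<psi> \<tau>) (at 0)"
    "\<forall>\<tau>. Im \<tau> > 0 \<longrightarrow> ((\<lambda>t. \<phi>' (\<tau> + d * of_real t)) has_real_derivative \<psi>' \<tau>) (at 0)" "Im \<tau> > 0"
  from DERIV_mult[OF *(1)[rule_format, OF *(3)] *(2)[rule_format, OF *(3)]]
  show "((\<lambda>t. \<phi> (\<tau> + d * of_real t) * \<phi>' (\<tau> + d * of_real t)) has_real_derivative
      \<psi> \<tau> * \<phi>' \<tau> + \<psi>' \<tau> * \<phi> \<tau>) (at 0)" by simp
qed

lemma dir_deriv_Im_chain: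
  assumes "\<And>v. v > 0 \<Longrightarrow> (g has_real_derivative g' v) (at v)"
  shows "dir_deriv d (\<lambda>\<tau>. g (Im \<tau>)) (\<lambda>\<tau>. Im d * g' (Im \<tau>))"
  unfolding dir_deriv_def
proof (intro allI impI)
  fix \<tau> :: complex assume im: "Im \<tau> > 0"
  have "((\<lambda>t. Im \<tau> + Im d * t) has_real_derivative Im d) (at 0)"
    by (auto intro!: derivative_eq_intros)
  moreover have "(g has_real_derivative g' (Im \<tau>)) (at (Im \<tau> + Im d * 0))"
    using assms[OF im] by simp
  ultimately show "((\<lambda>t. g (Im (\<tau> + d * of_real t))) has_real_derivative Im d * g' (Im \<tau>)) (at 0)"
    using DERIV_chain2[of g "g' (Im \<tau>)" "\<lambda>t. Im \<tau> + Im d * t" 0 "Im d" UNIV] by (simp add: mult.commute)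
qed

lemma has_real_derivative_inverse_power:
  fixes v :: real
  assumes "v > 0"
  shows "((\<lambda>v. 1 / v ^ r) has_real_derivative - real r / v ^ Suc r) (at v)"
proof (cases r)
  case (Suc m)
  have "((\<lambda>v. inverse v ^ Suc m) has_real_derivative
        real (Suc m) * inverse v ^ m * (- (inverse v * inverse v))) (at v)"
    using assms by (auto intro!: derivative_eq_intros simp del: power_Suc)
  then show ?thesis by (simp add: Suc divide_inverse power_inverse mult_ac del: of_nat_Suc)
qed simp

section \<open>Real parts of q-series over powers of the height\<close>

definition qterm :: "nat \<Rightarrow> (nat \<Rightarrow> real) \<Rightarrow> complex \<Rightarrow> real" where
  "qterm r a \<tau> = 1 / Im \<tau> ^ r * Re (qsum (\<lambda>n. of_real (a n)) \<tau>)"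

text \<open>The partner of \<open>qterm\<close> under differentiation in u, which exchanges real and
  imaginary parts up to sign.\<close>

definition qterm_Im :: "nat \<Rightarrow> (nat \<Rightarrow> real) \<Rightarrow> complex \<Rightarrow> real" where
  "qterm_Im r a \<tau> = 1 / Im \<tau> ^ r * Im (qsum (\<lambda>n. of_real (a n)) \<tau>)"

text \<open>On q-series d/d\<tau> is \<i> times this operation, the factor 2 pi being
  included.\<close>

definition euler_coeff :: "(nat \<Rightarrow> real) \<Rightarrow> nat \<Rightarrow> real" where
  "euler_coeff a n = 2 * pi * real (Suc n) * a n"

lemma disc_summable_euler_coeff:
  assumes "disc_summable (\<lambda>n. of_real (a n))"
  shows "disc_summable (\<lambda>n. of_real (euler_coeff a n))"
proof -
  have "disc_summable (\<lambda>n. of_real (2 * pi) * (of_nat (Suc n) * of_real (a n)))"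
    by (intro disc_summable_cmult disc_summable_deriv assms)
  then show ?thesis by (simp add: euler_coeff_def mult_ac)
qed

lemma qsum_real_has_field_derivative:
  assumes "disc_summable (\<lambda>n. of_real (a n))" "Im \<tau> > 0"
  shows "(qsum (\<lambda>n. of_real (a n)) has_field_derivative \<i> * qsum (\<lambda>n. of_real (euler_coeff a n)) \<tau>) (at \<tau>)"
proof -
  have "summable (\<lambda>n. of_nat (Suc n) * of_real (a n) * nome \<tau> ^ Suc n)"
    by (intro disc_summableD_Suc disc_summable_deriv assms norm_nome_less_1)
  from suminf_mult[OF this, of "of_real (2 * pi)"]
  have "qsum (\<lambda>n. of_real (euler_coeff a n)) \<tau> = of_real (2 * pi) * qsum (\<lambda>n. of_nat (Suc n) * of_real (a n)) \<tau>"
    by (simp add: qsum_def euler_coeff_def mult_ac del: of_nat_Suc)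
  then show ?thesis
    using qsum_has_field_derivative[OF assms] by (simp add: mult_ac del: of_nat_Suc)
qed

lemma dir_deriv_qsum:
  assumes a: "disc_summable (\<lambda>n. of_real (a n))"
  shows "dir_deriv d (\<lambda>\<tau>. Re (qsum (\<lambda>n. of_real (a n)) \<tau>)) (\<lambda>\<tau>. Re (\<i> * d * qsum (\<lambda>n. of_real (euler_coeff a n)) \<tau>))"
    and "dir_deriv d (\<lambda>\<tau>. Im (qsum (\<lambda>n. of_real (a n)) \<tau>)) (\<lambda>\<tau>. Im (\<i> * d * qsum (\<lambda>n. of_real (euler_coeff a n)) \<tau>))"
proof -
  have *: "((\<lambda>t. qsum (\<lambda>n. of_real (a n)) (\<tau> + d * of_real t)) has_vector_derivative
      \<i> * d * qsum (\<lambda>n. of_real (euler_coeff a n)) \<tau>) (at 0)" if im: "Im \<tau> > 0" for \<tau>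
  proof -
    have l: "((\<lambda>t. \<tau> + d * of_real t) has_vector_derivative d) (at 0)"
      by (auto intro!: derivative_eq_intros simp: has_vector_derivative_def scaleR_conv_of_real mult.commute)
    have "(qsum (\<lambda>n. of_real (a n)) has_field_derivative \<i> * qsum (\<lambda>n. of_real (euler_coeff a n)) \<tau>) (at (\<tau> + d * of_real 0))"
      using qsum_real_has_field_derivative[OF a im] by simp
    from field_vector_diff_chain_at[OF l this] show ?thesis by (simp add: o_def mult_ac)
  qed
  show "dir_deriv d (\<lambda>\<tau>. Re (qsum (\<lambda>n. of_real (a n)) \<tau>)) (\<lambda>\<tau>. Re (\<i> * d * qsum (\<lambda>n. of_real (euler_coeff a n)) \<tau>))"
    unfolding dir_deriv_def has_real_derivative_iff_has_vector_derivative
    by (intro allI impI bounded_linear.has_vector_derivative[OF bounded_linear_Re] *)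
  show "dir_deriv d (\<lambda>\<tau>. Im (qsum (\<lambda>n. of_real (a n)) \<tau>)) (\<lambda>\<tau>. Im (\<i> * d * qsum (\<lambda>n. of_real (euler_coeff a n)) \<tau>))"
    unfolding dir_deriv_def has_real_derivative_iff_has_vector_derivative
    by (intro allI impI bounded_linear.has_vector_derivative[OF bounded_linear_Im] *)
qed

lemma dir_deriv_cong:
  "dir_deriv d \<phi> \<psi> \<Longrightarrow> (\<And>\<tau>. Im \<tau> > 0 \<Longrightarrow> \<psi> \<tau> = \<psi>' \<tau>) \<Longrightarrow> dir_deriv d \<phi> \<psi>'"
  unfolding dir_deriv_def by auto

lemma dir_deriv_inverse_Im_power:
  "dir_deriv d (\<lambda>\<tau>. 1 / Im \<tau> ^ r) (\<lambda>\<tau>. Im d * (- real r / Im \<tau> ^ Suc r))"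
  by (rule dir_deriv_Im_chain) (rule has_real_derivative_inverse_power)

lemma dir_deriv_qterm:
  assumes a: "disc_summable (\<lambda>n. of_real (a n))"
  shows "dir_deriv 1 (qterm r a) (\<lambda>\<tau>. - qterm_Im r (euler_coeff a) \<tau>)"
    and "dir_deriv 1 (qterm_Im r a) (\<lambda>\<tau>. qterm r (euler_coeff a) \<tau>)"
    and "dir_deriv \<i> (qterm r a) (\<lambda>\<tau>. - real r * qterm (Suc r) a \<tau> + - 1 * qterm r (euler_coeff a) \<tau>)"
  unfolding qterm_def [abs_def] qterm_Im_def [abs_def]
  by (rule dir_deriv_cong[OF dir_deriv_mult[OF dir_deriv_inverse_Im_power dir_deriv_qsum(1)[OF a]]]
           dir_deriv_cong[OF dir_deriv_mult[OF dir_deriv_inverse_Im_power dir_deriv_qsum(2)[OF a]]];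
      simp add: field_simps)+

lemma deriv_uv_of_real:
  assumes f: "\<And>\<tau>. Im \<tau> > 0 \<Longrightarrow> f \<tau> = complex_of_real (\<phi> \<tau>)" and "Im \<tau> > 0"
  shows "dir_deriv 1 \<phi> \<psi> \<Longrightarrow> deriv_u f \<tau> = of_real (\<psi> \<tau>)"
    and "dir_deriv \<i> \<phi> \<psi> \<Longrightarrow> deriv_v f \<tau> = of_real (\<psi> \<tau>)"
proof -
  have gen: "vector_derivative (\<lambda>t. f (\<tau> + d * of_real t)) (at 0) = of_real (\<psi> \<tau>)" if "dir_deriv d \<phi> \<psi>" for d
  proof (rule vector_derivative_at)
    have h: "((\<lambda>t. of_real (\<phi> (\<tau> + d * of_real t))) has_vector_derivative complex_of_real (\<psi> \<tau>)) (at 0)"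
      using that assms(2) unfolding dir_deriv_def by (intro has_vector_derivative_of_real) auto
    \<comment> \<open>\<open>f\<close> agrees with \<open>\<phi>\<close> only on the upper
      half-plane, so the points must be shown to stay there for small \<open>t\<close>.\<close>
    have "((\<lambda>t. Im (\<tau> + d * of_real t)) \<longlongrightarrow> Im \<tau>) (at 0)"
      by (auto intro!: tendsto_eq_intros)
    then have "eventually (\<lambda>t. Im (\<tau> + d * of_real t) > 0) (at 0)"
      using assms(2) by (rule order_tendstoD(1))
    then have "eventually (\<lambda>t. of_real (\<phi> (\<tau> + d * of_real t)) = f (\<tau> + d * of_real t)) (at 0)"
      by eventually_elim (rule f [symmetric])
    from has_derivative_transform_eventually[OF h[unfolded has_vector_derivative_def] this]
    show "((\<lambda>t. f (\<tau> + d * of_real t)) has_vector_derivative of_real (\<psi> \<tau>)) (at 0)"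
      using f[OF assms(2)] unfolding has_vector_derivative_def by simp
  qed
  show "dir_deriv 1 \<phi> \<psi> \<Longrightarrow> deriv_u f \<tau> = of_real (\<psi> \<tau>)" using gen[of 1] by (simp add: deriv_u_def)
  show "dir_deriv \<i> \<phi> \<psi> \<Longrightarrow> deriv_v f \<tau> = of_real (\<psi> \<tau>)" using gen[of \<i>] by (simp add: deriv_v_def)
qed

lemma hyperbolic_laplacian_of_real:
  assumes f: "\<And>\<tau>. Im \<tau> > 0 \<Longrightarrow> f \<tau> = complex_of_real (\<phi> \<tau>)" and im: "Im \<tau> > 0"
  assumes "dir_deriv 1 \<phi> \<phi>u" "dir_deriv 1 \<phi>u \<phi>uu" "dir_deriv \<i> \<phi> \<phi>v" "dir_deriv \<i> \<phi>v \<phi>vv"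
  shows "hyperbolic_laplacian f \<tau> = of_real (- (Im \<tau>)\<^sup>2 * (\<phi>uu \<tau> + \<phi>vv \<tau>))"
proof -
  have "deriv_u (deriv_u f) \<tau> = of_real (\<phi>uu \<tau>)"
    by (rule deriv_uv_of_real(1)[OF deriv_uv_of_real(1)[OF f] im]) (use assms in auto)
  moreover have "deriv_v (deriv_v f) \<tau> = of_real (\<phi>vv \<tau>)"
    by (rule deriv_uv_of_real(2)[OF deriv_uv_of_real(2)[OF f] im]) (use assms in auto)
  ultimately show ?thesis by (simp add: hyperbolic_laplacian_def)
qed

lemma hat_coeff_Suc:
  assumes "r < K"
  shows "4 * pi * (real r + 1) * hat_coeff K (Suc r) = (real K + real r + 1) * (real K - real r) * hat_coeff K r"
proof -
  have "4 * pi * (real r + 1) * hat_coeff K (Suc r) = fact K / pi ^ Suc K * (4 * pi * (real r + 1) * bessel_coeff K (Suc r))"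
    by (simp only: hat_coeff_def mult_ac)
  then show ?thesis
    unfolding bessel_coeff_Suc_right[OF assms] by (simp only: hat_coeff_def mult_ac)
qed

text \<open>Real parts of q-series are harmonic, so second derivatives of the series cancel. What is
  left of the \<open>r\<close>-th term is r (r + 1) v^(-r-2) times its series and a mixed term,
  which by the choice of coefficients has the shape of the term of index r - 1.\<close>

lemma hyperbolic_laplacian_g_hat:
  assumes K: "K \<ge> 1" and im: "Im \<tau> > 0"
  shows "hyperbolic_laplacian (g_hat (Suc K)) \<tau> = of_real (- real (Suc K) * real K) * g_hat (Suc K) \<tau>"
proof -
  obtain \<alpha> \<beta> where ex: "\<And>\<tau>. Im \<tau> > 0 \<Longrightarrow> g_hat (Suc K) \<tau> =
    of_real (\<alpha> * Im \<tau> ^ Suc K + \<beta> / Im \<tau> ^ K + (\<Sum>r\<le>K. hat_coeff K r / Im \<tau> ^ r * (2 * Re (alt_series K r \<tau>))))"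
    using g_hat_expansion[OF K] by blast
  define a where "a r n = alt_coeff K n / real (Suc n) ^ r" for r n
  have da: "disc_summable (\<lambda>n. of_real (a r n))" if "r \<le> K" for r
    unfolding a_def by (rule disc_summable_alt_coeff[OF that])
  note de = disc_summable_euler_coeff[OF da]
  define c where "c r = 2 * hat_coeff K r" for r
  define \<phi> where "\<phi> \<tau> = \<alpha> * Im \<tau> ^ Suc K + \<beta> * (1 / Im \<tau> ^ K) + (\<Sum>r\<le>K. c r * qterm r (a r) \<tau>)" for \<tau>
  have f: "g_hat (Suc K) \<tau> = of_real (\<phi> \<tau>)" if "Im \<tau> > 0" for \<tau>
    unfolding ex[OF that] \<phi>_def qterm_def c_def alt_series_def a_def by (simp add: mult_ac)
  define \<phi>u where "\<phi>u \<tau> = (\<Sum>r\<le>K. c r * (- 1 * qterm_Im r (euler_coeff (a r)) \<tau>))" for \<tau>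
  define \<phi>uu where "\<phi>uu \<tau> = (\<Sum>r\<le>K. c r * (- 1 * qterm r (euler_coeff (euler_coeff (a r))) \<tau>))" for \<tau>
  define \<phi>v where "\<phi>v \<tau> = \<alpha> * (real (Suc K) * Im \<tau> ^ K) + \<beta> * (- real K * (1 / Im \<tau> ^ Suc K)) +
     (\<Sum>r\<le>K. c r * (- real r * qterm (Suc r) (a r) \<tau> + - 1 * qterm r (euler_coeff (a r)) \<tau>))" for \<tau>
  define \<phi>vv where "\<phi>vv \<tau> = \<alpha> * (real (Suc K) * (real K * Im \<tau> ^ (K - 1))) + \<beta> * (- real K * (- real (Suc K) / Im \<tau> ^ Suc (Suc K))) +
     (\<Sum>r\<le>K. c r * (- real r * (- real (Suc r) * qterm (Suc (Suc r)) (a r) \<tau> + - 1 * qterm (Suc r) (euler_coeff (a r)) \<tau>)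
        + - 1 * (- real r * qterm (Suc r) (euler_coeff (a r)) \<tau> + - 1 * qterm r (euler_coeff (euler_coeff (a r))) \<tau>)))" for \<tau>
  have pw1: "dir_deriv 1 (\<lambda>\<tau>. Im \<tau> ^ m) (\<lambda>\<tau>. 0)" for m
    by (rule dir_deriv_cong[OF dir_deriv_Im_chain[of "\<lambda>v. v ^ m" "\<lambda>v. real m * v ^ (m - 1)"]])
       (auto intro!: derivative_eq_intros)
  have iw1: "dir_deriv 1 (\<lambda>\<tau>. 1 / Im \<tau> ^ m) (\<lambda>\<tau>. 0)" for m
    by (rule dir_deriv_cong[OF dir_deriv_inverse_Im_power]) auto
  have pwi: "dir_deriv \<i> (\<lambda>\<tau>. Im \<tau> ^ m) (\<lambda>\<tau>. real m * Im \<tau> ^ (m - 1))" for m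
    by (rule dir_deriv_cong[OF dir_deriv_Im_chain[of "\<lambda>v. v ^ m" "\<lambda>v. real m * v ^ (m - 1)"]])
       (auto intro!: derivative_eq_intros)
  have iwi: "dir_deriv \<i> (\<lambda>\<tau>. 1 / Im \<tau> ^ m) (\<lambda>\<tau>. - real m / Im \<tau> ^ Suc m)" for m
    by (rule dir_deriv_cong[OF dir_deriv_inverse_Im_power]) auto
  have u: "dir_deriv 1 \<phi> \<phi>u"
  proof (rule dir_deriv_cong)
    show "dir_deriv 1 \<phi> (\<lambda>\<tau>. \<alpha> * 0 + \<beta> * 0 + (\<Sum>r\<le>K. c r * - qterm_Im r (euler_coeff (a r)) \<tau>))"
      unfolding \<phi>_def [abs_def]
      by (intro dir_deriv_add dir_deriv_cmult dir_deriv_sum pw1 iw1 dir_deriv_qterm da) auto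
  qed (simp add: \<phi>u_def)
  have uu: "dir_deriv 1 \<phi>u \<phi>uu"
    unfolding \<phi>u_def [abs_def] \<phi>uu_def [abs_def]
    by (intro dir_deriv_cmult dir_deriv_sum dir_deriv_qterm de) auto
  have v: "dir_deriv \<i> \<phi> \<phi>v"
  proof (rule dir_deriv_cong)
    show "dir_deriv \<i> \<phi> (\<lambda>\<tau>. \<alpha> * (real (Suc K) * Im \<tau> ^ (Suc K - 1)) + \<beta> * (- real K / Im \<tau> ^ Suc K) +
      (\<Sum>r\<le>K. c r * (- real r * qterm (Suc r) (a r) \<tau> + - 1 * qterm r (euler_coeff (a r)) \<tau>)))"
      unfolding \<phi>_def [abs_def]
      by (intro dir_deriv_add dir_deriv_cmult dir_deriv_sum pwi iwi dir_deriv_qterm da) auto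
  qed (simp add: \<phi>v_def)
  have vv: "dir_deriv \<i> \<phi>v \<phi>vv"
    unfolding \<phi>v_def [abs_def] \<phi>vv_def [abs_def]
    by (intro dir_deriv_add dir_deriv_cmult dir_deriv_sum pwi iwi dir_deriv_qterm da de) auto
  define y where "y = Im \<tau>"
  have y: "y > 0" using im by (simp add: y_def)
  define P where "P r = Re (qsum (\<lambda>n. of_real (a r n)) \<tau>)" for r
  \<comment> \<open>The sequence \<open>a (Suc r)\<close> is \<open>a r\<close> divided by
    \<open>Suc n\<close>, and the Euler operator multiplies this factor back.\<close>
  have P: "Re (qsum (\<lambda>n. of_real (euler_coeff (a (Suc r)) n)) \<tau>) = 2 * pi * P r" if "Suc r \<le> K" for r
  proof -
    have "of_real (euler_coeff (a (Suc r)) n) = of_real (2 * pi) * complex_of_real (a r n)" for n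
      by (simp add: euler_coeff_def a_def del: of_nat_Suc)
    then have "qsum (\<lambda>n. of_real (euler_coeff (a (Suc r)) n)) \<tau> = of_real (2 * pi) * qsum (\<lambda>n. of_real (a r n)) \<tau>"
      unfolding qsum_def
      by (simp only: mult.assoc) (intro suminf_mult disc_summableD_Suc da norm_nome_less_1 im, use that in simp)
    then show ?thesis by (simp add: P_def)
  qed
  define t where "t r = c r / y ^ r * P r" for r
  have "(\<Sum>r\<le>K. y\<^sup>2 * (c r * (real r * (real r + 1) * qterm (Suc (Suc r)) (a r) \<tau> + 2 * real r * qterm (Suc r) (euler_coeff (a r)) \<tau>)))
     = (\<Sum>r\<le>K. real r * (real r + 1) * t r) + (\<Sum>r\<le>K. y\<^sup>2 * (c r * (2 * real r * qterm (Suc r) (euler_coeff (a r)) \<tau>)))"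
    unfolding sum.distrib [symmetric]
  proof (intro sum.cong refl)
    fix r
    have e: "y\<^sup>2 * qterm (Suc (Suc r)) (a r) \<tau> = 1 / y ^ r * P r"
      unfolding qterm_def P_def y_def [symmetric] using y by (simp add: power2_eq_square)
    have "real r * (real r + 1) * t r = real r * (real r + 1) * c r * (1 / y ^ r * P r)"
      by (simp add: t_def)
    also have "\<dots> = y\<^sup>2 * (c r * (real r * (real r + 1) * qterm (Suc (Suc r)) (a r) \<tau>))"
      unfolding e [symmetric] by (simp only: mult_ac)
    finally have e2: "real r * (real r + 1) * t r = y\<^sup>2 * (c r * (real r * (real r + 1) * qterm (Suc (Suc r)) (a r) \<tau>))" .
    show "y\<^sup>2 * (c r * (real r * (real r + 1) * qterm (Suc (Suc r)) (a r) \<tau> + 2 * real r * qterm (Suc r) (euler_coeff (a r)) \<tau>))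
      = real r * (real r + 1) * t r + y\<^sup>2 * (c r * (2 * real r * qterm (Suc r) (euler_coeff (a r)) \<tau>))"
      by (subst e2) (simp only: distrib_left)
  qed
  also have "(\<Sum>r\<le>K. y\<^sup>2 * (c r * (2 * real r * qterm (Suc r) (euler_coeff (a r)) \<tau>))) =
     (\<Sum>r\<le>K. (real K + real r + 1) * (real K - real r) * t r)"
  proof -
    \<comment> \<open>The summand r = 0 vanishes, so the index can be shifted. Afterwards the
      recursion of \<open>hat_coeff\<close> applies, and the range is refilled up to
      \<open>K\<close> because the factor \<open>real K - real r\<close> vanishes there.\<close>
    obtain K' where K': "K = Suc K'" using K by (cases K) auto
    have "(\<Sum>r\<le>K. y\<^sup>2 * (c r * (2 * real r * qterm (Suc r) (euler_coeff (a r)) \<tau>))) =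
       (\<Sum>r\<le>K'. y\<^sup>2 * (c (Suc r) * (2 * real (Suc r) * qterm (Suc (Suc r)) (euler_coeff (a (Suc r))) \<tau>)))"
      unfolding K' sum.atMost_Suc_shift by simp
    also have "\<dots> = (\<Sum>r\<le>K'. (real K + real r + 1) * (real K - real r) * t r)"
    proof (intro sum.cong refl)
      fix r assume "r \<in> {..K'}"
      then have r: "r < K" "Suc r \<le> K" using K' by auto
      have e3: "y\<^sup>2 * qterm (Suc (Suc r)) (euler_coeff (a (Suc r))) \<tau> = 1 / y ^ r * (2 * pi * P r)"
        unfolding qterm_def P[OF r(2)] y_def [symmetric] using y by (simp add: power2_eq_square)
      have "y\<^sup>2 * (c (Suc r) * (2 * real (Suc r) * qterm (Suc (Suc r)) (euler_coeff (a (Suc r))) \<tau>)) =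
        4 * (real r + 1) * hat_coeff K (Suc r) * (y\<^sup>2 * qterm (Suc (Suc r)) (euler_coeff (a (Suc r))) \<tau>)"
        by (simp add: c_def algebra_simps)
      also have "\<dots> = (4 * pi * (real r + 1) * hat_coeff K (Suc r)) * (2 * (1 / y ^ r * P r))"
        unfolding e3 by (simp only: mult_ac)
      also have "\<dots> = (real K + real r + 1) * (real K - real r) * t r"
        unfolding hat_coeff_Suc[OF r(1)] t_def c_def by (simp add: mult_ac)
      finally show "y\<^sup>2 * (c (Suc r) * (2 * real (Suc r) * qterm (Suc (Suc r)) (euler_coeff (a (Suc r))) \<tau>)) =
        (real K + real r + 1) * (real K - real r) * t r" .
    qed
    also have "\<dots> = (\<Sum>r\<le>K. (real K + real r + 1) * (real K - real r) * t r)"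
      using K' by simp
    finally show ?thesis .
  qed
  \<comment> \<open>The dependence on \<open>r\<close> disappears: r (r + 1) + (K + r + 1)(K - r) =
    K (K + 1).\<close>
  also have "(\<Sum>r\<le>K. real r * (real r + 1) * t r) + (\<Sum>r\<le>K. (real K + real r + 1) * (real K - real r) * t r) =
     real (Suc K) * real K * (\<Sum>r\<le>K. t r)"
    unfolding sum.distrib [symmetric] sum_distrib_left by (intro sum.cong) (auto simp: algebra_simps)
  also have "(\<Sum>r\<le>K. t r) = (\<Sum>r\<le>K. c r * qterm r (a r) \<tau>)"
    by (simp add: t_def qterm_def P_def y_def)
  finally have sums: "(\<Sum>r\<le>K. y\<^sup>2 * (c r * (real r * (real r + 1) * qterm (Suc (Suc r)) (a r) \<tau> + 2 * real r * qterm (Suc r) (euler_coeff (a r)) \<tau>)))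
     = real (Suc K) * real K * (\<Sum>r\<le>K. c r * qterm r (a r) \<tau>)" .
  have "\<phi>uu \<tau> + \<phi>vv \<tau> = \<alpha> * (real (Suc K) * (real K * y ^ (K - 1))) + \<beta> * (real K * real (Suc K) / y ^ Suc (Suc K)) +
     (\<Sum>r\<le>K. c r * (real r * (real r + 1) * qterm (Suc (Suc r)) (a r) \<tau> + 2 * real r * qterm (Suc r) (euler_coeff (a r)) \<tau>))"
  proof -
    have "(\<Sum>r\<le>K. c r * (real r * (real r + 1) * qterm (Suc (Suc r)) (a r) \<tau> + 2 * real r * qterm (Suc r) (euler_coeff (a r)) \<tau>)) =
      \<phi>uu \<tau> + (\<Sum>r\<le>K. c r * (- real r * (- real (Suc r) * qterm (Suc (Suc r)) (a r) \<tau> + - 1 * qterm (Suc r) (euler_coeff (a r)) \<tau>)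
        + - 1 * (- real r * qterm (Suc r) (euler_coeff (a r)) \<tau> + - 1 * qterm r (euler_coeff (euler_coeff (a r))) \<tau>)))"
      unfolding \<phi>uu_def sum.distrib [symmetric] by (intro sum.cong) (auto simp: algebra_simps)
    moreover have "- real K * (- real (Suc K) / Im \<tau> ^ Suc (Suc K)) = real K * real (Suc K) / Im \<tau> ^ Suc (Suc K)"
      by (simp del: of_nat_Suc)
    ultimately show ?thesis unfolding \<phi>vv_def y_def by (simp only: add_ac)
  qed
  then have "y\<^sup>2 * (\<phi>uu \<tau> + \<phi>vv \<tau>) = \<alpha> * (real (Suc K) * real K) * (y\<^sup>2 * y ^ (K - 1)) + \<beta> * (real K * real (Suc K)) * (y\<^sup>2 / y ^ Suc (Suc K)) +
     (\<Sum>r\<le>K. y\<^sup>2 * (c r * (real r * (real r + 1) * qterm (Suc (Suc r)) (a r) \<tau> + 2 * real r * qterm (Suc r) (euler_coeff (a r)) \<tau>)))"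
    unfolding sum_distrib_left [symmetric] by (simp add: distrib_left mult_ac del: of_nat_Suc)
  also have "\<dots> = real (Suc K) * real K * \<phi> \<tau>"
  proof -
    have "y\<^sup>2 * y ^ (K - 1) = y ^ Suc K" using K by (simp add: power_add [symmetric])
    moreover have "y\<^sup>2 / y ^ Suc (Suc K) = 1 / y ^ K" using y by (simp add: power2_eq_square)
    ultimately show ?thesis unfolding sums \<phi>_def y_def [symmetric] by (simp add: distrib_left mult_ac del: of_nat_Suc power_Suc)
  qed
  finally have "- y\<^sup>2 * (\<phi>uu \<tau> + \<phi>vv \<tau>) = - real (Suc K) * real K * \<phi> \<tau>"
    by (simp del: of_nat_Suc)
  then show ?thesis
    using hyperbolic_laplacian_of_real[OF f im u uu v vv] f[OF im] unfolding y_def by (simp del: of_nat_Suc)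
qed

subsection \<open>Real analyticity\<close>

definition real_analytic_at :: "(complex \<Rightarrow> complex) \<Rightarrow> complex \<Rightarrow> bool" where
  "real_analytic_at f z \<longleftrightarrow> (\<exists>r>0. \<exists>c :: nat \<Rightarrow> nat \<Rightarrow> complex. \<forall>w\<in>ball z r.
        ((\<lambda>(m, n). c m n * of_real (Re (w - z)) ^ m * of_real (Im (w - z)) ^ n) has_sum f w) UNIV)"

lemma real_analytic_on_iff: "real_analytic_on f S \<longleftrightarrow> (\<forall>z\<in>S. real_analytic_at f z)"
  unfolding real_analytic_on_def real_analytic_at_def ..

section \<open>Closure properties of real analyticity\<close>

lemma real_analytic_at_transform:
  assumes "real_analytic_at f z" "open S" "z \<in> S" "\<And>w. w \<in> S \<Longrightarrow> f w = g w"
  shows "real_analytic_at g z"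
proof -
  obtain r c where r: "r > 0" and c: "\<forall>w\<in>ball z r.
        ((\<lambda>(m, n). c m n * of_real (Re (w - z)) ^ m * of_real (Im (w - z)) ^ n) has_sum f w) UNIV"
    using assms(1) unfolding real_analytic_at_def by blast
  obtain e where e: "e > 0" "ball z e \<subseteq> S" using assms(2,3) open_contains_ball by blast
  show ?thesis
    unfolding real_analytic_at_def
  proof (rule exI[of _ "min r e"], intro conjI exI[of _ c] ballI)
    fix w assume "w \<in> ball z (min r e)"
    then have w: "w \<in> ball z r" "w \<in> S" using e by auto
    show "((\<lambda>(m, n). c m n * of_real (Re (w - z)) ^ m * of_real (Im (w - z)) ^ n) has_sum g w) UNIV"
      using c[rule_format, OF w(1)] unfolding assms(4)[OF w(2)] .
  qed (use r e in auto)
qed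

lemma real_analytic_at_add:
  assumes "real_analytic_at f z" "real_analytic_at g z"
  shows "real_analytic_at (\<lambda>w. f w + g w) z"
proof -
  obtain r c where r: "r > 0" and c: "\<forall>w\<in>ball z r.
        ((\<lambda>(m, n). c m n * of_real (Re (w - z)) ^ m * of_real (Im (w - z)) ^ n) has_sum f w) UNIV"
    using assms(1) unfolding real_analytic_at_def by blast
  obtain s d where s: "s > 0" and d: "\<forall>w\<in>ball z s.
        ((\<lambda>(m, n). d m n * of_real (Re (w - z)) ^ m * of_real (Im (w - z)) ^ n) has_sum g w) UNIV"
    using assms(2) unfolding real_analytic_at_def by blast
  show ?thesis
    unfolding real_analytic_at_def
  proof (rule exI[of _ "min r s"], intro conjI exI[of _ "\<lambda>m n. c m n + d m n"] ballI)
    fix w assume "w \<in> ball z (min r s)"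
    then have "w \<in> ball z r" "w \<in> ball z s" by auto
    from has_sum_add[OF c[rule_format, OF this(1)] d[rule_format, OF this(2)]]
    show "((\<lambda>(m, n). (c m n + d m n) * of_real (Re (w - z)) ^ m * of_real (Im (w - z)) ^ n) has_sum f w + g w) UNIV"
      by (simp add: case_prod_unfold distrib_right)
  qed (use r s in auto)
qed

lemma has_sum_prod_complex:
  fixes f :: "'a \<Rightarrow> complex" and g :: "'b \<Rightarrow> complex"
  assumes f: "(f has_sum a) A" and g: "(g has_sum b) B"
  shows "((\<lambda>(x, y). f x * g y) has_sum a * b) (A \<times> B)"
proof (rule has_sum_SigmaI[where g = "\<lambda>x. f x * b"])
  show "((\<lambda>y. case (x, y) of (x, y) \<Rightarrow> f x * g y) has_sum f x * b) B" for x
    using has_sum_cmult_right[OF g, of "f x"] by simp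
  show "((\<lambda>x. f x * b) has_sum a * b) A" by (rule has_sum_cmult_left[OF f])
  have nf: "(\<lambda>x. norm (f x)) summable_on A" and ng: "(\<lambda>x. norm (g x)) summable_on B"
    using f g summable_on_iff_abs_summable_on_complex has_sum_imp_summable by blast+
  obtain b' where b': "((\<lambda>x. norm (g x)) has_sum b') B" using ng by (auto simp: summable_on_def)
  have "(\<lambda>p. norm (case p of (x, y) \<Rightarrow> f x * g y)) summable_on A \<times> B"
    by (rule summable_on_SigmaI[where g = "\<lambda>x. norm (f x) * b'"])
       (auto simp: norm_mult intro: has_sum_cmult_right b' summable_on_cmult_left nf)
  then show "(\<lambda>(x, y). f x * g y) summable_on A \<times> B" by (rule abs_summable_summable)
qed

text \<open>The Cauchy product in two variables: \<open>h\<close> groups the pairs of monomials by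
  their total exponents, leaving finitely many pairs for each, and \<open>has_sum\<close> is
  unconditional.\<close>

lemma real_analytic_at_mult:
  assumes "real_analytic_at f z" "real_analytic_at g z"
  shows "real_analytic_at (\<lambda>w. f w * g w) z"
proof -
  obtain r c where r: "r > 0" and c: "\<forall>w\<in>ball z r.
        ((\<lambda>(m, n). c m n * of_real (Re (w - z)) ^ m * of_real (Im (w - z)) ^ n) has_sum f w) UNIV"
    using assms(1) unfolding real_analytic_at_def by blast
  obtain s d where s: "s > 0" and d: "\<forall>w\<in>ball z s.
        ((\<lambda>(m, n). d m n * of_real (Re (w - z)) ^ m * of_real (Im (w - z)) ^ n) has_sum g w) UNIV"
    using assms(2) unfolding real_analytic_at_def by blast
  define e where "e m n = (\<Sum>(i, j)\<in>{..m} \<times> {..n}. c i j * d (m - i) (n - j))" for m n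
  show ?thesis
    unfolding real_analytic_at_def
  proof (rule exI[of _ "min r s"], intro conjI exI[of _ e] ballI)
    fix w assume "w \<in> ball z (min r s)"
    then have w: "w \<in> ball z r" "w \<in> ball z s" by auto
    define x y where "x = complex_of_real (Re (w - z))" and "y = complex_of_real (Im (w - z))"
    define F where "F = (\<lambda>((i, j), (i', j')). c i j * x ^ i * y ^ j * (d i' j' * x ^ i' * y ^ j'))"
    define h where "h = (\<lambda>((i, j), (i', j')). ((i + i', j + j'), (i :: nat, j :: nat)))"
    define D where "D = Sigma UNIV (\<lambda>(m, n). {..m} \<times> {..n :: nat} :: (nat \<times> nat) set)"
    have F: "(F has_sum f w * g w) UNIV"
      using has_sum_prod_complex[OF c[rule_format, OF w(1)] d[rule_format, OF w(2)]]
      by (simp add: F_def x_def y_def case_prod_unfold)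
    have bij: "bij_betw h UNIV D"
      by (rule bij_betw_byWitness[where f' = "\<lambda>((m, n), (i, j)). ((i, j), (m - i, n - j))"])
         (auto simp: h_def D_def)
    define G where "G = (\<lambda>((m, n), (i, j)). c i j * d (m - i) (n - j) * x ^ m * y ^ n)"
    have "F p = G (h p)" for p
      by (cases p) (auto simp: F_def G_def h_def power_add mult_ac split: prod.splits)
    then have "F = (\<lambda>p. G (h p))" by (rule ext)
    then have "(G has_sum f w * g w) D"
      using has_sum_reindex_bij_betw[OF bij, of G] F by simp
    then have "((\<lambda>p. \<Sum>q\<in>(case p of (m, n) \<Rightarrow> {..m} \<times> {..n}). G (p, q)) has_sum f w * g w) UNIV"
      unfolding D_def by (rule has_sum_SigmaD) (auto intro!: has_sum_finite split: prod.splits)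
    also have "(\<lambda>p. \<Sum>q\<in>(case p of (m, n) \<Rightarrow> {..m} \<times> {..n}). G (p, q)) = (\<lambda>(m, n). e m n * x ^ m * y ^ n)"
      by (auto simp: fun_eq_iff G_def e_def sum_distrib_right case_prod_unfold)
    finally show "((\<lambda>(m, n). e m n * of_real (Re (w - z)) ^ m * of_real (Im (w - z)) ^ n) has_sum f w * g w) UNIV"
      by (simp add: x_def y_def)
  qed (use r s in auto)
qed

lemma real_analytic_at_cnj:
  assumes "real_analytic_at f z"
  shows "real_analytic_at (\<lambda>w. cnj (f w)) z"
proof -
  obtain r c where r: "r > 0" and c: "\<forall>w\<in>ball z r.
        ((\<lambda>(m, n). c m n * of_real (Re (w - z)) ^ m * of_real (Im (w - z)) ^ n) has_sum f w) UNIV"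
    using assms(1) unfolding real_analytic_at_def by blast
  show ?thesis
    unfolding real_analytic_at_def
  proof (rule exI[of _ r], intro conjI exI[of _ "\<lambda>m n. cnj (c m n)"] ballI)
    fix w assume "w \<in> ball z r"
    from c[rule_format, OF this]
    have "((\<lambda>p. cnj (case p of (m, n) \<Rightarrow> c m n * of_real (Re (w - z)) ^ m * of_real (Im (w - z)) ^ n)) has_sum cnj (f w)) UNIV"
      by (subst has_sum_cnj_iff) simp
    then show "((\<lambda>(m, n). cnj (c m n) * of_real (Re (w - z)) ^ m * of_real (Im (w - z)) ^ n) has_sum cnj (f w)) UNIV"
      by (simp add: case_prod_unfold)
  qed (use r in auto)
qed

text \<open>Each power of w - z = x + i y is expanded binomially. Absolute convergence of the
  resulting double series is governed by |x| + |y| instead of the modulus, which is why the radius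
  is halved.\<close>

lemma real_analytic_at_holomorphic:
  assumes "f holomorphic_on S" "open S" "z \<in> S"
  shows "real_analytic_at f z"
proof -
  obtain R where R: "R > 0" "ball z R \<subseteq> S" using assms(2,3) open_contains_ball by blast
  define a where "a n = (deriv ^^ n) f z / fact n" for n
  have a: "(\<lambda>n. a n * (w - z) ^ n) sums f w" if "w \<in> ball z R" for w
    unfolding a_def using holomorphic_power_series[OF holomorphic_on_subset[OF assms(1) R(2)] that] .
  define c where "c m n = a (m + n) * of_nat ((m + n) choose n) * \<i> ^ n" for m n
  show ?thesis
    unfolding real_analytic_at_def
  proof (rule exI[of _ "R / 2"], intro conjI exI[of _ c] ballI)
    fix w assume w: "w \<in> ball z (R / 2)"
    define x y where "x = Re (w - z)" and "y = Im (w - z)"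
    define s where "s = \<bar>x\<bar> + \<bar>y\<bar>"
    have "\<bar>x\<bar> \<le> norm (w - z)" "\<bar>y\<bar> \<le> norm (w - z)"
      unfolding x_def y_def by (rule abs_Re_le_cmod, rule abs_Im_le_cmod)
    then have s: "0 \<le> s" "s < R" using w by (auto simp: s_def dist_norm norm_minus_commute)
    obtain t where t: "s < t" "t < R" using s(2) dense by blast
    have "summable (\<lambda>n. a n * complex_of_real t ^ n)"
      using a[of "z + of_real t"] t s by (simp add: dist_norm sums_iff)
    then have "summable (\<lambda>n. norm (a n * complex_of_real s ^ n))"
      by (rule powser_insidea) (use s t in auto)
    then have sm: "summable (\<lambda>n. norm (a n) * s ^ n)" using s by (simp add: norm_mult norm_power)
    define F where "F = (\<lambda>(N, n). a N * of_nat (N choose n) * \<i> ^ n * of_real x ^ (N - n) * of_real y ^ n)"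
    define D where "D = Sigma UNIV (\<lambda>N :: nat. {..N})"
    have row: "(\<Sum>n\<le>N. F (N, n)) = a N * (w - z) ^ N" for N
    proof -
      have "w - z = \<i> * of_real y + of_real x" by (simp add: x_def y_def complex_eq_iff)
      then have "(w - z) ^ N = (\<Sum>n\<le>N. of_nat (N choose n) * (\<i> * of_real y) ^ n * of_real x ^ (N - n))"
        by (simp add: binomial_ring)
      then show ?thesis by (simp add: F_def sum_distrib_left power_mult_distrib mult_ac)
    qed
    have nrow: "(\<Sum>n\<le>N. norm (F (N, n))) = norm (a N) * s ^ N" for N
    proof -
      have "s ^ N = (\<Sum>n\<le>N. of_nat (N choose n) * \<bar>y\<bar> ^ n * \<bar>x\<bar> ^ (N - n))"
        unfolding s_def by (subst add.commute) (simp add: binomial_ring)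
      then show ?thesis by (simp add: F_def sum_distrib_left norm_mult norm_power mult_ac)
    qed
    have "(\<lambda>p. norm (F p)) summable_on D"
      unfolding D_def
    proof (rule summable_on_SigmaI)
      show "((\<lambda>n. norm (F (N, n))) has_sum norm (a N) * s ^ N) {..N}" for N
        unfolding nrow [symmetric] by (rule has_sum_finite) simp
      show "(\<lambda>N. norm (a N) * s ^ N) summable_on UNIV"
        using sm s by (subst summable_on_UNIV_nonneg_real_iff) auto
    qed auto
    then have FD: "F summable_on D" by (rule abs_summable_summable)
    have "w \<in> ball z R" using w R by auto
    have "(\<lambda>N. norm (a N * (w - z) ^ N)) summable_on UNIV"
    proof (subst summable_on_UNIV_nonneg_real_iff)
      show "summable (\<lambda>N. norm (a N * (w - z) ^ N))"
      proof (rule summable_comparison_test'[OF sm, of 0])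
        fix N
        have "norm (w - z) \<le> s" unfolding s_def x_def y_def by (rule cmod_le)
        then show "norm (norm (a N * (w - z) ^ N)) \<le> norm (a N) * s ^ N"
          by (simp add: norm_mult norm_power mult_left_mono power_mono)
      qed
    qed auto
    then have "((\<lambda>N. a N * (w - z) ^ N) has_sum f w) UNIV"
      using a[OF \<open>w \<in> ball z R\<close>] by (intro norm_summable_imp_has_sum) (auto simp: summable_on_UNIV_nonneg_real_iff)
    then have "(F has_sum f w) D"
      unfolding D_def using FD[unfolded D_def]
      by (intro has_sum_SigmaI[where g = "\<lambda>N. a N * (w - z) ^ N"]) (auto simp: row [symmetric] intro!: has_sum_finite)
    moreover have "bij_betw (\<lambda>(m, n). (m + n, n)) UNIV D"
      by (rule bij_betw_byWitness[where f' = "\<lambda>(N, n). (N - n, n)"]) (auto simp: D_def)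
    ultimately have "((\<lambda>p. F (case p of (m, n) \<Rightarrow> (m + n, n))) has_sum f w) UNIV"
      by (subst has_sum_reindex_bij_betw)
    then show "((\<lambda>(m, n). c m n * of_real (Re (w - z)) ^ m * of_real (Im (w - z)) ^ n) has_sum f w) UNIV"
      by (simp add: F_def c_def x_def y_def case_prod_unfold)
  qed (use R in auto)
qed

lemma real_analytic_at_const: "real_analytic_at (\<lambda>_. c) z"
  by (rule real_analytic_at_holomorphic[of _ UNIV]) auto

lemma real_analytic_at_power:
  "real_analytic_at f z \<Longrightarrow> real_analytic_at (\<lambda>w. f w ^ n) z"
  by (induction n) (auto intro: real_analytic_at_const real_analytic_at_mult)

lemma real_analytic_at_sum:
  "finite A \<Longrightarrow> (\<And>i. i \<in> A \<Longrightarrow> real_analytic_at (f i) z) \<Longrightarrow> real_analytic_at (\<lambda>w. \<Sum>i\<in>A. f i w) z"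
  by (induction A rule: finite_induct) (auto intro: real_analytic_at_const real_analytic_at_add)

lemma real_analytic_at_Im: "real_analytic_at (\<lambda>w. of_real (Im w)) z"
proof -
  have "real_analytic_at (\<lambda>w. - \<i> / 2 * w + cnj (- \<i> / 2 * w)) z"
    by (intro real_analytic_at_add real_analytic_at_cnj real_analytic_at_holomorphic[of _ UNIV] holomorphic_intros) auto
  then show ?thesis by (rule real_analytic_at_transform[of _ _ UNIV]) (auto simp: complex_eq_iff)
qed

text \<open>A geometric series in the vertical displacement alone, so only the exponent 0 of the
  horizontal one occurs; in a ball of radius \<open>Im z\<close> its ratio is less than 1 in
  modulus.\<close>

lemma real_analytic_at_inverse_Im:
  assumes "Im z > 0"
  shows "real_analytic_at (\<lambda>w. 1 / of_real (Im w)) z"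
proof -
  define v where "v = Im z"
  have v: "v > 0" using assms by (simp add: v_def)
  define c where "c m n = (if m = 0 then complex_of_real ((-1) ^ n / v ^ Suc n) else 0)" for m n :: nat
  show ?thesis
    unfolding real_analytic_at_def
  proof (rule exI[of _ v], intro conjI exI[of _ c] ballI)
    fix w assume w: "w \<in> ball z v"
    define y where "y = Im (w - z)"
    have "\<bar>y\<bar> \<le> norm (w - z)" unfolding y_def by (rule abs_Im_le_cmod)
    then have y: "\<bar>- y / v\<bar> < 1" using w v by (simp add: dist_norm norm_minus_commute)
    have Imw: "Im w = v + y" by (simp add: v_def y_def)
    have "(\<lambda>n. 1 / v * (- y / v) ^ n) sums (1 / v * (1 / (1 - - y / v)))"
      using y by (intro sums_mult geometric_sums) simp
    moreover have "1 / v * (1 / (1 - - y / v)) = 1 / Im w"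
      using v by (simp add: Imw field_simps)
    moreover have "summable (\<lambda>n. norm (1 / v * (- y / v) ^ n))"
    proof -
      have "summable (\<lambda>n. norm (1 / v) * \<bar>- y / v\<bar> ^ n)"
        using y by (intro summable_mult summable_geometric) simp
      then show ?thesis by (simp only: abs_mult power_abs real_norm_def)
    qed
    ultimately have "((\<lambda>n. 1 / v * (- y / v) ^ n) has_sum 1 / Im w) UNIV"
      by (intro norm_summable_imp_has_sum) simp_all
    then have "((\<lambda>n. complex_of_real (1 / v * (- y / v) ^ n)) has_sum of_real (1 / Im w)) UNIV"
      by (rule has_sum_of_real)
    also have "(\<lambda>n. complex_of_real (1 / v * (- y / v) ^ n)) = (\<lambda>n. c 0 n * of_real (Re (w - z)) ^ 0 * of_real y ^ n)"
      by (simp add: c_def fun_eq_iff power_divide power_minus[of "complex_of_real y / complex_of_real v"])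
    finally have "((\<lambda>(m, n). c m n * of_real (Re (w - z)) ^ m * of_real y ^ n) has_sum of_real (1 / Im w)) (range (\<lambda>n. (0, n)))"
      by (subst has_sum_reindex) (auto simp: inj_on_def o_def)
    then have "((\<lambda>(m, n). c m n * of_real (Re (w - z)) ^ m * of_real y ^ n) has_sum of_real (1 / Im w)) UNIV"
      by (rule has_sum_cong_neutral[THEN iffD1, rotated -1]) (auto simp: c_def)
    then show "((\<lambda>(m, n). c m n * of_real (Re (w - z)) ^ m * of_real (Im (w - z)) ^ n) has_sum 1 / of_real (Im w)) UNIV"
      by (simp add: y_def)
  qed (use v in auto)
qed

lemma qsum_holomorphic: "disc_summable a \<Longrightarrow> qsum a holomorphic_on upper_half_plane"
  using qsum_has_field_derivative
  unfolding holomorphic_on_def field_differentiable_def upper_half_plane_def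
  by (blast intro: has_field_derivative_at_within)

lemma open_upper_half_plane: "open upper_half_plane"
  unfolding upper_half_plane_def by (rule open_halfspace_Im_gt)

lemma real_analytic_on_g_hat:
  assumes K: "K \<ge> 1"
  shows "real_analytic_on (g_hat (Suc K)) upper_half_plane"
  unfolding real_analytic_on_iff
proof
  fix z assume z: "z \<in> upper_half_plane"
  obtain \<alpha> \<beta> where ex: "\<And>\<tau>. Im \<tau> > 0 \<Longrightarrow> g_hat (Suc K) \<tau> =
    of_real (\<alpha> * Im \<tau> ^ Suc K + \<beta> / Im \<tau> ^ K + (\<Sum>r\<le>K. hat_coeff K r / Im \<tau> ^ r * (2 * Re (alt_series K r \<tau>))))"
    using g_hat_expansion[OF K] by blast
  define f where "f \<tau> = of_real \<alpha> * of_real (Im \<tau>) ^ Suc K + of_real \<beta> * (1 / of_real (Im \<tau>)) ^ K +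
    (\<Sum>r\<le>K. of_real (hat_coeff K r) * (1 / of_real (Im \<tau>)) ^ r * (alt_series K r \<tau> + cnj (alt_series K r \<tau>)))" for \<tau>
  have "real_analytic_at (alt_series K r) z" if "r \<le> K" for r
    unfolding alt_series_def
    by (rule real_analytic_at_holomorphic[OF qsum_holomorphic[OF disc_summable_alt_coeff[OF that]] open_upper_half_plane z])
  then have "real_analytic_at f z"
    unfolding f_def [abs_def] using z
    by (intro real_analytic_at_add real_analytic_at_mult real_analytic_at_const real_analytic_at_power
        real_analytic_at_Im real_analytic_at_inverse_Im real_analytic_at_sum real_analytic_at_cnj)
       (auto simp: upper_half_plane_def)
  then show "real_analytic_at (g_hat (Suc K)) z"
  proof (rule real_analytic_at_transform[OF _ open_upper_half_plane z])
    fix w assume "w \<in> upper_half_plane"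
    then have "Im w > 0" by (simp add: upper_half_plane_def)
    then show "f w = g_hat (Suc K) w"
      unfolding f_def ex[OF \<open>Im w > 0\<close>] complex_add_cnj by (simp add: power_divide)
  qed
qed

subsection \<open>Modularity and growth at the cusps\<close>

lemma SL2Z_vector: "vector [vector [a, b], vector [c, d]] \<in> SL2Z \<longleftrightarrow> a * d - b * c = 1"
  by (simp add: SL2Z_det)

lemma modular_act_vector:
  "modular_act (vector [vector [a, b], vector [c, d]]) \<tau> =
     (of_int a * \<tau> + of_int b) / (of_int c * \<tau> + of_int d)"
  by (simp add: modular_act_def moebius_def)

text \<open>The matrix diag(2, 1) \<open>A\<close> has determinant 2 and factors as a modular matrix
  times one of the three Hecke representatives. The parities of the second row of \<open>A\<close>
  decide which one; an even lower left entry gives doubling.\<close>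

lemma twice_modular_act:
  assumes A: "A \<in> SL2Z" and im: "Im \<tau> > 0"
  shows "even (A $ 2 $ 1) \<Longrightarrow> \<exists>B\<in>SL2Z. 2 * modular_act A \<tau> = modular_act B (2 * \<tau>)"
    and "\<exists>B\<in>SL2Z. 2 * modular_act A \<tau> = modular_act B (2 * \<tau>) \<or>
            2 * modular_act A \<tau> = modular_act B (\<tau> / 2) \<or>
            2 * modular_act A \<tau> = modular_act B ((\<tau> + 1) / 2)"
proof -
  define a b c d where "a = A $ 1 $ 1" "b = A $ 1 $ 2" "c = A $ 2 $ 1" "d = A $ 2 $ 2"
  have det: "a * d - b * c = 1" using A by (simp add: SL2Z_det a_b_c_d_def)
  have act: "modular_act A \<tau> = (of_int a * \<tau> + of_int b) / (of_int c * \<tau> + of_int d)"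
    by (simp add: modular_act_def moebius_def a_b_c_d_def)
  have even: "\<exists>B\<in>SL2Z. 2 * modular_act A \<tau> = modular_act B (2 * \<tau>)" if ev: "even c"
  proof -
    obtain c' where c: "c = 2 * c'" using ev by blast
    show ?thesis
      by (rule bexI[of _ "vector [vector [a, 2 * b], vector [c', d]]"])
         (use det in \<open>auto simp: act SL2Z_vector modular_act_vector c algebra_simps\<close>)
  qed
  then show "even (A $ 2 $ 1) \<Longrightarrow> \<exists>B\<in>SL2Z. 2 * modular_act A \<tau> = modular_act B (2 * \<tau>)"
    by (simp add: a_b_c_d_def)
  have "even c \<or> even d \<or> even (d - c)" by auto
  then consider "even c" | "even d" | "even (d - c)" by blast
  then show "\<exists>B\<in>SL2Z. 2 * modular_act A \<tau> = modular_act B (2 * \<tau>) \<or>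
            2 * modular_act A \<tau> = modular_act B (\<tau> / 2) \<or>
            2 * modular_act A \<tau> = modular_act B ((\<tau> + 1) / 2)"
  proof cases
    case 1
    then show ?thesis using even by blast
  next
    case 2
    then obtain d' where d: "d = 2 * d'" by blast
    have h: "of_int c * (\<tau> / 2) + of_int d' = (of_int c * \<tau> + of_int d) / 2"
      "of_int (2 * a) * (\<tau> / 2) + of_int b = of_int a * \<tau> + of_int b"
      by (simp_all add: d field_simps)
    have "modular_act (vector [vector [2 * a, b], vector [c, d']]) (\<tau> / 2) = 2 * modular_act A \<tau>"
      unfolding modular_act_vector act h by simp
    moreover have "vector [vector [2 * a, b], vector [c, d']] \<in> SL2Z"
      using det unfolding SL2Z_vector d by (simp add: mult_ac)
    ultimately show ?thesis by metis
  next
    case 3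
    then obtain e where "d - c = 2 * e" by blast
    then have d: "d = c + 2 * e" by simp
    have h: "of_int c * ((\<tau> + 1) / 2) + of_int e = (of_int c * \<tau> + of_int d) / 2"
      "of_int (2 * a) * ((\<tau> + 1) / 2) + of_int (b - a) = of_int a * \<tau> + of_int b"
      by (simp_all add: d field_simps)
    have "modular_act (vector [vector [2 * a, b - a], vector [c, e]]) ((\<tau> + 1) / 2) = 2 * modular_act A \<tau>"
      unfolding modular_act_vector act h by simp
    moreover have "vector [vector [2 * a, b - a], vector [c, e]] \<in> SL2Z"
      using det unfolding SL2Z_vector d by (simp add: algebra_simps)
    ultimately show ?thesis by metis
  qed
qed

lemma g_hat_modular:
  assumes K: "K \<ge> 1" and A: "A \<in> Gamma0 2" and im: "Im \<tau> > 0"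
  shows "g_hat (Suc K) (modular_act A \<tau>) = g_hat (Suc K) \<tau>"
proof -
  have A': "A \<in> SL2Z" "even (A $ 2 $ 1)" using A by (auto simp: Gamma0_def)
  obtain B where B: "B \<in> SL2Z" "2 * modular_act A \<tau> = modular_act B (2 * \<tau>)"
    using twice_modular_act(1)[OF A'(1) im A'(2)] by blast
  show ?thesis
    unfolding g_hat_prefactor B(2)
    using maass_eisenstein_modular[OF K A'(1) im] maass_eisenstein_modular[OF K B(1), of "2 * \<tau>"] im by simp
qed

text \<open>The height 1/2 is chosen for the cusps: it is the least height to which the Hecke
  representatives move a point with \<open>Im \<tau> \<ge> 1\<close>. There the nome is at most
  e^(-pi) in modulus.\<close>

lemma qsum_bounded:
  assumes a: "disc_summable a"
  shows "\<exists>B. \<forall>\<tau>. Im \<tau> \<ge> 1 / 2 \<longrightarrow> norm (qsum a \<tau>) \<le> B"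
proof -
  define x where "x = exp (- pi)"
  have x: "0 < x" "x < 1" by (simp_all add: x_def)
  have sm: "summable (\<lambda>n. norm (a n * complex_of_real x ^ Suc n))"
    by (rule disc_summableD_Suc_norm[OF a]) (use x in simp)
  have "norm (qsum a \<tau>) \<le> (\<Sum>n. norm (a n * complex_of_real x ^ Suc n))" if "Im \<tau> \<ge> 1 / 2" for \<tau>
    unfolding qsum_def
  proof (rule norm_suminf_le[OF _ sm])
    fix n
    have "norm (nome \<tau>) \<le> x" using that by (simp add: norm_nome x_def)
    then have "norm (nome \<tau>) ^ Suc n \<le> x ^ Suc n" by (intro power_mono) auto
    then show "norm (a n * nome \<tau> ^ Suc n) \<le> norm (a n * complex_of_real x ^ Suc n)"
      using x by (simp add: norm_mult norm_power mult_left_mono del: power_Suc)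
  qed
  then show ?thesis by blast
qed

text \<open>Since 1 / v \<le> 2, all negative powers of the height are bounded and only the outer
  factor v^k can grow.\<close>

lemma maass_eisenstein_bounded:
  assumes K: "K \<ge> 1"
  shows "\<exists>M\<ge>0. \<forall>\<tau>. Im \<tau> \<ge> 1 / 2 \<longrightarrow> norm (maass_eisenstein \<tau> (of_nat (Suc K))) \<le> M * Im \<tau> ^ Suc K"
proof -
  obtain \<beta> where \<beta>: "\<And>\<tau>. Im \<tau> > 0 \<Longrightarrow> maass_eisenstein \<tau> (of_nat (Suc K)) =
    of_real ((zeta_even K + \<beta> / Im \<tau> ^ (2 * K + 1) +
       (\<Sum>r\<le>K. bessel_coeff K r / Im \<tau> ^ (K + 1 + r) * (2 * Re (eis_series K r \<tau>)))) / zeta_even K * Im \<tau> ^ Suc K)"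
    using maass_eisenstein_expansion[OF K] by blast
  have "\<forall>r\<in>{..K}. \<exists>B. \<forall>\<tau>. Im \<tau> \<ge> 1 / 2 \<longrightarrow> norm (eis_series K r \<tau>) \<le> B"
    unfolding eis_series_def using qsum_bounded disc_summable_eis by simp
  then obtain B where B: "\<And>r \<tau>. r \<le> K \<Longrightarrow> Im \<tau> \<ge> 1 / 2 \<Longrightarrow> norm (eis_series K r \<tau>) \<le> B r"
    unfolding bchoice_iff by auto
  define M where "M = (\<bar>zeta_even K\<bar> + \<bar>\<beta>\<bar> * 2 ^ (2 * K + 1) + (\<Sum>r\<le>K. \<bar>bessel_coeff K r\<bar> * 2 ^ (K + 1 + r) * (2 * \<bar>B r\<bar>))) / zeta_even K"
  have M: "M \<ge> 0" unfolding M_def using zeta_even_pos[of K] by (intro divide_nonneg_pos add_nonneg_nonneg sum_nonneg) auto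
  have "norm (maass_eisenstein \<tau> (of_nat (Suc K))) \<le> M * Im \<tau> ^ Suc K" if im: "Im \<tau> \<ge> 1 / 2" for \<tau>
  proof -
    define v where "v = Im \<tau>"
    have v: "v > 0" "v \<ge> 1 / 2" using im by (simp_all add: v_def)
    have inv: "1 / v ^ n \<le> 2 ^ n" for n
    proof -
      have "(1 / v) ^ n \<le> 2 ^ n" using v by (intro power_mono) (auto simp: field_simps)
      then show ?thesis by (simp add: power_divide)
    qed
    have *: "\<bar>x / v ^ n * y\<bar> \<le> \<bar>x\<bar> * 2 ^ n * \<bar>y\<bar>" for x y n
    proof -
      have "\<bar>x / v ^ n * y\<bar> = \<bar>x\<bar> * (1 / v ^ n) * \<bar>y\<bar>" using v by (simp add: abs_mult)
      also have "\<dots> \<le> \<bar>x\<bar> * 2 ^ n * \<bar>y\<bar>" by (intro mult_right_mono mult_left_mono inv) auto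
      finally show ?thesis .
    qed
    have "\<bar>zeta_even K + \<beta> / v ^ (2 * K + 1) + (\<Sum>r\<le>K. bessel_coeff K r / v ^ (K + 1 + r) * (2 * Re (eis_series K r \<tau>)))\<bar>
      \<le> \<bar>zeta_even K\<bar> + \<bar>\<beta> / v ^ (2 * K + 1) * 1\<bar> + (\<Sum>r\<le>K. \<bar>bessel_coeff K r / v ^ (K + 1 + r) * (2 * Re (eis_series K r \<tau>))\<bar>)"
      using sum_abs[of "\<lambda>r. bessel_coeff K r / v ^ (K + 1 + r) * (2 * Re (eis_series K r \<tau>))" "{..K}"] by linarith
    also have "\<dots> \<le> \<bar>zeta_even K\<bar> + \<bar>\<beta>\<bar> * 2 ^ (2 * K + 1) * \<bar>1\<bar> + (\<Sum>r\<le>K. \<bar>bessel_coeff K r\<bar> * 2 ^ (K + 1 + r) * (2 * \<bar>B r\<bar>))"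
    proof (intro add_mono order_refl * sum_mono)
      fix r assume "r \<in> {..K}"
      then have "\<bar>Re (eis_series K r \<tau>)\<bar> \<le> B r"
        using B[of r \<tau>] im abs_Re_le_cmod[of "eis_series K r \<tau>"] by simp
      then have "\<bar>2 * Re (eis_series K r \<tau>)\<bar> \<le> 2 * \<bar>B r\<bar>" by simp
      then have "\<bar>bessel_coeff K r\<bar> * 2 ^ (K + 1 + r) * \<bar>2 * Re (eis_series K r \<tau>)\<bar> \<le> \<bar>bessel_coeff K r\<bar> * 2 ^ (K + 1 + r) * (2 * \<bar>B r\<bar>)"
        by (intro mult_left_mono) auto
      then show "\<bar>bessel_coeff K r / v ^ (K + 1 + r) * (2 * Re (eis_series K r \<tau>))\<bar> \<le> \<bar>bessel_coeff K r\<bar> * 2 ^ (K + 1 + r) * (2 * \<bar>B r\<bar>)"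
        using *[of "bessel_coeff K r" "K + 1 + r" "2 * Re (eis_series K r \<tau>)"] by linarith
    qed
    finally have "\<bar>zeta_even K + \<beta> / v ^ (2 * K + 1) + (\<Sum>r\<le>K. bessel_coeff K r / v ^ (K + 1 + r) * (2 * Re (eis_series K r \<tau>)))\<bar> / zeta_even K \<le> M"
      unfolding M_def using zeta_even_pos[of K] by (intro divide_right_mono) auto
    then have "\<bar>zeta_even K + \<beta> / v ^ (2 * K + 1) + (\<Sum>r\<le>K. bessel_coeff K r / v ^ (K + 1 + r) * (2 * Re (eis_series K r \<tau>)))\<bar> / zeta_even K * v ^ Suc K \<le> M * v ^ Suc K"
      using v by (intro mult_right_mono) auto
    then show ?thesis
      unfolding \<beta>[OF v(1)[unfolded v_def]] norm_of_real abs_mult abs_divide v_def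
      using zeta_even_pos[of K] v unfolding v_def by (simp del: power_Suc)
  qed
  then show ?thesis using M by blast
qed

text \<open>After moving both Eisenstein values back by invariance, their arguments have heights
  between 1/2 and twice \<open>Im \<tau>\<close>. The growth is thus polynomial of degree k, and v
  \<le> e^v turns it into an exponential bound with rate k.\<close>

lemma g_hat_growth:
  assumes K: "K \<ge> 1"
  shows "linear_exponential_growth_at_cusps (g_hat (Suc K))"
  unfolding linear_exponential_growth_at_cusps_def
proof
  fix A assume A: "A \<in> SL2Z"
  define E where "E \<tau> = maass_eisenstein \<tau> (of_nat (Suc K))" for \<tau>
  obtain M where M: "M \<ge> 0" "\<And>\<tau>. Im \<tau> \<ge> 1 / 2 \<Longrightarrow> norm (E \<tau>) \<le> M * Im \<tau> ^ Suc K"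
    using maass_eisenstein_bounded[OF K] unfolding E_def by blast
  define c where "c = fact K * zeta_even K / pi ^ Suc K"
  define N where "N = \<bar>c\<bar> * (M + 2 ^ Suc K * (M * 2 ^ Suc K))"
  have "norm (g_hat (Suc K) (modular_act A \<tau>)) \<le> N * exp (real (Suc K) * Im \<tau>)" if im: "Im \<tau> \<ge> 1" for \<tau>
  proof -
    have im0: "Im \<tau> > 0" using im by simp
    have E1: "norm (E (modular_act A \<tau>)) \<le> M * Im \<tau> ^ Suc K"
      using maass_eisenstein_modular[OF K A im0] M(2)[of \<tau>] im by (simp add: E_def)
    have E2: "norm (E (2 * modular_act A \<tau>)) \<le> M * (2 * Im \<tau>) ^ Suc K"
    proof -
      have "\<exists>\<sigma>. Im \<sigma> \<ge> 1 / 2 \<and> Im \<sigma> \<le> 2 * Im \<tau> \<and> E (2 * modular_act A \<tau>) = E \<sigma>"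
      proof -
        obtain B \<sigma> where B: "B \<in> SL2Z" "2 * modular_act A \<tau> = modular_act B \<sigma>" "\<sigma> \<in> {2 * \<tau>, \<tau> / 2, (\<tau> + 1) / 2}"
          using twice_modular_act(2)[OF A im0] by blast
        from B(3) have "Im \<sigma> = 2 * Im \<tau> \<or> Im \<sigma> = Im \<tau> / 2"
          by (elim insertE emptyE; hypsubst; simp)
        then have "Im \<sigma> \<ge> 1 / 2" "Im \<sigma> \<le> 2 * Im \<tau>" using im by auto
        moreover from this have "E (modular_act B \<sigma>) = E \<sigma>"
          unfolding E_def by (intro maass_eisenstein_modular[OF K B(1)]) simp
        ultimately show ?thesis using B(2) by auto
      qed
      then obtain \<sigma> where s: "Im \<sigma> \<ge> 1 / 2" "Im \<sigma> \<le> 2 * Im \<tau>" "E (2 * modular_act A \<tau>) = E \<sigma>" by blast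
      have "norm (E \<sigma>) \<le> M * Im \<sigma> ^ Suc K" by (rule M(2)[OF s(1)])
      also have "\<dots> \<le> M * (2 * Im \<tau>) ^ Suc K"
        using s M(1) by (intro mult_left_mono power_mono) auto
      finally show ?thesis using s by simp
    qed
    have "norm (g_hat (Suc K) (modular_act A \<tau>)) = \<bar>c\<bar> * norm (E (modular_act A \<tau>) - 2 ^ Suc K * E (2 * modular_act A \<tau>))"
      unfolding g_hat_prefactor E_def c_def norm_mult norm_of_real ..
    also have "\<dots> \<le> \<bar>c\<bar> * (norm (E (modular_act A \<tau>)) + norm (2 ^ Suc K * E (2 * modular_act A \<tau>)))"
      by (intro mult_left_mono norm_triangle_ineq4) auto
    also have "norm (2 ^ Suc K * E (2 * modular_act A \<tau>)) = 2 ^ Suc K * norm (E (2 * modular_act A \<tau>))"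
      by (simp add: norm_mult norm_power)
    also have "\<bar>c\<bar> * (norm (E (modular_act A \<tau>)) + 2 ^ Suc K * norm (E (2 * modular_act A \<tau>))) \<le>
       \<bar>c\<bar> * (M * Im \<tau> ^ Suc K + 2 ^ Suc K * (M * (2 * Im \<tau>) ^ Suc K))"
      by (intro mult_left_mono add_mono E1 E2) auto
    also have "\<dots> = N * Im \<tau> ^ Suc K"
      by (simp add: N_def power_mult_distrib algebra_simps)
    also have "\<dots> \<le> N * exp (real (Suc K) * Im \<tau>)"
    proof (rule mult_left_mono)
      have "Im \<tau> \<le> exp (Im \<tau>)" using exp_ge_add_one_self[of "Im \<tau>"] by linarith
      then have "Im \<tau> ^ Suc K \<le> exp (Im \<tau>) ^ Suc K" using im by (intro power_mono) auto
      then show "Im \<tau> ^ Suc K \<le> exp (real (Suc K) * Im \<tau>)" by (simp only: exp_of_nat_mult)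
      show "N \<ge> 0" unfolding N_def using M(1) by simp
    qed
    finally show ?thesis .
  qed
  then show "\<exists>C M V. 0 < V \<and> (\<forall>\<tau>. V \<le> Im \<tau> \<longrightarrow> norm (g_hat (Suc K) (modular_act A \<tau>)) \<le> M * exp (C * Im \<tau>))"
    by (intro exI[of _ "real (Suc K)"] exI[of _ N] exI[of _ 1]) auto
qed

theorem theorem1p3:
  fixes k :: nat
  assumes "k \<ge> 2"
  shows "is_holomorphic_part k (g_hat k) (\<lambda>\<tau>. g_series k (nome \<tau>)) \<and>
         maass_form_weight_0 2 (of_nat k * (1 - of_nat k)) (g_hat k)"
proof -
  obtain K where k: "k = Suc K" and K: "K \<ge> 1" using assms by (cases k) auto
  have "hyperbolic_laplacian (g_hat k) \<tau> = of_nat k * (1 - of_nat k) * g_hat k \<tau>" if "Im \<tau> > 0" for \<tau>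
    using hyperbolic_laplacian_g_hat[OF K that] by (simp add: k algebra_simps)
  then show ?thesis
    using is_holomorphic_part_g_hat[OF K] real_analytic_on_g_hat[OF K] g_hat_modular[OF K] g_hat_growth[OF K]
    by (auto simp: maass_form_weight_0_def k upper_half_plane_def)
qed

end
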